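(* Let $\Delta$ be a simplicial complex on the vertex set $[n]=\{1,\ldots,n\}$, let $h$ be an integer, and let $\mathbb{k}$ be a field such that $\Delta$ is a vertex minimal $h$-cycle with respect to $\mathbb{k}$, i.e. for every subset $T\subseteq[n]$ one has $\widetilde{H}_h(\Delta|_T;\mathbb{k})\neq 0$ if and only if $T=[n]$. Let $T\subseteq[n]$ be a set of vertices of $\Delta$ such that $\Delta|_T$ is disconnected. Then $\operatorname{reg}(\mathbb{k}[\Delta|_{[n]\setminus T}])\geq h$.
   Context: For $T\subseteq[n]$, the restriction $\Delta|_T$ is the simplicial complex of all faces $\sigma\in\Delta$ with $\sigma\subseteq T$, regarded as a complex on vertex set $T$. $\widetilde{H}_i(\,\cdot\,;\mathbb{k})$ denotes reduced simplicial homology over $\mathbb{k}$. For a simplicial complex $\Gamma$ on vertex set $V$, $\mathbb{k}[\Gamma]=S/I_\Gamma$ is its Stanley–Reisner ring, where $S=\mathbb{k}[x_v : v\in V]$ and $I_\Gamma$ is the ideal generated by the squarefree monomials $x_{v_1}\cdots x_{v_t}$ with $\{v_1,\ldots,v_t\}\notin\Gamma$. For a finitely generated graded $S$-module $M$ with graded Betti numbers $\beta_{i,j}(M)$ (from a minimal graded free resolution), the Castelnuovo–Mumford regularity is $\operatorname{reg}(M)=\max\{j-i : \beta_{i,j}(M)\neq 0\}$. *)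

theory Defs
  imports
    "HOL-Algebra.Module"
    "HOL-Algebra.QuotRing"
    "HOL-Algebra.Elementary_Groups"
    "HOL-Library.Poly_Mapping"
    "HOL-Library.Extended_Real"
begin

section \<open>Simplicial complexes and reduced homology\<close>

text \<open>
  A point of the vertex set need not be a face, and the void complex is allowed. A vertex
  minimal cycle (see below) automatically contains every point of its vertex set and is not void,
  since a non-face point could be removed from the vertex set without changing the homology.
\<close>

definition simplicial_complex_on :: "'v set \<Rightarrow> 'v set set \<Rightarrow> bool" where
  "simplicial_complex_on V \<Delta> \<longleftrightarrow>
     finite V \<and> \<Delta> \<subseteq> Pow V \<and> (\<forall>\<sigma>\<in>\<Delta>. \<forall>\<tau>. \<tau> \<subseteq> \<sigma> \<longrightarrow> \<tau> \<in> \<Delta>)"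

definition restriction :: "'v set set \<Rightarrow> 'v set \<Rightarrow> 'v set set" where
  "restriction \<Delta> T = {\<sigma> \<in> \<Delta>. \<sigma> \<subseteq> T}"

definition connected_complex :: "'v set set \<Rightarrow> bool" where
  "connected_complex \<Gamma> \<longleftrightarrow>
     (\<forall>u\<in>\<Union>\<Gamma>. \<forall>v\<in>\<Union>\<Gamma>. (u, v) \<in> {(a, b). {a, b} \<in> \<Gamma>}\<^sup>*)"

definition simplicial_chains :: "int \<Rightarrow> 'v set set \<Rightarrow> ('v set \<Rightarrow>\<^sub>0 'k::field) set" where
  "simplicial_chains i \<Gamma> = {c. Poly_Mapping.keys c \<subseteq> {\<sigma> \<in> \<Gamma>. int (card \<sigma>) = i + 1}}"

text \<open>
  Every face is oriented by the order of the vertices. Faces of cardinality 1 are sent to multiples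
  of the empty face, so this is the augmented chain complex, with degrees starting at -1.
\<close>

definition simplicial_boundary ::
  "('v::linorder set \<Rightarrow>\<^sub>0 'k::field) \<Rightarrow> ('v set \<Rightarrow>\<^sub>0 'k)" where
  "simplicial_boundary c =
     (\<Sum>\<sigma>\<in>Poly_Mapping.keys c. \<Sum>v\<in>\<sigma>.
        Poly_Mapping.single (\<sigma> - {v})
          ((-1) ^ card {w \<in> \<sigma>. w < v} * Poly_Mapping.lookup c \<sigma>))"

definition simplicial_cycle_group ::
  "int \<Rightarrow> 'v::linorder set set \<Rightarrow> ('v set \<Rightarrow>\<^sub>0 'k::field) monoid" where
  "simplicial_cycle_group i \<Gamma> =
     \<lparr>carrier = {c \<in> simplicial_chains i \<Gamma>. simplicial_boundary c = 0}, mult = (+), one = 0\<rparr>"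

definition reduced_homology ::
  "'k::field itself \<Rightarrow> int \<Rightarrow> 'v::linorder set set \<Rightarrow> ('v set \<Rightarrow>\<^sub>0 'k) set monoid" where
  "reduced_homology K i \<Gamma> =
     simplicial_cycle_group i \<Gamma> Mod (simplicial_boundary ` simplicial_chains (i + 1) \<Gamma>)"

definition vertex_minimal_cycle ::
  "'k::field itself \<Rightarrow> int \<Rightarrow> 'v::linorder set \<Rightarrow> 'v set set \<Rightarrow> bool" where
  "vertex_minimal_cycle K h V \<Delta> \<longleftrightarrow>
     (\<forall>T\<subseteq>V. \<not> trivial_group (reduced_homology K h (restriction \<Delta> T)) \<longleftrightarrow> T = V)"


section \<open>Polynomial rings\<close>

text \<open>A polynomial maps exponent vectors to coefficients.\<close>

type_synonym ('v, 'k) mpoly = "('v \<Rightarrow>\<^sub>0 nat) \<Rightarrow>\<^sub>0 'k"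

definition indets :: "('v, 'k::zero) mpoly \<Rightarrow> 'v set" where
  "indets p = (\<Union>m\<in>Poly_Mapping.keys p. Poly_Mapping.keys m)"

definition poly_ring :: "'v set \<Rightarrow> ('v, 'k::field) mpoly ring" where
  "poly_ring V = \<lparr>carrier = {p. indets p \<subseteq> V}, mult = (*), one = 1, zero = 0, add = (+)\<rparr>"

definition mon_degree :: "('v \<Rightarrow>\<^sub>0 nat) \<Rightarrow> nat" where
  "mon_degree m = (\<Sum>v\<in>Poly_Mapping.keys m. Poly_Mapping.lookup m v)"

definition homogeneous_part :: "'v set \<Rightarrow> int \<Rightarrow> ('v, 'k::field) mpoly set" where
  "homogeneous_part V d =
     {p \<in> carrier (poly_ring V). \<forall>m\<in>Poly_Mapping.keys p. int (mon_degree m) = d}"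

definition irrelevant_ideal :: "'v set \<Rightarrow> ('v, 'k::field) mpoly set" where
  "irrelevant_ideal V = {p \<in> carrier (poly_ring V). Poly_Mapping.lookup p 0 = 0}"

definition squarefree_monomial :: "'v set \<Rightarrow> ('v, 'k::field) mpoly" where
  "squarefree_monomial \<sigma> = Poly_Mapping.single (\<Sum>v\<in>\<sigma>. Poly_Mapping.single v 1) 1"


section \<open>Graded modules and the Stanley--Reisner ring\<close>

record ('a, 'b) graded_module = "('a, 'b) module" +
  grade :: "int \<Rightarrow> 'b set"

definition stanley_reisner_ideal :: "'v set \<Rightarrow> 'v set set \<Rightarrow> ('v, 'k::field) mpoly set" where
  "stanley_reisner_ideal V \<Gamma> =
     genideal (poly_ring V) {squarefree_monomial \<sigma> | \<sigma>. \<sigma> \<subseteq> V \<and> \<sigma> \<notin> \<Gamma>}"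

text \<open>The quotient ring, regarded as a graded module over the polynomial ring.\<close>

definition stanley_reisner_ring ::
  "'k::field itself \<Rightarrow> 'v set \<Rightarrow> 'v set set
     \<Rightarrow> (('v, 'k) mpoly, ('v, 'k) mpoly set) graded_module" where
  "stanley_reisner_ring K V \<Gamma> =
     (let S = poly_ring V; I = stanley_reisner_ideal V \<Gamma>; Q = S Quot I in
      \<lparr>carrier = carrier Q, mult = mult Q, one = one Q, zero = zero Q, add = add Q,
       smult = (\<lambda>p x. (I +>\<^bsub>S\<^esub> p) \<otimes>\<^bsub>Q\<^esub> x),
       grade = (\<lambda>d. (\<lambda>p. I +>\<^bsub>S\<^esub> p) ` homogeneous_part V d)\<rparr>)"

text \<open>
  The direct sum over \<open>b \<in> B\<close> of the twisted rank one modules \<open>S(-\<delta> b)\<close>. The fields \<open>mult\<close> and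
  \<open>one\<close> of the record are irrelevant for modules.
\<close>

definition graded_free_module ::
  "'v set \<Rightarrow> 'i set \<Rightarrow> ('i \<Rightarrow> int)
     \<Rightarrow> (('v, 'k::field) mpoly, 'i \<Rightarrow>\<^sub>0 ('v, 'k) mpoly) graded_module" where
  "graded_free_module V B \<delta> =
     \<lparr>carrier = {f. Poly_Mapping.keys f \<subseteq> B \<and>
                    (\<forall>b. Poly_Mapping.lookup f b \<in> carrier (poly_ring V))},
      mult = undefined, one = undefined, zero = 0, add = (+),
      smult = (\<lambda>p. Poly_Mapping.map (\<lambda>q. p * q)),
      grade = (\<lambda>d. {f. Poly_Mapping.keys f \<subseteq> B \<and>
                       (\<forall>b. Poly_Mapping.lookup f b \<in> homogeneous_part V (d - \<delta> b))})\<rparr>"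

definition graded_hom ::
  "('a, 'r) ring_scheme \<Rightarrow> ('a, 'b, 'm) graded_module_scheme \<Rightarrow> ('a, 'c, 'n) graded_module_scheme
     \<Rightarrow> ('b \<Rightarrow> 'c) set" where
  "graded_hom R M N =
     {f \<in> carrier M \<rightarrow> carrier N.
        (\<forall>x\<in>carrier M. \<forall>y\<in>carrier M. f (x \<oplus>\<^bsub>M\<^esub> y) = f x \<oplus>\<^bsub>N\<^esub> f y) \<and>
        (\<forall>a\<in>carrier R. \<forall>x\<in>carrier M. f (a \<odot>\<^bsub>M\<^esub> x) = a \<odot>\<^bsub>N\<^esub> f x) \<and>
        (\<forall>d. f ` grade M d \<subseteq> grade N d)}"


section \<open>Minimal graded free resolutions, Betti numbers, regularity\<close>

text \<open>
  \<open>res_map F i\<close> is the differential from the free module in homological degree \<open>i + 1\<close> to the one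
  in degree \<open>i\<close>; \<open>res_aug F\<close> is the augmentation from the free module in degree 0.
\<close>

record (overloaded) ('v, 'k, 'b) free_complex =
  res_basis :: "nat \<Rightarrow> nat set"
  res_degree :: "nat \<Rightarrow> nat \<Rightarrow> int"
  res_map :: "nat \<Rightarrow> (nat \<Rightarrow>\<^sub>0 ('v, 'k) mpoly) \<Rightarrow> (nat \<Rightarrow>\<^sub>0 ('v, 'k) mpoly)"
  res_aug :: "(nat \<Rightarrow>\<^sub>0 ('v, 'k) mpoly) \<Rightarrow> 'b"

definition res_module ::
  "'v set \<Rightarrow> ('v, 'k::field, 'b) free_complex \<Rightarrow> nat
     \<Rightarrow> (('v, 'k) mpoly, nat \<Rightarrow>\<^sub>0 ('v, 'k) mpoly) graded_module" where
  "res_module V F i = graded_free_module V (res_basis F i) (res_degree F i)"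

text \<open>
  The last condition is minimality: the image of each differential lies in the irrelevant ideal
  times its target. Together with exactness it forces the number of basis elements of degree \<open>j\<close>
  in homological degree \<open>i\<close> to be the dimension of the degree \<open>j\<close> part of \<open>Tor\<^sub>i(M, k)\<close>; hence for
  finitely generated modules finiteness of the bases need not be required separately.
\<close>

definition minimal_graded_free_resolution ::
  "'v set \<Rightarrow> (('v, 'k::field) mpoly, 'b) graded_module \<Rightarrow> ('v, 'k, 'b) free_complex \<Rightarrow> bool" where
  "minimal_graded_free_resolution V M F \<longleftrightarrow>
     res_aug F \<in> graded_hom (poly_ring V) (res_module V F 0) M \<and>
     (\<forall>i. res_map F i \<in> graded_hom (poly_ring V) (res_module V F (Suc i)) (res_module V F i)) \<and>
     res_aug F ` carrier (res_module V F 0) = carrier M \<and>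
     {x \<in> carrier (res_module V F 0). res_aug F x = \<zero>\<^bsub>M\<^esub>}
       = res_map F 0 ` carrier (res_module V F 1) \<and>
     (\<forall>i. {x \<in> carrier (res_module V F (Suc i)). res_map F i x = 0}
            = res_map F (Suc i) ` carrier (res_module V F (Suc (Suc i)))) \<and>
     (\<forall>i. \<forall>x\<in>carrier (res_module V F (Suc i)). \<forall>b.
            Poly_Mapping.lookup (res_map F i x) b \<in> irrelevant_ideal V)"

text \<open>Any two minimal graded free resolutions are isomorphic, so the choice is immaterial.\<close>

definition graded_betti ::
  "'v set \<Rightarrow> (('v, 'k::field) mpoly, 'b) graded_module \<Rightarrow> nat \<Rightarrow> int \<Rightarrow> nat" where
  "graded_betti V M i j =
     (let F = (SOME F. minimal_graded_free_resolution V M F)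
      in card {b \<in> res_basis F i. res_degree F i b = j})"

text \<open>
  For a finitely generated nonzero graded module over a polynomial ring in finitely many variables
  the set below is finite and nonempty, and the supremum is its maximum; the zero module has
  regularity \<open>-\<infinity>\<close>.
\<close>

definition regularity ::
  "'v set \<Rightarrow> (('v, 'k::field) mpoly, 'b) graded_module \<Rightarrow> ereal" where
  "regularity V M = Sup {ereal (of_int (j - int i)) | i j. graded_betti V M i j \<noteq> 0}"

end

theory Submission
  imports Defs
begin

text \<open>
  Write \<open>T = A \<union> B\<close> for a separation of \<open>\<Delta>|\<^sub>T\<close>. Every face of \<open>\<Delta>\<close> misses \<open>A\<close> or \<open>B\<close>, so \<open>\<Delta>\<close> is the
  union of its restrictions to \<open>[n] - A\<close> and \<open>[n] - B\<close>, which have no homology in degree \<open>h\<close> by minimality, and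
  Mayer--Vietoris turns the \<open>h\<close>-cycle of \<open>\<Delta>\<close> into a nonzero class in degree \<open>h - 1\<close> on
  \<open>\<Gamma> = \<Delta>|\<^sub>W\<close>, \<open>W = [n] - T\<close>. By Hochster's formula this class is visible in \<open>\<beta>\<^bsub>|W|-h,|W|\<^esub>(k[\<Gamma>])\<close>: the
  dual cochain is a Koszul cycle of \<open>k[\<Gamma>]\<close> in multidegree \<open>(1,\<dots>,1)\<close> that is not a boundary, whereas
  dimension shifting along a free resolution without generators of degree \<open>|W|\<close> in homological degree
  \<open>|W| - h\<close> would make every such cycle a boundary. Betti numbers are defined by a choice of a minimal
  resolution and by \<open>card\<close>, so one also needs that minimal resolutions exist and that they have only
  finitely many generators in each degree.
\<close>

section \<open>Koszul differentials and simplicial homology\<close>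

text \<open>Tor is never formed: Koszul homology of the ring is compared with the resolution one
  syzygy module at a time, and the only input about free modules is the exactness of their Koszul
  complexes. One operator \<open>koszul\<close>, with a variable action of the vertices, covers both
  the simplicial boundary (trivial action) and the Koszul differential (multiplication by
  variables), so one computation gives square zero for both. Quotient modules are avoided by
  representing elements of the ring by normal forms, the polynomials supported on faces; the
  augmentation then obeys the same axioms as the differentials, up to truncation of products. The
  existence proof is shaped by the fact that the bases of a resolution are sets of natural numbers
  even over an uncountable field: generators are indexed by leading positions, not by chosen module
  elements.\<close>

definition alternate :: "nat \<Rightarrow> 'a::ab_group_add \<Rightarrow> 'a" where
  "alternate n x = (if even n then x else - x)"

text \<open>With the trivial action this is the simplicial boundary of the full simplex on
  \<open>W\<close>; with \<open>act v\<close> multiplication by the variable \<open>v\<close> it is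
  the Koszul differential. Values lie in an arbitrary abelian group because field coefficients,
  polynomials and module elements all occur.\<close>

definition koszul ::
  "'v::linorder set \<Rightarrow> ('v \<Rightarrow> 'a \<Rightarrow> 'a) \<Rightarrow> ('v set \<Rightarrow> 'a) \<Rightarrow> 'v set \<Rightarrow> 'a::ab_group_add" where
  "koszul W act f \<tau> = (\<Sum>v\<in>W - \<tau>. alternate (card {w\<in>\<tau>. w < v}) (act v (f (insert v \<tau>))))"

lemma alternate_zero [simp]: "alternate n 0 = 0"
  by (simp add: alternate_def)

lemma alternate_eq_mult: "alternate n x = (-1) ^ n * (x::'k::field)"
  by (simp add: alternate_def)

lemma alternate_diff: "alternate n (x - y) = alternate n x - alternate n y"
  by (simp add: alternate_def)

text \<open>The terms for \<open>(v, u)\<close> and \<open>(u, v)\<close> cancel. The diagonal is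
  left out of the sum, since \<open>g v v = - g v v\<close> would not force it to vanish in
  characteristic 2.\<close>

lemma sum_antisymmetric_eq_0:
  fixes g :: "'a \<Rightarrow> 'a \<Rightarrow> 'b::ab_group_add"
  assumes "finite A" and "\<And>u v. u \<in> A \<Longrightarrow> v \<in> A \<Longrightarrow> u \<noteq> v \<Longrightarrow> g u v = - g v u"
  shows "(\<Sum>v\<in>A. \<Sum>u\<in>A - {v}. g v u) = 0"
  using assms
proof (induction A rule: finite_induct)
  case (insert a A)
  have eq: "insert a A - {v} = insert a (A - {v})" if "v \<in> A" for v
    using that insert.hyps by auto
  have "(\<Sum>v\<in>insert a A. \<Sum>u\<in>insert a A - {v}. g v u)
      = (\<Sum>u\<in>A. g a u) + (\<Sum>v\<in>A. g v a + (\<Sum>u\<in>A - {v}. g v u))"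
  proof -
    have "(\<Sum>v\<in>A. \<Sum>u\<in>insert a A - {v}. g v u) = (\<Sum>v\<in>A. g v a + (\<Sum>u\<in>A - {v}. g v u))"
      using insert.hyps by (intro sum.cong) (simp_all add: eq del: insert_Diff_if)
    moreover have "insert a A - {a} = A" using insert.hyps by auto
    ultimately show ?thesis using insert.hyps by (simp del: insert_Diff_if)
  qed
  also have "(\<Sum>v\<in>A. g v a + (\<Sum>u\<in>A - {v}. g v u)) = (\<Sum>v\<in>A. g v a)"
  proof -
    have "(\<Sum>v\<in>A. \<Sum>u\<in>A - {v}. g v u) = 0"
      by (rule insert.IH) (use insert.prems in blast)
    then show ?thesis by (simp add: sum.distrib)
  qed
  also have "\<dots> = (\<Sum>v\<in>A. - g a v)"
    by (rule sum.cong[OF refl], rule insert.prems) (use insert.hyps in auto)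
  finally show ?case by (simp add: sum_negf)
qed simp

lemma card_insert_below:
  fixes u v :: "'v::linorder"
  assumes "finite \<tau>" "v \<notin> \<tau>"
  shows "card {w \<in> insert v \<tau>. w < u} = (if v < u then 1 else 0) + card {w \<in> \<tau>. w < u}"
proof -
  have "{w \<in> insert v \<tau>. w < u} = (if v < u then insert v {w \<in> \<tau>. w < u} else {w \<in> \<tau>. w < u})"
    by auto
  then show ?thesis using assms by simp
qed

text \<open>Each pair of inserted vertices occurs in both orders, with opposite signs, and the
  actions commute.\<close>

lemma koszul_koszul:
  assumes "finite W" "\<tau> \<subseteq> W"
    and add: "\<And>v x y. act v (x + y) = act v x + act v y"
    and comm: "\<And>u v x. act u (act v x) = act v (act u x)"
  shows "koszul W act (koszul W act f) \<tau> = 0"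
proof -
  have zero: "act v 0 = 0" for v
    using add[of v 0 0] by simp
  have minus: "act v (- x) = - act v x" for v x
    using add[of v x "- x"] zero by (simp add: eq_neg_iff_add_eq_0 add.commute)
  have alt: "act v (alternate k x) = alternate k (act v x)" for v k x
    by (simp add: alternate_def minus)
  have sum: "act v (sum h A) = (\<Sum>a\<in>A. act v (h a))" for v and h :: "'a \<Rightarrow> 'b" and A
    by (induction A rule: infinite_finite_induct) (simp_all add: zero add)
  have alt_sum: "alternate k (sum h A) = (\<Sum>a\<in>A. alternate k (h a))" for k and h :: "'a \<Rightarrow> 'b" and A
    by (simp add: alternate_def sum_negf)
  define c where "c \<sigma> v = card {w\<in>\<sigma>. w < v}" for \<sigma> and v :: 'a
  define g where "g v u = alternate (c \<tau> v) (alternate (c (insert v \<tau>) u)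
      (act v (act u (f (insert u (insert v \<tau>))))))" for v u
  have fin: "finite \<tau>" using assms(1,2) finite_subset by blast
  have "koszul W act (koszul W act f) \<tau> = (\<Sum>v\<in>W - \<tau>. \<Sum>u\<in>W - \<tau> - {v}. g v u)"
    unfolding koszul_def g_def c_def sum alt_sum alt
    by (intro sum.cong refl) (auto intro: sum.cong)
  also have "\<dots> = 0"
  proof (rule sum_antisymmetric_eq_0)
    fix u v assume uv: "u \<in> W - \<tau>" "v \<in> W - \<tau>" "u \<noteq> v"
    then have "act u (act v (f (insert v (insert u \<tau>)))) = act v (act u (f (insert u (insert v \<tau>))))"
      by (metis comm insert_commute)
    \<comment> \<open>Inserting the smaller vertex raises the count below the larger one, but not
      conversely; this is the sign change between the two orders.\<close>
    moreover have "c (insert u \<tau>) v = (if u < v then 1 else 0) + c \<tau> v"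
      "c (insert v \<tau>) u = (if v < u then 1 else 0) + c \<tau> u"
      unfolding c_def using uv fin by (intro card_insert_below; simp)+
    moreover have "u < v \<and> \<not> v < u \<or> v < u \<and> \<not> u < v" using uv by auto
    ultimately show "g u v = - g v u"
      unfolding g_def by (auto simp: alternate_def)
  qed (use assms in auto)
  finally show ?thesis .
qed

text \<open>A face contributes at \<open>\<tau>\<close> exactly if it is
  \<open>insert v \<tau>\<close>, and \<open>v\<close> is not counted among the vertices below
  \<open>v\<close>, so the sign can be computed in \<open>\<tau>\<close>. This makes the facts about
  \<open>koszul\<close> available for the boundary.\<close>

lemma lookup_simplicial_boundary:
  fixes c :: "'v::linorder set \<Rightarrow>\<^sub>0 'k::field"
  assumes "finite V" "Poly_Mapping.keys c \<subseteq> Pow V"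
  shows "Poly_Mapping.lookup (simplicial_boundary c) \<tau> =
    (if \<tau> \<subseteq> V then koszul V (\<lambda>_ x. x) (Poly_Mapping.lookup c) \<tau> else 0)"
proof -
  let ?l = "Poly_Mapping.lookup"
  define t where "t \<sigma> v = (if \<sigma> - {v} = \<tau> then (-1) ^ card {w \<in> \<sigma>. w < v} * ?l c \<sigma> else 0)" for \<sigma> v
  have fin: "finite \<sigma>" if "\<sigma> \<in> Pow V" for \<sigma> using that assms(1) finite_subset by auto
  have "?l (simplicial_boundary c) \<tau> = (\<Sum>\<sigma>\<in>Poly_Mapping.keys c. \<Sum>v\<in>\<sigma>. t \<sigma> v)"
    by (simp add: simplicial_boundary_def lookup_sum lookup_single t_def when_def)
  also have "\<dots> = (\<Sum>\<sigma>\<in>Pow V. \<Sum>v\<in>\<sigma>. t \<sigma> v)"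
    using assms by (intro sum.mono_neutral_left) (auto simp: t_def in_keys_iff intro!: sum.neutral)
  \<comment> \<open>The inner range is made independent of \<open>\<sigma>\<close> so that the two
    sums can be swapped.\<close>
  also have "\<dots> = (\<Sum>\<sigma>\<in>Pow V. \<Sum>v\<in>V. if v \<in> \<sigma> then t \<sigma> v else 0)"
  proof (rule sum.cong[OF refl])
    fix \<sigma> assume "\<sigma> \<in> Pow V"
    then have "V \<inter> \<sigma> = \<sigma>" by auto
    then show "(\<Sum>v\<in>\<sigma>. t \<sigma> v) = (\<Sum>v\<in>V. if v \<in> \<sigma> then t \<sigma> v else 0)"
      using assms(1) by (simp add: sum.inter_restrict[symmetric])
  qed
  also have "\<dots> = (\<Sum>v\<in>V. \<Sum>\<sigma>\<in>Pow V. if v \<in> \<sigma> then t \<sigma> v else 0)"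
    by (rule sum.swap)
  also have "\<dots> = (\<Sum>v\<in>V. if \<tau> \<subseteq> V \<and> v \<notin> \<tau> then t (insert v \<tau>) v else 0)"
  proof (intro sum.cong refl)
    fix v assume v: "v \<in> V"
    have "(\<Sum>\<sigma>\<in>Pow V. if v \<in> \<sigma> then t \<sigma> v else 0)
        = (\<Sum>\<sigma>\<in>Pow V. if \<sigma> = insert v \<tau> then (if v \<notin> \<tau> then t (insert v \<tau>) v else 0) else 0)"
      by (intro sum.cong) (auto simp: t_def)
    then show "(\<Sum>\<sigma>\<in>Pow V. if v \<in> \<sigma> then t \<sigma> v else 0)
        = (if \<tau> \<subseteq> V \<and> v \<notin> \<tau> then t (insert v \<tau>) v else 0)"
      using v assms(1) by simp
  qed
  also have "\<dots> = (if \<tau> \<subseteq> V then \<Sum>v\<in>V - \<tau>. t (insert v \<tau>) v else 0)"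
  proof -
    have "(\<Sum>v\<in>V. if v \<notin> \<tau> then t (insert v \<tau>) v else 0) = (\<Sum>v\<in>V - \<tau>. t (insert v \<tau>) v)"
      using assms(1) by (intro sum.mono_neutral_cong_right) auto
    then show ?thesis by auto
  qed
  finally have 1: "?l (simplicial_boundary c) \<tau> = (if \<tau> \<subseteq> V then \<Sum>v\<in>V - \<tau>. t (insert v \<tau>) v else 0)" .
  have "(\<Sum>v\<in>V - \<tau>. t (insert v \<tau>) v) = koszul V (\<lambda>_ x. x) (?l c) \<tau>" if "\<tau> \<subseteq> V"
    unfolding koszul_def
  proof (intro sum.cong refl)
    fix v assume v: "v \<in> V - \<tau>"
    then have "insert v \<tau> - {v} = \<tau>" by auto
    moreover have "card {w \<in> insert v \<tau>. w < v} = card {w \<in> \<tau>. w < v}"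
      using card_insert_below[of \<tau> v v] v that fin by auto
    ultimately show "t (insert v \<tau>) v = alternate (card {w \<in> \<tau>. w < v}) (?l c (insert v \<tau>))"
      by (simp add: t_def alternate_eq_mult)
  qed
  then show ?thesis using 1 by simp
qed

section \<open>Linearity of the boundary, chain groups and reduced homology\<close>

lemma simplicial_boundary_add:
  "simplicial_boundary (c + d) = simplicial_boundary c + simplicial_boundary d"
  unfolding simplicial_boundary_def
  by (rule setsum_keys_plus_distrib[where f = "\<lambda>\<sigma> a. \<Sum>v\<in>\<sigma>. Poly_Mapping.single (\<sigma> - {v})
          ((-1) ^ card {w \<in> \<sigma>. w < v} * a)"])
    (simp_all add: single_add distrib_left sum.distrib)

lemma simplicial_boundary_0 [simp]: "simplicial_boundary 0 = 0"
  by (simp add: simplicial_boundary_def)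

lemma simplicial_boundary_uminus: "simplicial_boundary (- c) = - simplicial_boundary c"
  using simplicial_boundary_add[of c "- c"] by (simp add: eq_neg_iff_add_eq_0 add.commute)

lemma simplicial_boundary_diff:
  "simplicial_boundary (c - d) = simplicial_boundary c - simplicial_boundary d"
  using simplicial_boundary_add[of c "- d"] by (simp add: simplicial_boundary_uminus)

lemma lookup_map_scale [simp]:
  "Poly_Mapping.lookup (Poly_Mapping.map ((*) (a::'k::semiring_0)) p) x = a * Poly_Mapping.lookup p x"
  by (simp add: map.rep_eq when_def)

lemma keys_map_scale_subset: "Poly_Mapping.keys (Poly_Mapping.map ((*) a) p) \<subseteq> Poly_Mapping.keys p"
  for a :: "'k::semiring_0"
  by (auto simp: in_keys_iff)

lemma simplicial_boundary_scale:
  fixes a :: "'k::field"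
  assumes "finite V" "Poly_Mapping.keys c \<subseteq> Pow V"
  shows "simplicial_boundary (Poly_Mapping.map ((*) a) c) = Poly_Mapping.map ((*) a)
      (simplicial_boundary c)"
proof (rule poly_mapping_eqI)
  fix \<tau>
  have k: "Poly_Mapping.keys (Poly_Mapping.map ((*) a) c) \<subseteq> Pow V"
    using assms(2) keys_map_scale_subset by fast
  show "Poly_Mapping.lookup (simplicial_boundary (Poly_Mapping.map ((*) a) c)) \<tau>
      = Poly_Mapping.lookup (Poly_Mapping.map ((*) a) (simplicial_boundary c)) \<tau>"
    by (simp add: lookup_simplicial_boundary[OF assms(1) k] lookup_simplicial_boundary[OF assms]
        koszul_def sum_distrib_left alternate_eq_mult algebra_simps)
qed

lemma simplicial_boundary_boundary:
  fixes c :: "'v::linorder set \<Rightarrow>\<^sub>0 'k::field"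
  assumes "finite V" "Poly_Mapping.keys c \<subseteq> Pow V"
  shows "simplicial_boundary (simplicial_boundary c) = 0"
proof (rule poly_mapping_eqI)
  fix \<tau>
  have k: "Poly_Mapping.keys (simplicial_boundary c) \<subseteq> Pow V"
    by (auto simp: in_keys_iff lookup_simplicial_boundary[OF assms] split: if_splits)
  have "koszul V (\<lambda>_ x. x) (Poly_Mapping.lookup (simplicial_boundary c)) \<tau> =
      koszul V (\<lambda>_ x. x) (koszul V (\<lambda>_ x. x) (Poly_Mapping.lookup c)) \<tau>" if "\<tau> \<subseteq> V"
    unfolding koszul_def[of V "\<lambda>_ x. x" _ \<tau>] using that
    by (intro sum.cong refl) (auto simp: lookup_simplicial_boundary[OF assms])
  then show "Poly_Mapping.lookup (simplicial_boundary (simplicial_boundary c)) \<tau> =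
      Poly_Mapping.lookup 0 \<tau>"
    by (simp add: lookup_simplicial_boundary[OF assms(1) k] koszul_koszul[OF assms(1)])
qed

lemma simplicial_chains_add:
  "c \<in> simplicial_chains i \<Gamma> \<Longrightarrow> d \<in> simplicial_chains i \<Gamma> \<Longrightarrow> c + d \<in> simplicial_chains i \<Gamma>"
  unfolding simplicial_chains_def using keys_add[of c d] by blast

lemma simplicial_chains_uminus:
  "c \<in> simplicial_chains i \<Gamma> \<Longrightarrow> - c \<in> simplicial_chains i \<Gamma>"
  by (simp add: simplicial_chains_def in_keys_iff subset_iff)

lemma simplicial_chains_diff:
  "c \<in> simplicial_chains i \<Gamma> \<Longrightarrow> d \<in> simplicial_chains i \<Gamma> \<Longrightarrow> c - d \<in> simplicial_chains i \<Gamma>"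
  using simplicial_chains_add[of c i \<Gamma> "- d"] simplicial_chains_uminus[of d] by simp

lemma simplicial_chains_0 [simp]: "0 \<in> simplicial_chains i \<Gamma>"
  by (simp add: simplicial_chains_def)

lemma simplicial_chains_mono: "\<Gamma> \<subseteq> \<Gamma>' \<Longrightarrow> simplicial_chains i \<Gamma> \<subseteq> simplicial_chains i \<Gamma>'"
  by (auto simp: simplicial_chains_def)

lemma simplicial_chains_keys:
  "simplicial_complex_on V \<Gamma> \<Longrightarrow> c \<in> simplicial_chains i \<Gamma> \<Longrightarrow> Poly_Mapping.keys c \<subseteq> Pow V"
  by (auto simp: simplicial_chains_def simplicial_complex_on_def)

text \<open>A nonzero coefficient at \<open>\<tau>\<close> forces some
  \<open>insert v \<tau>\<close> into the support of \<open>c\<close>, so \<open>\<tau>\<close> is a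
  face by closure under subsets.\<close>

lemma simplicial_boundary_in_chains:
  assumes \<Gamma>: "simplicial_complex_on V \<Gamma>" and c: "c \<in> simplicial_chains i \<Gamma>"
  shows "simplicial_boundary c \<in> simplicial_chains (i - 1) \<Gamma>"
proof -
  have V: "finite V" using \<Gamma> by (simp add: simplicial_complex_on_def)
  have "\<tau> \<in> \<Gamma> \<and> int (card \<tau>) = i" if "\<tau> \<in> Poly_Mapping.keys (simplicial_boundary c)" for \<tau>
  proof -
    have \<tau>: "\<tau> \<subseteq> V" "koszul V (\<lambda>_ x. x) (Poly_Mapping.lookup c) \<tau> \<noteq> 0"
      using that by (auto simp: in_keys_iff lookup_simplicial_boundary[OF V
          simplicial_chains_keys[OF \<Gamma> c]]
          split: if_splits)
    obtain v where "v \<in> V - \<tau>" "alternate (card {w \<in> \<tau>. w < v}) (Poly_Mapping.lookup c (insert v \<tau>)) \<noteq> 0"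
      using \<tau>(2) unfolding koszul_def by (rule sum.not_neutral_contains_not_neutral)
    then have "v \<in> V - \<tau>" "insert v \<tau> \<in> Poly_Mapping.keys c"
      by (auto simp: in_keys_iff alternate_def split: if_splits)
    moreover have "finite \<tau>" using \<tau>(1) V finite_subset by auto
    ultimately have "insert v \<tau> \<in> \<Gamma>" "int (card (insert v \<tau>)) = i + 1" "card (insert v \<tau>) = Suc (card \<tau>)"
      using c by (auto simp: simplicial_chains_def)
    moreover from this(1) have "\<tau> \<in> \<Gamma>"
      using \<Gamma> by (auto simp: simplicial_complex_on_def)
    ultimately show ?thesis by simp
  qed
  then show ?thesis by (auto simp: simplicial_chains_def)
qed

lemma simplicial_complex_restriction:
  "simplicial_complex_on V \<Delta> \<Longrightarrow> T \<subseteq> V \<Longrightarrow> simplicial_complex_on T (restriction \<Delta> T)"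
  by (auto simp: simplicial_complex_on_def restriction_def intro: finite_subset)

text \<open>The only place where the quotient group is opened; afterwards homology is a statement
  about chains. Boundaries are cycles because the boundary squares to zero, and they form a normal
  subgroup because the cycle group is abelian.\<close>

lemma trivial_reduced_homology_iff:
  fixes \<Gamma> :: "'v::linorder set set"
  assumes \<Gamma>: "simplicial_complex_on V \<Gamma>"
  shows "trivial_group (reduced_homology TYPE('k::field) i \<Gamma>) \<longleftrightarrow>
    (\<forall>c\<in>simplicial_chains i \<Gamma>. simplicial_boundary c = 0 \<longrightarrow>
       (c::'v set \<Rightarrow>\<^sub>0 'k) \<in> simplicial_boundary ` simplicial_chains (i + 1) \<Gamma>)"
proof -
  let ?G = "simplicial_cycle_group i \<Gamma> :: ('v set \<Rightarrow>\<^sub>0 'k) monoid"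
  let ?H = "simplicial_boundary ` simplicial_chains (i + 1) \<Gamma> :: ('v set \<Rightarrow>\<^sub>0 'k) set"
  have V: "finite V" using \<Gamma> by (simp add: simplicial_complex_on_def)
  interpret G: comm_group ?G
  proof (rule comm_groupI)
    fix x assume x: "x \<in> carrier ?G"
    show "\<exists>y\<in>carrier ?G. y \<otimes>\<^bsub>?G\<^esub> x = \<one>\<^bsub>?G\<^esub>"
      by (rule bexI[of _ "- x"])
        (use x in \<open>auto simp: simplicial_cycle_group_def simplicial_chains_uminus
            simplicial_boundary_uminus\<close>)
  qed (auto simp: simplicial_cycle_group_def simplicial_chains_add simplicial_boundary_add add_ac)
  have inv: "inv\<^bsub>?G\<^esub> x = - x" if "x \<in> carrier ?G" for x
    by (rule G.inv_equality)
      (use that in \<open>auto simp: simplicial_cycle_group_def simplicial_chains_uminus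
          simplicial_boundary_uminus\<close>)
  have sub: "?H \<subseteq> carrier ?G"
  proof
    fix x assume "x \<in> ?H"
    then obtain c where c: "c \<in> simplicial_chains (i + 1) \<Gamma>" "x = simplicial_boundary c" by auto
    then show "x \<in> carrier ?G"
      using simplicial_boundary_in_chains[OF \<Gamma> c(1)]
        simplicial_boundary_boundary[OF V simplicial_chains_keys[OF \<Gamma> c(1)]]
      by (simp add: simplicial_cycle_group_def)
  qed
  have "subgroup ?H ?G"
  proof (rule G.subgroupI)
    fix a assume a: "a \<in> ?H"
    then have "inv\<^bsub>?G\<^esub> a = - a" using sub inv by blast
    then show "inv\<^bsub>?G\<^esub> a \<in> ?H"
      using a by (auto simp: simplicial_boundary_uminus[symmetric] intro!: imageI
          simplicial_chains_uminus)
  next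
    fix a b assume "a \<in> ?H" "b \<in> ?H"
    then obtain c d where "c \<in> simplicial_chains (i + 1) \<Gamma>" "d \<in> simplicial_chains (i + 1) \<Gamma>"
      "a = simplicial_boundary c" "b = simplicial_boundary d" by auto
    then have "a + b = simplicial_boundary (c + d)" "c + d \<in> simplicial_chains (i + 1) \<Gamma>"
      by (simp_all add: simplicial_boundary_add simplicial_chains_add)
    then show "a \<otimes>\<^bsub>?G\<^esub> b \<in> ?H" by (simp add: simplicial_cycle_group_def)
  qed (use sub in \<open>auto intro: simplicial_chains_0\<close>)
  then have normal: "?H \<lhd> ?G" by (rule G.normal_iff_subgroup[THEN iffD2])
  interpret H: normal ?H ?G by (rule normal)
  have "trivial_group (reduced_homology TYPE('k) i \<Gamma>) \<longleftrightarrow> (\<forall>x\<in>carrier ?G. ?H #>\<^bsub>?G\<^esub> x = ?H)"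
    unfolding reduced_homology_def
    using H.factorgroup_is_group group.trivial_group_subset[OF H.factorgroup_is_group]
    by (auto simp: carrier_FactGroup)
  also have "\<dots> \<longleftrightarrow> (\<forall>x\<in>carrier ?G. x \<in> ?H)"
    using G.coset_join1[OF _ _ H.subgroup_axioms] G.coset_join2[OF _ H.subgroup_axioms] by auto
  finally show ?thesis by (auto simp: simplicial_cycle_group_def)
qed

section \<open>Filtering coefficients and separating a vector from a subspace\<close>

definition pm_filter :: "('a \<Rightarrow> bool) \<Rightarrow> ('a \<Rightarrow>\<^sub>0 'b::zero) \<Rightarrow> ('a \<Rightarrow>\<^sub>0 'b)" where
  "pm_filter P p = Poly_Mapping.mapp (\<lambda>k c. if P k then c else 0) p"

lemma lookup_pm_filter [simp]:
  "Poly_Mapping.lookup (pm_filter P p) k = (if P k then Poly_Mapping.lookup p k else 0)"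
  by (simp add: pm_filter_def lookup_mapp when_def in_keys_iff)

lemma keys_pm_filter: "Poly_Mapping.keys (pm_filter P p) = {k \<in> Poly_Mapping.keys p. P k}"
  by (auto simp: in_keys_iff split: if_splits)

text \<open>A basis of \<open>U\<close> stays independent when \<open>w\<close> is added, so a
  linear functional can be prescribed as 0 on the basis and 1 at \<open>w\<close>; \<open>U\<close>
  may have infinite dimension. \<open>\<phi>\<close> records its values on unit vectors, which is
  how a nonbounding cycle will yield a cochain.\<close>

lemma separating_functional:
  fixes U :: "('a \<Rightarrow>\<^sub>0 'k::field) set"
  assumes zero: "0 \<in> U" and add: "\<And>x y. x \<in> U \<Longrightarrow> y \<in> U \<Longrightarrow> x + y \<in> U"
    and scale: "\<And>c x. x \<in> U \<Longrightarrow> Poly_Mapping.map ((*) c) x \<in> U"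
    and w: "w \<notin> U"
  shows "\<exists>\<phi>::'a \<Rightarrow> 'k. (\<forall>u\<in>U. (\<Sum>a\<in>Poly_Mapping.keys u. Poly_Mapping.lookup u a * \<phi> a) = 0) \<and>
    (\<Sum>a\<in>Poly_Mapping.keys w. Poly_Mapping.lookup w a * \<phi> a) \<noteq> 0"
proof -
  let ?s = "\<lambda>c::'k. Poly_Mapping.map ((*) c) :: ('a \<Rightarrow>\<^sub>0 'k) \<Rightarrow> _"
  interpret V: vector_space ?s
    by standard (rule poly_mapping_eqI; simp add: lookup_add algebra_simps)+
  interpret P: vector_space_pair ?s "(*)"
    by standard (simp_all add: algebra_simps)
  have "V.subspace U" using assms by (auto simp: V.subspace_def)
  then obtain B where B: "B \<subseteq> U" "V.independent B" "V.span B = U"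
    by (metis V.basis_exists V.span_minimal subset_antisym)
  have "V.independent (insert w B)" using B w by (auto simp: V.independent_insert)
  then obtain g where g: "Vector_Spaces.linear ?s (*) g"
    "\<forall>x\<in>insert w B. g x = (if x = w then 1 else 0)"
    using P.linear_independent_extend[of "insert w B" "\<lambda>x. if x = w then 1 else 0"] by blast
  interpret g: Vector_Spaces.linear ?s "(*)" g by (rule g(1))
  have gB: "g x = 0" if "x \<in> B" for x
    using that g(2) w B(1) by auto
  have gU: "g u = 0" if "u \<in> U" for u
    using P.linear_eq_0_on_span[OF g(1) gB] that B(3) by auto
  have gw: "g w = 1" using g(2) by simp
  have eq: "g u = (\<Sum>a\<in>Poly_Mapping.keys u. Poly_Mapping.lookup u a * g (Poly_Mapping.single a 1))" for u
  proof -
    have u: "u = (\<Sum>a\<in>Poly_Mapping.keys u. ?s (Poly_Mapping.lookup u a) (Poly_Mapping.single a 1))"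
      by (rule poly_mapping_eqI) (auto simp: lookup_sum lookup_single when_def in_keys_iff
          if_distrib cong: if_cong)
    show ?thesis
      by (subst u) (simp only: g.sum g.scale)
  qed
  show ?thesis
    by (rule exI[of _ "\<lambda>a. g (Poly_Mapping.single a 1)"]) (simp add: eq[symmetric] gU gw)
qed

section \<open>Disconnected restrictions and the connecting map\<close>

text \<open>\<open>A\<close> is the set of vertices reachable from one vertex along edges,
  \<open>B\<close> the rest of \<open>T\<close>, including points of \<open>T\<close> that are no
  vertices. A face meeting both would contain an edge from \<open>A\<close> to \<open>B\<close>,
  which extends a path out of \<open>A\<close>.\<close>

lemma separated_vertices:
  assumes \<Delta>: "simplicial_complex_on V \<Delta>" and "T \<subseteq> V" and dis: "\<not> connected_complex (restriction \<Delta> T)"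
  obtains A B where "A \<noteq> {}" "B \<noteq> {}" "A \<union> B = T" "A \<inter> B = {}"
    "\<And>\<sigma>. \<sigma> \<in> \<Delta> \<Longrightarrow> \<sigma> \<inter> A = {} \<or> \<sigma> \<inter> B = {}"
proof -
  let ?R = "{(a, b). {a, b} \<in> restriction \<Delta> T}"
  obtain u v where uv: "u \<in> \<Union>(restriction \<Delta> T)" "v \<in> \<Union>(restriction \<Delta> T)" "(u, v) \<notin> ?R\<^sup>*"
    using dis unfolding connected_complex_def by blast
  define A where "A = {w \<in> T. (u, w) \<in> ?R\<^sup>*}"
  have "u \<in> T" "v \<in> T" using uv by (auto simp: restriction_def)
  then have "u \<in> A" "v \<in> T - A" using uv(3) by (auto simp: A_def)
  moreover have "\<sigma> \<inter> A = {} \<or> \<sigma> \<inter> (T - A) = {}" if "\<sigma> \<in> \<Delta>" for \<sigma>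
  proof (rule ccontr)
    assume "\<not> ?thesis"
    then obtain a b where ab: "a \<in> \<sigma>" "a \<in> A" "b \<in> \<sigma>" "b \<in> T - A" by blast
    then have "{a, b} \<in> \<Delta>" using \<Delta> that by (auto simp: simplicial_complex_on_def)
    then have "(a, b) \<in> ?R" using ab by (auto simp: restriction_def A_def)
    then have "(u, b) \<in> ?R\<^sup>*" using ab(2) by (auto simp: A_def intro: rtrancl_into_rtrancl)
    then show False using ab by (auto simp: A_def)
  qed
  ultimately show ?thesis
    by (intro that[of A "T - A"]) (auto simp: A_def)
qed

text \<open>Mayer--Vietoris for the cover of \<open>\<Delta>\<close> by the restrictions to \<open>V - A\<close> and \<open>V - B\<close>, where
  \<open>T = A \<union> B\<close> is a separation: the connecting map is injective on homology in degree \<open>h\<close>.\<close>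

lemma nonbounding_cycle_off_disconnected:
  fixes \<Delta> :: "'v::linorder set set"
  assumes \<Delta>: "simplicial_complex_on V \<Delta>" and min: "vertex_minimal_cycle TYPE('k::field) h V \<Delta>"
    and T: "T \<subseteq> V" and dis: "\<not> connected_complex (restriction \<Delta> T)"
  shows "\<exists>w::'v set \<Rightarrow>\<^sub>0 'k. w \<in> simplicial_chains (h - 1) (restriction \<Delta> (V - T)) \<and>
    simplicial_boundary w = 0 \<and> w \<notin> simplicial_boundary ` simplicial_chains h (restriction \<Delta> (V - T))"
proof -
  obtain A B where AB: "A \<noteq> {}" "B \<noteq> {}" "A \<union> B = T" "A \<inter> B = {}"
    and sep: "\<And>\<sigma>. \<sigma> \<in> \<Delta> \<Longrightarrow> \<sigma> \<inter> A = {} \<or> \<sigma> \<inter> B = {}"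
    using separated_vertices[OF \<Delta> T dis] by metis
  let ?r = "restriction \<Delta>"
  let ?C = "\<lambda>i U. simplicial_chains i (?r U) :: ('v set \<Rightarrow>\<^sub>0 'k) set"
  let ?d = "simplicial_boundary :: ('v set \<Rightarrow>\<^sub>0 'k) \<Rightarrow> _"
  have V: "finite V" using \<Delta> by (simp add: simplicial_complex_on_def)
  have complex: "simplicial_complex_on U (?r U)" if "U \<subseteq> V" for U
    using simplicial_complex_restriction[OF \<Delta> that] .
  have "?r V = \<Delta>" using \<Delta> by (auto simp: simplicial_complex_on_def restriction_def)
  have "\<not> trivial_group (reduced_homology TYPE('k) h (?r V))"
    using min by (auto simp: vertex_minimal_cycle_def)
  then obtain z where z: "z \<in> ?C h V" "?d z = 0" "z \<notin> ?d ` ?C (h + 1) V"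
    using trivial_reduced_homology_iff[OF complex[OF subset_refl]] by blast
  have bounding: "c \<in> ?d ` ?C (h + 1) U" if "U \<subset> V" "c \<in> ?C h U" "?d c = 0" for c U
  proof -
    have "trivial_group (reduced_homology TYPE('k) h (?r U))"
      using min that(1) by (auto simp: vertex_minimal_cycle_def)
    then show ?thesis
      using trivial_reduced_homology_iff[OF complex] that by blast
  qed
  \<comment> \<open>Nonemptiness of both sides enters here: minimality speaks only about proper
    subsets of \<open>V\<close>.\<close>
  have VA: "V - A \<subset> V" and VB: "V - B \<subset> V" using AB T by auto
  \<comment> \<open>A face meeting \<open>A\<close> misses \<open>B\<close>, so the two parts of
    \<open>z\<close> live on \<open>V - A\<close> and on \<open>V - B\<close>.\<close>
  define z1 where "z1 = pm_filter (\<lambda>\<sigma>. \<sigma> \<inter> A = {}) z"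
  define z2 where "z2 = pm_filter (\<lambda>\<sigma>. \<sigma> \<inter> A \<noteq> {}) z"
  have z12: "z = z1 + z2"
    by (rule poly_mapping_eqI) (simp add: z1_def z2_def lookup_add)
  have z1: "z1 \<in> ?C h (V - A)"
    using z(1) by (auto simp: z1_def simplicial_chains_def keys_pm_filter restriction_def)
  have z2: "z2 \<in> ?C h (V - B)"
    using z(1) sep by (fastforce simp: z2_def simplicial_chains_def keys_pm_filter restriction_def)
  have d12: "?d z1 = - ?d z2"
    using z(2) by (simp add: z12 simplicial_boundary_add eq_neg_iff_add_eq_0)
  have "?d z1 \<in> ?C (h - 1) (V - A)"
    using simplicial_boundary_in_chains[OF complex z1] by auto
  moreover have "?d z1 \<in> ?C (h - 1) (V - B)"
    unfolding d12 using simplicial_boundary_in_chains[OF complex z2]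
    by (auto intro: simplicial_chains_uminus)
  \<comment> \<open>Up to sign the parts have the same boundary. Its faces avoid both
    \<open>A\<close> and \<open>B\<close>, and so it represents the image of \<open>z\<close> under
    the connecting map.\<close>
  ultimately have w: "?d z1 \<in> ?C (h - 1) (V - T)"
    using AB(3) by (auto simp: simplicial_chains_def restriction_def)
  have dd: "?d (?d z1) = 0"
    using simplicial_boundary_boundary[OF V] simplicial_chains_keys[OF complex z1] by blast
  have "?d z1 \<notin> ?d ` ?C h (V - T)"
  proof
    assume "?d z1 \<in> ?d ` ?C h (V - T)"
    then obtain y where y: "y \<in> ?C h (V - T)" "?d z1 = ?d y" by auto
    have "?r (V - T) \<subseteq> ?r (V - A)" "?r (V - T) \<subseteq> ?r (V - B)"
      using AB(3) by (auto simp: restriction_def)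
    then have yA: "y \<in> ?C h (V - A)" and yB: "y \<in> ?C h (V - B)"
      using y(1) simplicial_chains_mono by blast+
    \<comment> \<open>Correcting by \<open>y\<close> turns both parts into cycles. Each bounds on
      its own side, and the sum exhibits \<open>z\<close> as a boundary.\<close>
    have "z1 - y \<in> ?d ` ?C (h + 1) (V - A)"
      using bounding[OF VA simplicial_chains_diff[OF z1 yA]] y(2) by (simp add: simplicial_boundary_diff)
    moreover have "z2 + y \<in> ?d ` ?C (h + 1) (V - B)"
    proof (rule bounding[OF VB simplicial_chains_add[OF z2 yB]])
      show "?d (z2 + y) = 0" unfolding simplicial_boundary_add y(2)[symmetric] d12 by simp
    qed
    ultimately obtain a b where ab: "a \<in> ?C (h + 1) (V - A)" "z1 - y = ?d a"
      "b \<in> ?C (h + 1) (V - B)" "z2 + y = ?d b" by auto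
    have "?r (V - A) \<subseteq> ?r V" "?r (V - B) \<subseteq> ?r V" by (auto simp: restriction_def)
    then have "a + b \<in> ?C (h + 1) V"
      using ab simplicial_chains_mono by (blast intro: simplicial_chains_add)
    moreover have "z = ?d (a + b)"
      using ab by (simp add: simplicial_boundary_add z12 flip: ab(2,4))
    ultimately show False using z(3) by blast
  qed
  then show ?thesis using w dd by blast
qed

section \<open>Graded free modules\<close>

definition indet :: "'v \<Rightarrow> ('v, 'k::field) mpoly" where
  "indet v = Poly_Mapping.single (Poly_Mapping.single v 1) 1"

text \<open>Elements of a free module are treated as functions of a basis index and a monomial;
  membership, degree and support then all become conditions on nonzero coefficients.\<close>

definition free_coeff :: "('i \<Rightarrow>\<^sub>0 ('v, 'k::zero) mpoly) \<Rightarrow> 'i \<Rightarrow> ('v \<Rightarrow>\<^sub>0 nat) \<Rightarrow> 'k" where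
  "free_coeff f b m = Poly_Mapping.lookup (Poly_Mapping.lookup f b) m"

definition free_smult :: "('v, 'k::field) mpoly \<Rightarrow> ('i \<Rightarrow>\<^sub>0 ('v, 'k) mpoly) \<Rightarrow> ('i \<Rightarrow>\<^sub>0 ('v, 'k) mpoly)"
    where
  "free_smult p = Poly_Mapping.map (\<lambda>q. p * q)"

definition free_carrier :: "'v set \<Rightarrow> 'i set \<Rightarrow> ('i \<Rightarrow>\<^sub>0 ('v, 'k::field) mpoly) set" where
  "free_carrier W B = {f. \<forall>b m. free_coeff f b m \<noteq> 0 \<longrightarrow> b \<in> B \<and> Poly_Mapping.keys m \<subseteq> W}"

definition free_grade ::
  "'v set \<Rightarrow> 'i set \<Rightarrow> ('i \<Rightarrow> int) \<Rightarrow> int \<Rightarrow> ('i \<Rightarrow>\<^sub>0 ('v, 'k::field) mpoly) set" where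
  "free_grade W B \<delta> d = {f. \<forall>b m. free_coeff f b m \<noteq> 0 \<longrightarrow>
     b \<in> B \<and> Poly_Mapping.keys m \<subseteq> W \<and> int (mon_degree m) + \<delta> b = d}"

text \<open>One projection serves for homogeneous components and for truncation modulo the monomials
  with nonface support, as both only select pairs of a basis index and a monomial.\<close>

definition free_filter ::
  "('i \<Rightarrow> ('v \<Rightarrow>\<^sub>0 nat) \<Rightarrow> bool) \<Rightarrow> ('i \<Rightarrow>\<^sub>0 ('v, 'k::field) mpoly) \<Rightarrow> ('i \<Rightarrow>\<^sub>0 ('v, 'k) mpoly)" where
  "free_filter P f = Poly_Mapping.mapp (\<lambda>b. pm_filter (P b)) f"

abbreviation free_component ::
  "('i \<Rightarrow> int) \<Rightarrow> int \<Rightarrow> ('i \<Rightarrow>\<^sub>0 ('v, 'k::field) mpoly) \<Rightarrow> ('i \<Rightarrow>\<^sub>0 ('v, 'k) mpoly)" where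
  "free_component \<delta> d \<equiv> free_filter (\<lambda>b m. int (mon_degree m) + \<delta> b = d)"

abbreviation supported_part ::
  "'v set set \<Rightarrow> ('i \<Rightarrow>\<^sub>0 ('v, 'k::field) mpoly) \<Rightarrow> ('i \<Rightarrow>\<^sub>0 ('v, 'k) mpoly)" where
  "supported_part \<Gamma> \<equiv> free_filter (\<lambda>b m. Poly_Mapping.keys m \<in> \<Gamma>)"

lemma pm_filter_zero [simp]: "pm_filter P 0 = 0"
  by (rule poly_mapping_eqI) simp

lemma free_eqI: "(\<And>b m. free_coeff f b m = free_coeff g b m) \<Longrightarrow> f = g"
  by (auto simp: free_coeff_def intro!: poly_mapping_eqI)

lemma free_coeff_zero [simp]: "free_coeff 0 b m = 0"
  by (simp add: free_coeff_def)

lemma free_coeff_add [simp]: "free_coeff (f + g) b m = free_coeff f b m + free_coeff g b m"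
  by (simp add: free_coeff_def lookup_add)

lemma free_coeff_uminus [simp]: "free_coeff (- f) b m = - free_coeff f b m"
  by (simp add: free_coeff_def)

lemma free_coeff_diff [simp]: "free_coeff (f - g) b m = free_coeff f b m - free_coeff g b m"
  by (simp add: free_coeff_def lookup_minus)

lemma free_coeff_sum: "free_coeff (sum f A) b m = (\<Sum>a\<in>A. free_coeff (f a) b m)"
  by (simp add: free_coeff_def lookup_sum)

lemma free_coeff_filter [simp]:
  "free_coeff (free_filter P f) b m = (if P b m then free_coeff f b m else 0)"
  by (simp add: free_coeff_def free_filter_def lookup_mapp when_def in_keys_iff)

lemma free_coeff_single: "free_coeff (Poly_Mapping.single b p) b' m = (if b' = b then
    Poly_Mapping.lookup p m else 0)"
  by (simp add: free_coeff_def lookup_single when_def)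

lemma free_keys_iff: "b \<in> Poly_Mapping.keys f \<longleftrightarrow> (\<exists>m. free_coeff f b m \<noteq> 0)"
  unfolding in_keys_iff free_coeff_def poly_mapping_eq_iff fun_eq_iff by simp

lemma lookup_free_smult [simp]: "Poly_Mapping.lookup (free_smult p f) b = p * Poly_Mapping.lookup f b"
  by (simp add: free_smult_def map.rep_eq when_def)

lemma finite_free_support: "finite {(b, m). free_coeff f b m \<noteq> 0}"
proof -
  have "{(b, m). free_coeff f b m \<noteq> 0} \<subseteq> (SIGMA b:Poly_Mapping.keys f. Poly_Mapping.keys
      (Poly_Mapping.lookup f b))"
    by (auto simp: free_coeff_def in_keys_iff)
  then show ?thesis by (rule finite_subset) auto
qed

text \<open>Subtraction of exponent vectors is truncated, so \<open>x - t\<close> is the true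
  quotient only under the divisibility test.\<close>

lemma lookup_single_times:
  fixes p :: "('v, 'k::field) mpoly"
  shows "Poly_Mapping.lookup (Poly_Mapping.single t c * p) x =
    (if \<exists>m. x = t + m then c * Poly_Mapping.lookup p (x - t) else 0)"
proof -
  have "p = (\<Sum>k\<in>Poly_Mapping.keys p. Poly_Mapping.single k (Poly_Mapping.lookup p k))"
    by (rule poly_mapping_eqI) (auto simp: lookup_sum lookup_single when_def in_keys_iff)
  then have "Poly_Mapping.single t c * p = (\<Sum>k\<in>Poly_Mapping.keys p. Poly_Mapping.single (t + k) (c *
      Poly_Mapping.lookup p k))"
    by (metis (no_types, lifting) mult_single sum.cong sum_distrib_left)
  then have "Poly_Mapping.lookup (Poly_Mapping.single t c * p) x
      = (\<Sum>k\<in>Poly_Mapping.keys p. if t + k = x then c * Poly_Mapping.lookup p k else 0)"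
    by (simp add: lookup_sum lookup_single when_def)
  also have "\<dots> = (if \<exists>m. x = t + m then c * Poly_Mapping.lookup p (x - t) else 0)"
    by (auto simp: in_keys_iff intro!: sum.neutral)
  finally show ?thesis .
qed

lemma exists_add_single_iff:
  fixes m :: "'v \<Rightarrow>\<^sub>0 nat"
  shows "(\<exists>m'. m = Poly_Mapping.single v 1 + m') \<longleftrightarrow> v \<in> Poly_Mapping.keys m"
proof
  assume "v \<in> Poly_Mapping.keys m"
  then have "m = Poly_Mapping.single v 1 + (m - Poly_Mapping.single v 1)"
    by (intro poly_mapping_eqI) (auto simp: lookup_add lookup_minus lookup_single when_def in_keys_iff)
  then show "\<exists>m'. m = Poly_Mapping.single v 1 + m'" by blast
qed (auto simp: in_keys_iff lookup_add)

lemma lookup_indet_times: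
  "Poly_Mapping.lookup (indet v * p) m =
    (if v \<in> Poly_Mapping.keys m then Poly_Mapping.lookup p (m - Poly_Mapping.single v 1) else 0)"
  unfolding indet_def lookup_single_times exists_add_single_iff by simp

lemma lookup_const_times: "Poly_Mapping.lookup (Poly_Mapping.single 0 c * p) m = c *
    Poly_Mapping.lookup p m"
  for p :: "('v, 'k::field) mpoly"
  by (simp add: lookup_single_times)

lemma free_coeff_indet_smult:
  "free_coeff (free_smult (indet v) f) b m =
    (if v \<in> Poly_Mapping.keys m then free_coeff f b (m - Poly_Mapping.single v 1) else 0)"
  by (simp add: free_coeff_def lookup_indet_times)

lemma free_coeff_const_smult [simp]:
  "free_coeff (free_smult (Poly_Mapping.single 0 c) f) b m = c * free_coeff f b m"
  by (simp add: free_coeff_def lookup_const_times)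

lemma free_smult_add: "free_smult p (f + g) = free_smult p f + free_smult p g"
  by (rule poly_mapping_eqI) (simp add: lookup_add distrib_left)

lemma free_smult_add_left: "free_smult (p + q) f = free_smult p f + free_smult q f"
  by (rule poly_mapping_eqI) (simp add: lookup_add distrib_right)

lemma free_smult_assoc: "free_smult p (free_smult q f) = free_smult (p * q) f"
  by (rule poly_mapping_eqI) (simp add: mult.assoc)

lemma free_smult_zero [simp]: "free_smult p 0 = 0" "free_smult 0 f = 0"
  by (rule poly_mapping_eqI; simp)+

lemma free_smult_one [simp]: "free_smult 1 f = f"
  by (rule poly_mapping_eqI; simp)

lemma free_smult_uminus: "free_smult p (- f) = - free_smult p f" "free_smult (- p) f = - free_smult p f"
  by (rule poly_mapping_eqI; simp)+

lemma free_smult_sum: "free_smult p (sum f A) = (\<Sum>a\<in>A. free_smult p (f a))"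
  by (rule poly_mapping_eqI) (simp add: lookup_sum sum_distrib_left)

lemma free_smult_sum_left: "free_smult (sum p A) f = (\<Sum>a\<in>A. free_smult (p a) f)"
  by (rule poly_mapping_eqI) (simp add: lookup_sum sum_distrib_right)

section \<open>Degrees and supports of products, and closure of the graded pieces\<close>

lemma mon_degree_add: "mon_degree (a + b) = mon_degree a + mon_degree b"
  unfolding mon_degree_def by (rule setsum_keys_plus_distrib[where f = "\<lambda>_ x. x"]) auto

lemma mon_degree_zero [simp]: "mon_degree 0 = 0"
  by (simp add: mon_degree_def)

lemma mon_degree_single [simp]: "mon_degree (Poly_Mapping.single v k) = k"
  by (simp add: mon_degree_def)

lemma keys_add_nat: "Poly_Mapping.keys (a + b) = Poly_Mapping.keys a \<union> Poly_Mapping.keys b"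
  for a b :: "'v \<Rightarrow>\<^sub>0 nat"
  by (auto simp: in_keys_iff lookup_add)

lemma keys_minus_nat: "Poly_Mapping.keys (a - b) \<subseteq> Poly_Mapping.keys a"
  for a b :: "'v \<Rightarrow>\<^sub>0 nat"
  by (auto simp: in_keys_iff lookup_minus)

lemma poly_ring_simps [simp]:
  "mult (poly_ring V) = (*)" "one (poly_ring V) = 1" "zero (poly_ring V) = 0" "add (poly_ring V) = (+)"
  by (simp_all add: poly_ring_def)

lemma poly_ring_carrier_iff:
  "p \<in> carrier (poly_ring W) \<longleftrightarrow> (\<forall>m. Poly_Mapping.lookup p m \<noteq> 0 \<longrightarrow> Poly_Mapping.keys m \<subseteq> W)"
  by (simp add: poly_ring_def indets_def UN_subset_iff Ball_def lookup_not_eq_zero_eq_in_keys)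

lemma homogeneous_part_iff:
  "p \<in> homogeneous_part W d \<longleftrightarrow>
    (\<forall>m. Poly_Mapping.lookup p m \<noteq> 0 \<longrightarrow> Poly_Mapping.keys m \<subseteq> W \<and> int (mon_degree m) = d)"
  by (auto simp: homogeneous_part_def poly_ring_carrier_iff in_keys_iff)

lemma lookup_times_nonzero:
  fixes p q :: "('v, 'k::field) mpoly"
  assumes "Poly_Mapping.lookup (p * q) m \<noteq> 0"
  obtains a b where "m = a + b" "Poly_Mapping.lookup p a \<noteq> 0" "Poly_Mapping.lookup q b \<noteq> 0"
  using assms keys_mult[of p q] by (auto simp flip: in_keys_iff)

lemma poly_ring_closed:
  "p \<in> carrier (poly_ring W) \<Longrightarrow> q \<in> carrier (poly_ring W) \<Longrightarrow> p + q \<in> carrier (poly_ring W)"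
  "p \<in> carrier (poly_ring W) \<Longrightarrow> - p \<in> carrier (poly_ring W)"
  "p \<in> carrier (poly_ring W) \<Longrightarrow> q \<in> carrier (poly_ring W) \<Longrightarrow> p * q \<in> carrier (poly_ring W)"
  "Poly_Mapping.single 0 c \<in> carrier (poly_ring W)"
  "0 \<in> carrier (poly_ring W)" "1 \<in> carrier (poly_ring W)"
  "v \<in> W \<Longrightarrow> indet v \<in> carrier (poly_ring W)"
  subgoal by (auto simp: poly_ring_carrier_iff lookup_add) (metis add.right_neutral subsetD)
  subgoal by (auto simp: poly_ring_carrier_iff)
  subgoal unfolding poly_ring_carrier_iff
    by (metis keys_add_nat lookup_times_nonzero le_sup_iff)
  by (auto simp: poly_ring_carrier_iff lookup_single lookup_one when_def indet_def)

lemma carrier_graded_free_module [simp]: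
  "carrier (graded_free_module W B \<delta>) = free_carrier W B"
  unfolding graded_free_module_def free_carrier_def
  by (auto simp: poly_ring_carrier_iff free_keys_iff subset_iff) (auto simp: free_coeff_def)

lemma grade_graded_free_module [simp]:
  "grade (graded_free_module W B \<delta>) d = free_grade W B \<delta> d"
  unfolding graded_free_module_def free_grade_def
  by (auto simp: homogeneous_part_iff free_keys_iff subset_iff eq_diff_eq) (auto simp: free_coeff_def)

lemma graded_free_module_simps [simp]:
  "add (graded_free_module W B \<delta>) = (+)" "zero (graded_free_module W B \<delta>) = 0"
  "smult (graded_free_module W B \<delta>) = free_smult"
  by (simp_all add: graded_free_module_def free_smult_def fun_eq_iff)

lemma free_grade_subset: "free_grade W B \<delta> d \<subseteq> free_carrier W B"
  unfolding free_grade_def free_carrier_def by blast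

lemma free_carrier_closed:
  "0 \<in> free_carrier W B"
  "f \<in> free_carrier W B \<Longrightarrow> g \<in> free_carrier W B \<Longrightarrow> f + g \<in> free_carrier W B"
  "f \<in> free_carrier W B \<Longrightarrow> - f \<in> free_carrier W B"
  "f \<in> free_carrier W B \<Longrightarrow> g \<in> free_carrier W B \<Longrightarrow> f - g \<in> free_carrier W B"
  "f \<in> free_carrier W B \<Longrightarrow> free_filter P f \<in> free_carrier W B"
  unfolding free_carrier_def mem_Collect_eq by (simp, simp, metis add_0, simp, simp, metis
      diff_0_right, simp)

lemma free_grade_closed:
  "0 \<in> free_grade W B \<delta> d"
  "f \<in> free_grade W B \<delta> d \<Longrightarrow> g \<in> free_grade W B \<delta> d \<Longrightarrow> f + g \<in> free_grade W B \<delta> d"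
  "f \<in> free_grade W B \<delta> d \<Longrightarrow> - f \<in> free_grade W B \<delta> d"
  "f \<in> free_grade W B \<delta> d \<Longrightarrow> g \<in> free_grade W B \<delta> d \<Longrightarrow> f - g \<in> free_grade W B \<delta> d"
  unfolding free_grade_def mem_Collect_eq by (simp, simp, metis add_0, simp, simp, metis diff_0_right)

lemma free_carrier_sum:
  "(\<And>a. a \<in> A \<Longrightarrow> f a \<in> free_carrier W B) \<Longrightarrow> sum f A \<in> free_carrier W B"
  by (induction A rule: infinite_finite_induct) (auto simp: free_carrier_closed)

lemma free_grade_sum:
  "(\<And>a. a \<in> A \<Longrightarrow> f a \<in> free_grade W B \<delta> d) \<Longrightarrow> sum f A \<in> free_grade W B \<delta> d"
  by (induction A rule: infinite_finite_induct) (auto simp: free_grade_closed)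

lemma free_component_in_grade: "f \<in> free_carrier W B \<Longrightarrow> free_component \<delta> d f \<in> free_grade W B \<delta> d"
  by (auto simp: free_carrier_def free_grade_def)

lemma free_component_of_grade:
  "f \<in> free_grade W B \<delta> e \<Longrightarrow> free_component \<delta> d f = (if e = d then f else 0)"
  by (rule free_eqI) (auto simp: free_grade_def)

lemma free_filter_sum: "free_filter P (sum f A) = (\<Sum>a\<in>A. free_filter P (f a))"
  by (rule free_eqI) (simp add: free_coeff_sum)

lemma free_filter_0 [simp]: "free_filter P 0 = 0"
  by (rule free_eqI) simp

lemma free_smult_in_carrier:
  "p \<in> carrier (poly_ring W) \<Longrightarrow> f \<in> free_carrier W B \<Longrightarrow> free_smult p f \<in> free_carrier W B"
  unfolding free_carrier_def poly_ring_carrier_iff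
  by (clarsimp simp: free_coeff_def keys_add_nat elim!: lookup_times_nonzero)

lemma free_smult_in_grade:
  assumes "p \<in> homogeneous_part W e" "f \<in> free_grade W B \<delta> d"
  shows "free_smult p f \<in> free_grade W B \<delta> (d + e)"
proof -
  have "b \<in> B \<and> Poly_Mapping.keys m \<subseteq> W \<and> int (mon_degree m) + \<delta> b = d + e"
    if nz: "free_coeff (free_smult p f) b m \<noteq> 0" for b m
  proof -
    obtain x y where "m = x + y" "Poly_Mapping.lookup p x \<noteq> 0" "free_coeff f b y \<noteq> 0"
      using nz unfolding free_coeff_def lookup_free_smult by (rule lookup_times_nonzero)
    then show ?thesis
      using assms by (force simp: homogeneous_part_iff free_grade_def keys_add_nat mon_degree_add)
  qed
  then show ?thesis by (auto simp: free_grade_def)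
qed

lemma indet_homogeneous: "v \<in> W \<Longrightarrow> indet v \<in> homogeneous_part W 1"
  by (auto simp: homogeneous_part_iff indet_def lookup_single when_def)

lemma const_homogeneous: "Poly_Mapping.single 0 c \<in> homogeneous_part W 0"
  by (auto simp: homogeneous_part_iff lookup_single when_def)

lemma homogeneous_in_carrier: "p \<in> homogeneous_part W d \<Longrightarrow> p \<in> carrier (poly_ring W)"
  by (simp add: homogeneous_part_def)

lemma sum_free_components:
  assumes "finite E" and "\<And>b m. free_coeff f b m \<noteq> 0 \<Longrightarrow> int (mon_degree m) + \<delta> b \<in> E"
  shows "f = (\<Sum>e\<in>E. free_component \<delta> e f)"
  by (rule free_eqI) (use assms in \<open>auto simp: free_coeff_sum\<close>)

lemma free_degrees_finite: "finite {int (mon_degree m) + \<delta> b | b m. free_coeff f b m \<noteq> 0}"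
proof -
  have eq: "{int (mon_degree m) + \<delta> b | b m. free_coeff f b m \<noteq> 0}
      = (\<lambda>(b, m). int (mon_degree m) + \<delta> b) ` {(b, m). free_coeff f b m \<noteq> 0}" by auto
  show ?thesis unfolding eq by (rule finite_imageI[OF finite_free_support])
qed

section \<open>Exactness of the Koszul complex\<close>

text \<open>The monomials of \<open>p\<close> whose least variable is \<open>v\<close>, divided by
  \<open>v\<close>. Every nonconstant monomial has exactly one least variable, so these operators
  split off each of them once.\<close>

definition min_quotient :: "'v::linorder \<Rightarrow> ('v, 'k::field) mpoly \<Rightarrow> ('v, 'k) mpoly" where
  "min_quotient v p = pm_filter (\<lambda>m. \<forall>w\<in>Poly_Mapping.keys m. v \<le> w)
     (Poly_Mapping.map_key (\<lambda>m. m + Poly_Mapping.single v 1) p)"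

lemma lookup_min_quotient:
  fixes v :: "'v::linorder"
  shows "Poly_Mapping.lookup (min_quotient v p) m =
    (if \<forall>w\<in>Poly_Mapping.keys m. v \<le> w then Poly_Mapping.lookup p (m + Poly_Mapping.single v 1) else 0)"
proof -
  have "inj (\<lambda>m::'v \<Rightarrow>\<^sub>0 nat. m + Poly_Mapping.single v 1)" by (rule injI) simp
  then show ?thesis by (simp add: min_quotient_def map_key.rep_eq)
qed

lemma min_quotient_0 [simp]: "min_quotient v 0 = 0"
  by (rule poly_mapping_eqI) (simp add: lookup_min_quotient)

lemma min_quotient_homogeneous:
  assumes "p \<in> homogeneous_part W d"
  shows "min_quotient v p \<in> homogeneous_part W (d - 1)"
  unfolding homogeneous_part_iff
proof (intro allI impI)
  fix m assume "Poly_Mapping.lookup (min_quotient v p) m \<noteq> 0"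
  then have "Poly_Mapping.lookup p (m + Poly_Mapping.single v 1) \<noteq> 0"
    by (simp add: lookup_min_quotient split: if_splits)
  then have "Poly_Mapping.keys (m + Poly_Mapping.single v 1) \<subseteq> W \<and> int (mon_degree (m +
      Poly_Mapping.single v 1)) = d"
    using assms unfolding homogeneous_part_iff by blast
  then show "Poly_Mapping.keys m \<subseteq> W \<and> int (mon_degree m) = d - 1"
    by (auto simp: keys_add_nat mon_degree_add)
qed

lemma min_quotient_in_carrier:
  assumes "p \<in> carrier (poly_ring W)"
  shows "min_quotient v p \<in> carrier (poly_ring W)"
  using assms by (fastforce simp: poly_ring_carrier_iff lookup_min_quotient keys_add_nat split:
      if_splits)

text \<open>A monomial at the index set \<open>\<sigma> - {v}\<close> is divided by the variable
  \<open>v\<close> and moved to \<open>\<sigma>\<close>, provided \<open>v\<close> is least in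
  \<open>\<sigma>\<close> and in the monomial. Nothing arrives at the empty set, as the homotopy
  raises the homological degree.\<close>

definition koszul_homotopy :: "('v::linorder set \<Rightarrow> ('v, 'k::field) mpoly) \<Rightarrow> 'v set \<Rightarrow> ('v, 'k) mpoly"
    where
  "koszul_homotopy f \<sigma> = (if \<sigma> = {} then 0 else min_quotient (Min \<sigma>) (f (\<sigma> - {Min \<sigma>})))"

lemma lookup_alternate: "Poly_Mapping.lookup (alternate n p) m = alternate n (Poly_Mapping.lookup p m)"
  by (simp add: alternate_def)

lemma lookup_koszul_poly:
  "Poly_Mapping.lookup (koszul W (\<lambda>v p. indet v * p) f \<tau>) m =
    (\<Sum>u\<in>W - \<tau>. alternate (card {w\<in>\<tau>. w < u}) (if u \<in> Poly_Mapping.keys m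
       then Poly_Mapping.lookup (f (insert u \<tau>)) (m - Poly_Mapping.single u 1) else 0))"
  by (simp add: koszul_def lookup_sum lookup_alternate lookup_indet_times)

lemma minus_single_plus_single:
  fixes m :: "'v \<Rightarrow>\<^sub>0 nat"
  assumes "u \<in> Poly_Mapping.keys m"
  shows "m - Poly_Mapping.single u 1 + Poly_Mapping.single v 1 = m + Poly_Mapping.single v 1 -
      Poly_Mapping.single u 1"
  using assms by (intro poly_mapping_eqI) (auto simp: lookup_add lookup_minus lookup_single when_def
      in_keys_iff)

text \<open>In multidegree \<open>a\<close> the Koszul complex is the augmented chain complex of the full simplex on the
  support of \<open>a\<close>; the homotopy is the cone operator with apex the least vertex.\<close>

lemma koszul_homotopy:
  assumes "finite W" "\<tau> \<subseteq> W" "Poly_Mapping.keys m \<subseteq> W" "\<tau> \<noteq> {} \<or> m \<noteq> 0"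
  shows "Poly_Mapping.lookup (koszul W (\<lambda>v p. indet v * p) (koszul_homotopy f) \<tau>) m
    + Poly_Mapping.lookup (koszul_homotopy (koszul W (\<lambda>v p. indet v * p) f) \<tau>) m
    = Poly_Mapping.lookup (f \<tau>) m"
proof -
  let ?l = "Poly_Mapping.lookup" and ?k = "Poly_Mapping.keys" and ?s = "\<lambda>v. Poly_Mapping.single v
      (1::nat)"
  let ?K = "koszul W (\<lambda>v p. indet v * p)"
  \<comment> \<open>The apex exists except for the constant monomial at the empty index set, the one
    place where the Koszul complex of a polynomial ring has homology.\<close>
  define v where "v = Min (\<tau> \<union> ?k m)"
  have fin: "finite \<tau>" using assms finite_subset by auto
  have ne: "\<tau> \<union> ?k m \<noteq> {}" using assms(4) by auto
  have v_in: "v \<in> \<tau> \<union> ?k m" unfolding v_def using fin ne by (intro Min_in) auto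
  have v_le: "v \<le> u" if "u \<in> \<tau> \<union> ?k m" for u unfolding v_def using fin that by (intro Min_le) auto
  have first: "?l (?K (koszul_homotopy f) \<tau>) m = (\<Sum>u\<in>W - \<tau>. alternate (card {w\<in>\<tau>. w < u})
      (if u \<in> ?k m then ?l (min_quotient (Min (insert u \<tau>)) (f (insert u \<tau> - {Min (insert u \<tau>)})))
          (m - ?s u) else 0))"
    unfolding lookup_koszul_poly by (simp add: koszul_homotopy_def cong: if_cong)
  show ?thesis
  proof (cases "v \<in> \<tau>")
    \<comment> \<open>The least element occurs only in the monomial: the second term vanishes, and
      in the first one only \<open>u = v\<close> passes the minimality test, which returns
      \<open>f \<tau>\<close>.\<close>
    case False
    then have vm: "v \<in> ?k m" "v \<in> W - \<tau>" using v_in assms(3) by auto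
    have below: "v < u" if "u \<in> \<tau>" for u using that v_le[of u] False by (metis UnI1 order_le_less)
    have "?l (koszul_homotopy (?K f) \<tau>) m = 0"
    proof (cases "\<tau> = {}")
      case nonempty: False
      then have "v < Min \<tau>" using below fin by simp
      then show ?thesis using nonempty vm by (auto simp: koszul_homotopy_def lookup_min_quotient)
    qed (simp add: koszul_homotopy_def)
    moreover have "?l (?K (koszul_homotopy f) \<tau>) m = (\<Sum>u\<in>W - \<tau>. if u = v then ?l (f \<tau>) m else 0)"
      unfolding first
    proof (intro sum.cong refl)
      fix u assume u: "u \<in> W - \<tau>"
      show "alternate (card {w\<in>\<tau>. w < u}) (if u \<in> ?k m
          then ?l (min_quotient (Min (insert u \<tau>)) (f (insert u \<tau> - {Min (insert u \<tau>)}))) (m - ?s u)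
              else 0)
        = (if u = v then ?l (f \<tau>) m else 0)"
      proof (cases "u = v")
        case True
        have "Min (insert v \<tau>) = v" using fin below by (intro Min_eqI) (auto intro: less_imp_le)
        moreover have "card {w\<in>\<tau>. w < v} = 0" using below by (force simp: card_eq_0_iff)
        moreover have "insert v \<tau> - {v} = \<tau>" using False by auto
        moreover have "\<forall>w\<in>?k (m - ?s v). v \<le> w" using v_le keys_minus_nat[of m "?s v"] by blast
        moreover have "m - ?s v + ?s v = m" using minus_single_plus_single[OF vm(1), of v] by simp
        ultimately show ?thesis unfolding True using vm by (simp add: lookup_min_quotient
            alternate_def del: card_eq_0_iff)
      next
        case neq: False
        have "?l (min_quotient (Min (insert u \<tau>)) (f (insert u \<tau> - {Min (insert u \<tau>)}))) (m - ?s u) = 0"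
          if um: "u \<in> ?k m"
        proof -
          have "v < u" using v_le[of u] um neq by auto
          then have "v < Min (insert u \<tau>)" using below fin by simp
          moreover have "v \<in> ?k (m - ?s u)"
            using vm(1) neq by (simp add: in_keys_iff lookup_minus lookup_single when_def)
          ultimately show ?thesis by (auto simp: lookup_min_quotient)
        qed
        then show ?thesis using neq by simp
      qed
    qed
    ultimately show ?thesis using vm(2) assms(1) by simp
  next
    \<comment> \<open>The least element belongs to \<open>\<tau>\<close>: the second term is the
      differential at \<open>\<rho>\<close>, whose summand \<open>u = v\<close> gives
      \<open>f \<tau>\<close>. Its other summands cancel the first term, since \<open>v < u\<close>
      shifts the sign count by one.\<close>
    case True
    have Min\<tau>: "Min \<tau> = v" using True fin v_le by (intro Min_eqI) auto
    define \<rho> where "\<rho> = \<tau> - {v}"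
    have \<tau>: "\<tau> = insert v \<rho>" "v \<notin> \<rho>" "finite \<rho>" using True fin by (auto simp: \<rho>_def)
    have W\<rho>: "W - \<rho> = insert v (W - \<tau>)" using assms(2) \<tau> by auto
    define t where "t u = (if u \<in> ?k m then ?l (f (insert u \<rho>)) (m + ?s v - ?s u) else 0)" for u
    have "?l (koszul_homotopy (?K f) \<tau>) m = ?l (?K f \<rho>) (m + ?s v)"
      using True v_le by (auto simp: koszul_homotopy_def Min\<tau> lookup_min_quotient \<rho>_def)
    also have "\<dots> = ?l (f \<tau>) m + (\<Sum>u\<in>W - \<tau>. alternate (card {w\<in>\<rho>. w < u}) (t u))"
    proof -
      have "{w\<in>\<rho>. w < v} = {}" using v_le \<tau> by fastforce
      then have "alternate (card {w\<in>\<rho>. w < v}) x = x" for x :: 'b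
        by (simp only: card.empty) (simp add: alternate_def)
      moreover have "u \<noteq> v" if "u \<in> W - \<tau>" for u using that True by auto
      ultimately show ?thesis
        unfolding lookup_koszul_poly W\<rho> using assms(1) True
        by (auto simp: keys_add_nat t_def \<tau>(1)[symmetric] intro!: sum.cong)
    qed
    finally have second: "?l (koszul_homotopy (?K f) \<tau>) m
      = ?l (f \<tau>) m + (\<Sum>u\<in>W - \<tau>. alternate (card {w\<in>\<rho>. w < u}) (t u))" .
    have "?l (?K (koszul_homotopy f) \<tau>) m = (\<Sum>u\<in>W - \<tau>. - alternate (card {w\<in>\<rho>. w < u}) (t u))"
      unfolding first
    proof (intro sum.cong refl)
      fix u assume u: "u \<in> W - \<tau>"
      show "alternate (card {w\<in>\<tau>. w < u}) (if u \<in> ?k m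
          then ?l (min_quotient (Min (insert u \<tau>)) (f (insert u \<tau> - {Min (insert u \<tau>)}))) (m - ?s u)
              else 0)
        = - alternate (card {w\<in>\<rho>. w < u}) (t u)"
      proof (cases "u \<in> ?k m")
        case um: True
        have "v < u" using v_le[of u] um u True by (metis DiffD2 UnI2 order_le_less)
        then have "Min (insert u \<tau>) = v" using Min\<tau> fin True
          by (metis Min_insert empty_iff min.strict_order_iff min.commute)
        moreover have "insert u \<tau> - {v} = insert u \<rho>" using \<open>v < u\<close> by (auto simp: \<rho>_def)
        moreover have "\<forall>w\<in>?k (m - ?s u). v \<le> w" using v_le keys_minus_nat[of m "?s u"] by blast
        moreover have "card {w\<in>\<tau>. w < u} = Suc (card {w\<in>\<rho>. w < u})"
          using card_insert_below[OF \<tau>(3,2), of u] \<open>v < u\<close> \<tau>(1) by simp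
        ultimately show ?thesis
          using um minus_single_plus_single[OF um, of v] by (simp add: lookup_min_quotient t_def
              alternate_def)
      qed (simp add: t_def)
    qed
    then show ?thesis using second by (simp add: sum_negf)
  qed
qed

text \<open>For nonconstant monomials this is the homotopy identity at the empty index set. It will
  separate the constant parts of the coefficients of a relation from the parts in the irrelevant
  ideal.\<close>

lemma poly_decomposition:
  assumes "finite W" "p \<in> carrier (poly_ring W)"
  shows "p = Poly_Mapping.single 0 (Poly_Mapping.lookup p 0) + (\<Sum>v\<in>W. indet v * min_quotient v p)"
proof (rule poly_mapping_eqI)
  fix m
  have eq: "(\<Sum>v\<in>W. indet v * min_quotient v p) = koszul W (\<lambda>v p. indet v * p) (koszul_homotopy (\<lambda>_.
      p)) {}"
    by (simp add: koszul_def koszul_homotopy_def alternate_def)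
  have "Poly_Mapping.lookup (\<Sum>v\<in>W. indet v * min_quotient v p) m = (if m = 0 then 0 else
      Poly_Mapping.lookup p m)"
  proof (cases "m \<noteq> 0 \<and> Poly_Mapping.keys m \<subseteq> W")
    case True
    then show ?thesis
      using koszul_homotopy[of W "{}" m "\<lambda>_. p"] assms(1) unfolding eq by (simp add: koszul_homotopy_def)
  next
    case False
    moreover have "(\<Sum>v\<in>W. indet v * min_quotient v p) \<in> carrier (poly_ring W)"
    proof -
      have "sum h A \<in> carrier (poly_ring W)" if "\<And>a. a \<in> A \<Longrightarrow> h a \<in> carrier (poly_ring W)"
        for h :: "'a \<Rightarrow> ('a, 'b) mpoly" and A
        using that by (induction A rule: infinite_finite_induct) (auto simp: poly_ring_closed)
      then show ?thesis using assms(2) by (simp add: poly_ring_closed min_quotient_in_carrier)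
    qed
    ultimately show ?thesis
      using assms(2) unfolding poly_ring_carrier_iff
      by (cases "m = 0") (simp add: lookup_sum lookup_indet_times, metis)
  qed
  then show "Poly_Mapping.lookup p m = Poly_Mapping.lookup (Poly_Mapping.single 0
      (Poly_Mapping.lookup p 0) + (\<Sum>v\<in>W. indet v * min_quotient v p)) m"
    by (simp add: lookup_add lookup_single when_def)
qed

lemma lookup_koszul_free:
  "Poly_Mapping.lookup (koszul W (\<lambda>v. free_smult (indet v)) f \<tau>) b =
    koszul W (\<lambda>v p. indet v * p) (\<lambda>\<sigma>. Poly_Mapping.lookup (f \<sigma>) b) \<tau>"
  by (simp add: koszul_def lookup_sum lookup_alternate)

lemma free_carrierD:
  "f \<in> free_carrier W B \<Longrightarrow> free_coeff f b m \<noteq> 0 \<Longrightarrow> b \<in> B \<and> Poly_Mapping.keys m \<subseteq> W"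
  by (simp add: free_carrier_def)

text \<open>In each coordinate the homotopy identity reads \<open>f = d (s f) + s (d f)\<close>, and
  the last term vanishes for a cycle. In degree 0 the constants escape the homotopy, whence the
  condition \<open>aug\<close>.\<close>

lemma koszul_free_exact:
  fixes f :: "'v::linorder set \<Rightarrow> ('i \<Rightarrow>\<^sub>0 ('v, 'k::field) mpoly)"
  assumes W: "finite W"
    and car: "\<And>\<sigma>. \<sigma> \<subseteq> W \<Longrightarrow> card \<sigma> = i \<Longrightarrow> f \<sigma> \<in> free_carrier W B"
    and cycle: "\<And>\<tau>. \<tau> \<subseteq> W \<Longrightarrow> Suc (card \<tau>) = i \<Longrightarrow> koszul W (\<lambda>v. free_smult (indet v)) f \<tau> = 0"
    and aug: "\<And>b. i = 0 \<Longrightarrow> free_coeff (f {}) b 0 = 0"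
  obtains g where "\<And>\<sigma>. \<sigma> \<subseteq> W \<Longrightarrow> card \<sigma> = Suc i \<Longrightarrow> g \<sigma> \<in> free_carrier W B"
    and "\<And>\<sigma>. \<sigma> \<subseteq> W \<Longrightarrow> card \<sigma> = i \<Longrightarrow> f \<sigma> = koszul W (\<lambda>v. free_smult (indet v)) g \<sigma>"
proof
  let ?l = "Poly_Mapping.lookup"
  define g where "g \<sigma> = (if \<sigma> = {} then 0 else Poly_Mapping.map (min_quotient (Min \<sigma>)) (f (\<sigma> - {Min
      \<sigma>})))" for \<sigma>
  have lookup_g: "?l (g \<sigma>) b = koszul_homotopy (\<lambda>\<sigma>. ?l (f \<sigma>) b) \<sigma>" for \<sigma> b
    by (simp add: g_def koszul_homotopy_def map.rep_eq when_def)
  show g: "g \<sigma> \<in> free_carrier W B" if "\<sigma> \<subseteq> W" "card \<sigma> = Suc i" for \<sigma>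
  proof -
    have fin: "finite \<sigma>" and ne: "\<sigma> \<noteq> {}" using that W finite_subset by auto
    have "f (\<sigma> - {Min \<sigma>}) \<in> free_carrier W B"
      using car that fin ne by (simp add: card_Diff_singleton subset_iff)
    then show ?thesis
      using ne unfolding free_carrier_def
      by (fastforce simp: free_coeff_def lookup_g koszul_homotopy_def lookup_min_quotient keys_add_nat
          split: if_splits)
  qed
  show "f \<sigma> = koszul W (\<lambda>v. free_smult (indet v)) g \<sigma>" if \<sigma>: "\<sigma> \<subseteq> W" "card \<sigma> = i" for \<sigma>
  proof (rule free_eqI)
    fix b m
    have fin: "finite \<sigma>" using \<sigma> W finite_subset by auto
    have in_car: "koszul W (\<lambda>v. free_smult (indet v)) g \<sigma> \<in> free_carrier W B"
      unfolding koszul_def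
    proof (rule free_carrier_sum)
      fix v assume v: "v \<in> W - \<sigma>"
      then have "g (insert v \<sigma>) \<in> free_carrier W B" using g[of "insert v \<sigma>"] \<sigma> fin by simp
      then show "alternate (card {w \<in> \<sigma>. w < v}) (free_smult (indet v) (g (insert v \<sigma>))) \<in>
          free_carrier W B"
        using v by (simp add: alternate_def free_carrier_closed free_smult_in_carrier poly_ring_closed)
    qed
    show "free_coeff (f \<sigma>) b m = free_coeff (koszul W (\<lambda>v. free_smult (indet v)) g \<sigma>) b m"
    proof (cases "Poly_Mapping.keys m \<subseteq> W")
      case False
      then show ?thesis using free_carrierD[OF in_car] free_carrierD[OF car[OF \<sigma>]] by metis
    next
      case m: True
      show ?thesis
      proof (cases "\<sigma> = {} \<and> m = 0")
        case True
        then show ?thesis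
          using aug \<sigma> by (simp add: free_coeff_def lookup_koszul_free lookup_koszul_poly)
      next
        case False
        have "koszul_homotopy (koszul W (\<lambda>v p. indet v * p) (\<lambda>\<sigma>. ?l (f \<sigma>) b)) \<sigma> = 0"
        proof (cases "\<sigma> = {}")
          case ne: False
          then have "\<sigma> - {Min \<sigma>} \<subseteq> W" "Suc (card (\<sigma> - {Min \<sigma>})) = i"
            using \<sigma> fin by (auto simp: card_Suc_Diff1 simp del: card_Diff_insert)
          from arg_cong[OF cycle[OF this], of "\<lambda>x. ?l x b"] show ?thesis
            using ne by (simp add: koszul_homotopy_def lookup_koszul_free)
        qed (simp add: koszul_homotopy_def)
        then show ?thesis
          using koszul_homotopy[OF W \<sigma>(1) m, of "\<lambda>\<sigma>. ?l (f \<sigma>) b"] False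
          by (auto simp: free_coeff_def lookup_koszul_free lookup_g)
      qed
    qed
  qed
qed

section \<open>Graded homomorphisms and dimension shifting\<close>

text \<open>With \<open>\<Gamma> = UNIV\<close> these are the graded homomorphisms of free modules. In general the target is the
  quotient of a free module by the monomials with support outside \<open>\<Gamma>\<close>, whose elements are
  represented by their normal forms.\<close>

locale free_hom =
  fixes W :: "'v::linorder set" and \<Gamma> :: "'v set set" and B :: "'i set" and \<delta> :: "'i \<Rightarrow> int"
    and B' :: "'j set" and \<delta>' :: "'j \<Rightarrow> int"
    and \<phi> :: "('i \<Rightarrow>\<^sub>0 ('v, 'k::field) mpoly) \<Rightarrow> ('j \<Rightarrow>\<^sub>0 ('v, 'k) mpoly)"
  assumes closed: "x \<in> free_carrier W B \<Longrightarrow> \<phi> x \<in> free_carrier W B'"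
    and add: "x \<in> free_carrier W B \<Longrightarrow> y \<in> free_carrier W B \<Longrightarrow> \<phi> (x + y) = \<phi> x + \<phi> y"
    and smult: "p \<in> carrier (poly_ring W) \<Longrightarrow> x \<in> free_carrier W B \<Longrightarrow>
      \<phi> (free_smult p x) = supported_part \<Gamma> (free_smult p (\<phi> x))"
    and graded: "x \<in> free_grade W B \<delta> d \<Longrightarrow> \<phi> x \<in> free_grade W B' \<delta>' d"
begin

lemma hom_zero: "\<phi> 0 = 0"
  using add[of 0 0] by (simp add: free_carrier_closed)

lemma hom_uminus: "x \<in> free_carrier W B \<Longrightarrow> \<phi> (- x) = - \<phi> x"
  using add[of x "- x"] by (simp add: free_carrier_closed hom_zero eq_neg_iff_add_eq_0 add.commute)

lemma hom_diff: "x \<in> free_carrier W B \<Longrightarrow> y \<in> free_carrier W B \<Longrightarrow> \<phi> (x - y) = \<phi> x - \<phi> y"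
  using add[of x "- y"] by (simp add: free_carrier_closed hom_uminus)

lemma hom_sum: "(\<And>a. a \<in> A \<Longrightarrow> f a \<in> free_carrier W B) \<Longrightarrow> \<phi> (sum f A) = (\<Sum>a\<in>A. \<phi> (f a))"
  by (induction A rule: infinite_finite_induct) (simp_all add: hom_zero add free_carrier_sum)

text \<open>The scalar 1 in \<open>smult\<close> shows that values are already truncated.\<close>

lemma hom_supported: "x \<in> free_carrier W B \<Longrightarrow> supported_part \<Gamma> (\<phi> x) = \<phi> x"
  using smult[of 1 x] by (simp add: poly_ring_closed)

lemma hom_component:
  assumes x: "x \<in> free_carrier W B"
  shows "\<phi> (free_component \<delta> d x) = free_component \<delta>' d (\<phi> x)"
proof -
  \<comment> \<open>\<open>d\<close> is inserted so that the one surviving summand exists even if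
    \<open>x\<close> has no part of degree \<open>d\<close>.\<close>
  define E where "E = insert d {int (mon_degree m) + \<delta> b | b m. free_coeff x b m \<noteq> 0}"
  have E: "finite E" "d \<in> E" by (simp_all add: E_def free_degrees_finite)
  have x_eq: "x = (\<Sum>e\<in>E. free_component \<delta> e x)"
    by (rule sum_free_components) (auto simp: E_def free_degrees_finite)
  have comp: "free_component \<delta> e x \<in> free_grade W B \<delta> e" for e
    using x by (rule free_component_in_grade)
  have "\<phi> x = (\<Sum>e\<in>E. \<phi> (free_component \<delta> e x))"
    by (subst x_eq, rule hom_sum) (use comp free_grade_subset in blast)
  then have "free_component \<delta>' d (\<phi> x) = (\<Sum>e\<in>E. free_component \<delta>' d (\<phi> (free_component \<delta> e x)))"
    by (simp add: free_filter_sum)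
  also have "\<dots> = (\<Sum>e\<in>E. if e = d then \<phi> (free_component \<delta> d x) else 0)"
    by (rule sum.cong[OF refl]) (simp add: free_component_of_grade[OF graded[OF comp]])
  also have "\<dots> = \<phi> (free_component \<delta> d x)" using E by simp
  finally show ?thesis by simp
qed

text \<open>The component of degree \<open>d\<close> of any preimage is again a preimage.\<close>

lemma graded_lift:
  assumes "y \<in> \<phi> ` free_carrier W B" "y \<in> free_grade W B' \<delta>' d"
  obtains x where "x \<in> free_grade W B \<delta> d" "\<phi> x = y"
proof -
  obtain x where x: "x \<in> free_carrier W B" "y = \<phi> x" using assms(1) by auto
  have "\<phi> (free_component \<delta> d x) = y"
    using hom_component[OF x(1)] free_component_of_grade[OF assms(2), of d] x(2) by simp
  then show ?thesis using that free_component_in_grade[OF x(1)] by blast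
qed

end

section \<open>Koszul complexes of free modules and of their truncations\<close>

abbreviation koszul_free ::
  "'v::linorder set \<Rightarrow> ('v set \<Rightarrow> ('i \<Rightarrow>\<^sub>0 ('v, 'k::field) mpoly)) \<Rightarrow> 'v set \<Rightarrow> ('i \<Rightarrow>\<^sub>0 ('v, 'k) mpoly)" where
  "koszul_free W \<equiv> koszul W (\<lambda>v. free_smult (indet v))"

abbreviation koszul_supported ::
  "'v::linorder set \<Rightarrow> 'v set set \<Rightarrow> ('v set \<Rightarrow> ('i \<Rightarrow>\<^sub>0 ('v, 'k::field) mpoly)) \<Rightarrow> 'v set \<Rightarrow> ('i \<Rightarrow>\<^sub>0 ('v,
      'k) mpoly)" where
  "koszul_supported W \<Gamma> \<equiv> koszul W (\<lambda>v x. supported_part \<Gamma> (free_smult (indet v) x))"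

text \<open>Vanishing of the Koszul homology of \<open>N\<close> in degree \<open>i\<close>, for
  cycles with values in \<open>G\<close>. In use \<open>G\<close> is the part of \<open>N\<close> of
  degree \<open>j - i\<close>, which means total degree \<open>j\<close> since an index set of size
  \<open>i\<close> carries degree \<open>i\<close>. For \<open>i = 0\<close> the cycle condition is
  void. The bounding family need not be homogeneous.\<close>

definition koszul_acyclic ::
  "'v::linorder set \<Rightarrow> 'v set set \<Rightarrow> ('i \<Rightarrow>\<^sub>0 ('v, 'k::field) mpoly) set \<Rightarrow> ('i \<Rightarrow>\<^sub>0 ('v, 'k) mpoly) set
      \<Rightarrow> nat \<Rightarrow> bool" where
  "koszul_acyclic W \<Gamma> G N i \<longleftrightarrow> (\<forall>f.
     (\<forall>\<sigma>. \<sigma> \<subseteq> W \<longrightarrow> card \<sigma> = i \<longrightarrow> f \<sigma> \<in> G) \<longrightarrow>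
     (\<forall>\<tau>. \<tau> \<subseteq> W \<longrightarrow> Suc (card \<tau>) = i \<longrightarrow> koszul_supported W \<Gamma> f \<tau> = 0) \<longrightarrow>
     (\<exists>g. (\<forall>\<sigma>. \<sigma> \<subseteq> W \<longrightarrow> card \<sigma> = Suc i \<longrightarrow> g \<sigma> \<in> N) \<and>
          (\<forall>\<sigma>. \<sigma> \<subseteq> W \<longrightarrow> card \<sigma> = i \<longrightarrow> f \<sigma> = koszul_supported W \<Gamma> g \<sigma>)))"

lemma free_filter_True [simp]: "free_filter (\<lambda>b m. True) x = x"
  by (rule free_eqI) simp

lemma koszul_cong:
  "(\<And>v. v \<in> W - \<tau> \<Longrightarrow> f (insert v \<tau>) = g (insert v \<tau>)) \<Longrightarrow> koszul W act f \<tau> = koszul W act g \<tau>"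
  unfolding koszul_def by (rule sum.cong[OF refl]) simp

lemma koszul_free_diff:
  fixes f g :: "'v::linorder set \<Rightarrow> ('i \<Rightarrow>\<^sub>0 ('v, 'k::field) mpoly)"
  shows "koszul_free W (\<lambda>\<sigma>. f \<sigma> - g \<sigma>) \<tau> = koszul_free W f \<tau> - koszul_free W g \<tau>"
proof -
  have "free_smult p (x - y) = free_smult p x - free_smult p y" for p and x y :: "'i \<Rightarrow>\<^sub>0 ('v, 'k) mpoly"
    using free_smult_add[of p x "- y"] by (simp add: free_smult_uminus)
  then show ?thesis by (simp add: koszul_def alternate_diff sum_subtractf)
qed

lemma koszul_free_koszul_free:
  "finite W \<Longrightarrow> \<tau> \<subseteq> W \<Longrightarrow> koszul_free W (koszul_free W f) \<tau> = 0"
  by (rule koszul_koszul) (simp_all add: free_smult_add free_smult_assoc mult.commute)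

lemma alternate_closed:
  "x \<in> free_carrier W B \<Longrightarrow> alternate n x \<in> free_carrier W B"
  "x \<in> free_grade W B \<delta> d \<Longrightarrow> alternate n x \<in> free_grade W B \<delta> d"
  by (simp_all add: alternate_def free_carrier_closed free_grade_closed)

lemma koszul_free_in_grade:
  assumes "\<And>v. v \<in> W - \<tau> \<Longrightarrow> f (insert v \<tau>) \<in> free_grade W B \<delta> (d - 1)"
  shows "koszul_free W f \<tau> \<in> free_grade W B \<delta> d"
  unfolding koszul_def
proof (rule free_grade_sum)
  fix v assume v: "v \<in> W - \<tau>"
  have "free_smult (indet v) (f (insert v \<tau>)) \<in> free_grade W B \<delta> (d - 1 + 1)"
    using v assms by (intro free_smult_in_grade indet_homogeneous) auto
  then show "alternate (card {w \<in> \<tau>. w < v}) (free_smult (indet v) (f (insert v \<tau>))) \<in> free_grade W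
      B \<delta> d"
    by (simp add: alternate_closed)
qed

text \<open>On the target side the multiplication by a variable is followed by truncation, as a
  variable times a face monomial can have nonface support.\<close>

lemma (in free_hom) hom_koszul:
  assumes "\<And>v. v \<in> W - \<tau> \<Longrightarrow> f (insert v \<tau>) \<in> free_carrier W B"
  shows "\<phi> (koszul_free W f \<tau>) = koszul_supported W \<Gamma> (\<lambda>\<sigma>. \<phi> (f \<sigma>)) \<tau>"
proof -
  have car: "free_smult (indet v) (f (insert v \<tau>)) \<in> free_carrier W B" if "v \<in> W - \<tau>" for v
    using that assms by (simp add: free_smult_in_carrier poly_ring_closed)
  have alt: "\<phi> (alternate n x) = alternate n (\<phi> x)" if "x \<in> free_carrier W B" for n x
    using that by (simp add: alternate_def hom_uminus)
  have "\<phi> (koszul_free W f \<tau>)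
      = (\<Sum>v\<in>W - \<tau>. \<phi> (alternate (card {w\<in>\<tau>. w < v}) (free_smult (indet v) (f (insert v \<tau>)))))"
    unfolding koszul_def by (rule hom_sum) (simp add: alternate_closed car)
  also have "\<dots> = koszul_supported W \<Gamma> (\<lambda>\<sigma>. \<phi> (f \<sigma>)) \<tau>"
    unfolding koszul_def
    by (rule sum.cong[OF refl]) (simp add: alt[OF car] smult assms poly_ring_closed)
  finally show ?thesis .
qed

text \<open>Dimension shifting: as the Koszul complex of a free module is exact in positive degrees, the
  Koszul homology of the image of \<open>\<phi>\<close> in degree \<open>i + 1\<close> embeds into that of the kernel in degree \<open>i\<close>.\<close>

lemma (in free_hom) koszul_acyclic_image:
  fixes j :: int and i :: nat
  defines "K \<equiv> {x \<in> free_carrier W B. \<phi> x = 0}"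
  assumes W: "finite W" and ker: "koszul_acyclic W UNIV (K \<inter> free_grade W B \<delta> (j - int i)) K i"
  shows "koszul_acyclic W \<Gamma> (\<phi> ` free_carrier W B \<inter> free_grade W B' \<delta>' (j - int (Suc i)))
    (\<phi> ` free_carrier W B) (Suc i)"
  unfolding koszul_acyclic_def
proof (intro allI impI)
  fix f :: "'v set \<Rightarrow> _"
  assume f: "\<forall>\<sigma>. \<sigma> \<subseteq> W \<longrightarrow> card \<sigma> = Suc i \<longrightarrow>
      f \<sigma> \<in> \<phi> ` free_carrier W B \<inter> free_grade W B' \<delta>' (j - int (Suc i))"
    and cycle: "\<forall>\<tau>. \<tau> \<subseteq> W \<longrightarrow> Suc (card \<tau>) = Suc i \<longrightarrow> koszul_supported W \<Gamma> f \<tau> = 0"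
  have "\<exists>x. x \<in> free_grade W B \<delta> (j - int (Suc i)) \<and> \<phi> x = f \<sigma>" if "\<sigma> \<subseteq> W" "card \<sigma> = Suc i" for \<sigma>
    using f that graded_lift by blast
  then obtain x where x: "\<And>\<sigma>. \<sigma> \<subseteq> W \<Longrightarrow> card \<sigma> = Suc i \<Longrightarrow>
      x \<sigma> \<in> free_grade W B \<delta> (j - int (Suc i)) \<and> \<phi> (x \<sigma>) = f \<sigma>"
    by metis
  have fin: "finite \<tau>" if "\<tau> \<subseteq> W" for \<tau> using that W finite_subset by blast
  have ins: "insert v \<tau> \<subseteq> W" "card (insert v \<tau>) = Suc (card \<tau>)" if "\<tau> \<subseteq> W" "v \<in> W - \<tau>" for \<tau> v
    using that fin by auto
  have xcar: "x \<sigma> \<in> free_carrier W B" if "\<sigma> \<subseteq> W" "card \<sigma> = Suc i" for \<sigma>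
    using x[OF that] free_grade_subset by blast
  \<comment> \<open>This is the connecting homomorphism: the differential of the lift maps to the
    differential of \<open>f\<close>, which is zero, and the variable raises the degree by
    one.\<close>
  have kx: "koszul_free W x \<tau> \<in> K \<inter> free_grade W B \<delta> (j - int i)" if \<tau>: "\<tau> \<subseteq> W" "card \<tau> = i" for \<tau>
  proof -
    have "x (insert v \<tau>) \<in> free_grade W B \<delta> (j - int i - 1)" if "v \<in> W - \<tau>" for v
      using x[of "insert v \<tau>"] ins[OF \<tau>(1) that] \<tau>(2) by (simp add: algebra_simps)
    then have g: "koszul_free W x \<tau> \<in> free_grade W B \<delta> (j - int i)"
      by (rule koszul_free_in_grade)
    have "\<phi> (koszul_free W x \<tau>) = koszul_supported W \<Gamma> (\<lambda>\<sigma>. \<phi> (x \<sigma>)) \<tau>"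
      by (rule hom_koszul) (use xcar ins \<tau> in auto)
    also have "\<dots> = koszul_supported W \<Gamma> f \<tau>"
      by (rule koszul_cong) (use x ins \<tau> in auto)
    also have "\<dots> = 0" using cycle \<tau> by simp
    finally show ?thesis using g free_grade_subset unfolding K_def by blast
  qed
  \<comment> \<open>Acyclicity of the kernel applies to the family \<open>koszul_free W x\<close>,
    which is itself a cycle because the differential squares to zero.\<close>
  have "\<exists>y. (\<forall>\<sigma>. \<sigma> \<subseteq> W \<longrightarrow> card \<sigma> = Suc i \<longrightarrow> y \<sigma> \<in> K) \<and>
      (\<forall>\<tau>. \<tau> \<subseteq> W \<longrightarrow> card \<tau> = i \<longrightarrow> koszul_free W x \<tau> = koszul_supported W UNIV y \<tau>)"
    by (rule ker[unfolded koszul_acyclic_def, rule_format])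
      (use kx W koszul_free_koszul_free in simp_all)
  then obtain y where y: "\<And>\<sigma>. \<sigma> \<subseteq> W \<Longrightarrow> card \<sigma> = Suc i \<Longrightarrow> y \<sigma> \<in> K"
    "\<And>\<tau>. \<tau> \<subseteq> W \<Longrightarrow> card \<tau> = i \<Longrightarrow> koszul_free W x \<tau> = koszul_free W y \<tau>"
    by auto
  \<comment> \<open>\<open>x - y\<close> is a cycle of the free module in positive degree, hence a
    boundary. As \<open>\<phi>\<close> kills \<open>y\<close>, the image of that boundary is
    \<open>f\<close>.\<close>
  obtain z where z: "\<And>\<sigma>. \<sigma> \<subseteq> W \<Longrightarrow> card \<sigma> = Suc (Suc i) \<Longrightarrow> z \<sigma> \<in> free_carrier W B"
    "\<And>\<sigma>. \<sigma> \<subseteq> W \<Longrightarrow> card \<sigma> = Suc i \<Longrightarrow> x \<sigma> - y \<sigma> = koszul_free W z \<sigma>"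
  proof (rule koszul_free_exact[OF W, where i = "Suc i" and f = "\<lambda>\<sigma>. x \<sigma> - y \<sigma>" and B = B])
    show "x \<sigma> - y \<sigma> \<in> free_carrier W B" if "\<sigma> \<subseteq> W" "card \<sigma> = Suc i" for \<sigma>
      using xcar[OF that] y(1)[OF that] by (auto simp: K_def free_carrier_closed)
    show "koszul_free W (\<lambda>\<sigma>. x \<sigma> - y \<sigma>) \<tau> = 0" if "\<tau> \<subseteq> W" "Suc (card \<tau>) = Suc i" for \<tau>
      using that y(2) by (simp add: koszul_free_diff)
  qed auto
  have "f \<sigma> = koszul_supported W \<Gamma> (\<lambda>\<sigma>. \<phi> (z \<sigma>)) \<sigma>" if \<sigma>: "\<sigma> \<subseteq> W" "card \<sigma> = Suc i" for \<sigma>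
  proof -
    have "y \<sigma> \<in> free_carrier W B" "\<phi> (y \<sigma>) = 0" using y(1)[OF \<sigma>] by (auto simp: K_def)
    then have "f \<sigma> = \<phi> (x \<sigma> - y \<sigma>)" using x[OF \<sigma>] xcar[OF \<sigma>] by (simp add: hom_diff)
    also have "\<dots> = koszul_supported W \<Gamma> (\<lambda>\<sigma>. \<phi> (z \<sigma>)) \<sigma>"
      unfolding z(2)[OF \<sigma>] by (rule hom_koszul) (use z(1) ins \<sigma> in auto)
    finally show ?thesis .
  qed
  then show "\<exists>g. (\<forall>\<sigma>. \<sigma> \<subseteq> W \<longrightarrow> card \<sigma> = Suc (Suc i) \<longrightarrow> g \<sigma> \<in> \<phi> ` free_carrier W B) \<and>
      (\<forall>\<sigma>. \<sigma> \<subseteq> W \<longrightarrow> card \<sigma> = Suc i \<longrightarrow> f \<sigma> = koszul_supported W \<Gamma> g \<sigma>)"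
    using z(1) by (intro exI[of _ "\<lambda>\<sigma>. \<phi> (z \<sigma>)"]) blast
qed

text \<open>The start of the dimension shift. An element of degree \<open>j\<close> has constant
  coefficients only at generators of degree \<open>j\<close>; without these it lies in the
  irrelevant ideal times the free module, and so does its image in the image of
  \<open>\<phi>\<close>.\<close>

lemma (in free_hom) koszul_acyclic_image_0:
  assumes W: "finite W" and gen: "\<And>b. b \<in> B \<Longrightarrow> \<delta> b \<noteq> j"
  shows "koszul_acyclic W \<Gamma> (\<phi> ` free_carrier W B \<inter> free_grade W B' \<delta>' j) (\<phi> ` free_carrier W B) 0"
  unfolding koszul_acyclic_def
proof (intro allI impI)
  fix f :: "'v set \<Rightarrow> _"
  assume f: "\<forall>\<sigma>. \<sigma> \<subseteq> W \<longrightarrow> card \<sigma> = 0 \<longrightarrow> f \<sigma> \<in> \<phi> ` free_carrier W B \<inter> free_grade W B' \<delta>' j"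
  have emp: "\<sigma> = {}" if "\<sigma> \<subseteq> W" "card \<sigma> = 0" for \<sigma>
    using that W finite_subset[of \<sigma> W] by auto
  obtain x where x: "x \<in> free_grade W B \<delta> j" "\<phi> x = f {}"
    using f graded_lift[of "f {}" j] by auto
  have coeff: "free_coeff x b 0 = 0" for b
    using x(1) gen unfolding free_grade_def by fastforce
  obtain z where z: "\<And>\<sigma>. \<sigma> \<subseteq> W \<Longrightarrow> card \<sigma> = Suc 0 \<Longrightarrow> z \<sigma> \<in> free_carrier W B"
    "\<And>\<sigma>. \<sigma> \<subseteq> W \<Longrightarrow> card \<sigma> = 0 \<Longrightarrow> x = koszul_free W z \<sigma>"
    by (rule koszul_free_exact[OF W, where i = 0 and f = "\<lambda>\<sigma>. x" and B = B])
      (use subsetD[OF free_grade_subset x(1)] coeff in auto)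
  have "f {} = koszul_supported W \<Gamma> (\<lambda>\<sigma>. \<phi> (z \<sigma>)) {}"
  proof -
    have "f {} = \<phi> (koszul_free W z {})" using x z(2)[of "{}"] by simp
    also have "\<dots> = koszul_supported W \<Gamma> (\<lambda>\<sigma>. \<phi> (z \<sigma>)) {}"
      by (rule hom_koszul) (use z(1) in auto)
    finally show ?thesis .
  qed
  then show "\<exists>g. (\<forall>\<sigma>. \<sigma> \<subseteq> W \<longrightarrow> card \<sigma> = Suc 0 \<longrightarrow> g \<sigma> \<in> \<phi> ` free_carrier W B) \<and>
      (\<forall>\<sigma>. \<sigma> \<subseteq> W \<longrightarrow> card \<sigma> = 0 \<longrightarrow> f \<sigma> = koszul_supported W \<Gamma> g \<sigma>)"
    using z(1) emp by (intro exI[of _ "\<lambda>\<sigma>. \<phi> (z \<sigma>)"]) blast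
qed

section \<open>Minimal free covers of graded submodules\<close>

definition free_extend ::
  "('i \<Rightarrow> ('j \<Rightarrow>\<^sub>0 ('v, 'k::field) mpoly)) \<Rightarrow> ('i \<Rightarrow>\<^sub>0 ('v, 'k) mpoly) \<Rightarrow> ('j \<Rightarrow>\<^sub>0 ('v, 'k) mpoly)" where
  "free_extend u f = (\<Sum>p\<in>Poly_Mapping.keys f. free_smult (Poly_Mapping.lookup f p) (u p))"

lemma free_extend_superset:
  "finite A \<Longrightarrow> Poly_Mapping.keys f \<subseteq> A \<Longrightarrow>
    free_extend u f = (\<Sum>p\<in>A. free_smult (Poly_Mapping.lookup f p) (u p))"
  unfolding free_extend_def by (rule sum.mono_neutral_left) (auto simp: in_keys_iff)

lemma free_extend_single [simp]: "free_extend u (Poly_Mapping.single b p) = free_smult p (u b)"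
  by (simp add: free_extend_def)

lemma lookup_in_poly_ring: "f \<in> free_carrier W B \<Longrightarrow> Poly_Mapping.lookup f b \<in> carrier (poly_ring W)"
  by (simp add: free_carrier_def poly_ring_carrier_iff free_coeff_def)

lemma lookup_homogeneous: "f \<in> free_grade W B \<delta> d \<Longrightarrow> Poly_Mapping.lookup f b \<in> homogeneous_part W (d
    - \<delta> b)"
  by (simp add: free_grade_def homogeneous_part_iff free_coeff_def eq_diff_eq)

lemma free_gradeD:
  "f \<in> free_grade W B \<delta> d \<Longrightarrow> free_coeff f b m \<noteq> 0 \<Longrightarrow>
    b \<in> B \<and> Poly_Mapping.keys m \<subseteq> W \<and> int (mon_degree m) + \<delta> b = d"
  by (simp add: free_grade_def)

lemma keys_subset_free_carrier: "f \<in> free_carrier W B \<Longrightarrow> Poly_Mapping.keys f \<subseteq> B"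
  unfolding free_carrier_def by (auto simp: free_keys_iff)

lemma free_hom_free_extend:
  fixes u :: "'i \<Rightarrow> ('j \<Rightarrow>\<^sub>0 ('v::linorder, 'k::field) mpoly)"
  assumes u: "\<And>p. p \<in> B \<Longrightarrow> u p \<in> free_grade W B' \<delta>' (\<delta> p)"
  shows "free_hom W UNIV B \<delta> B' \<delta>' (free_extend u)"
proof
  fix x :: "'i \<Rightarrow>\<^sub>0 ('v, 'k) mpoly" assume x: "x \<in> free_carrier W B"
  have "u p \<in> free_carrier W B'" if "p \<in> Poly_Mapping.keys x" for p
    using that u keys_subset_free_carrier[OF x] free_grade_subset by blast
  then show "free_extend u x \<in> free_carrier W B'"
    unfolding free_extend_def
    by (intro free_carrier_sum free_smult_in_carrier lookup_in_poly_ring[OF x])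
next
  fix x y :: "'i \<Rightarrow>\<^sub>0 ('v, 'k) mpoly"
  let ?A = "Poly_Mapping.keys x \<union> Poly_Mapping.keys y"
  have "Poly_Mapping.keys (x + y) \<subseteq> ?A" by (rule keys_add)
  then show "free_extend u (x + y) = free_extend u x + free_extend u y"
    by (simp add: free_extend_superset[of ?A] lookup_add free_smult_add_left sum.distrib)
next
  fix p and x :: "'i \<Rightarrow>\<^sub>0 ('v, 'k) mpoly"
  have "Poly_Mapping.keys (free_smult p x) \<subseteq> Poly_Mapping.keys x"
    by (auto simp: in_keys_iff)
  then show "free_extend u (free_smult p x) = supported_part UNIV (free_smult p (free_extend u x))"
    by (simp add: free_extend_superset[of "Poly_Mapping.keys x"] free_smult_sum free_smult_assoc)
next
  fix x :: "'i \<Rightarrow>\<^sub>0 ('v, 'k) mpoly" and d assume x: "x \<in> free_grade W B \<delta> d"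
  then have sub: "Poly_Mapping.keys x \<subseteq> B" using free_grade_subset keys_subset_free_carrier by blast
  have "free_smult (Poly_Mapping.lookup x p) (u p) \<in> free_grade W B' \<delta>' (\<delta> p + (d - \<delta> p))"
    if "p \<in> Poly_Mapping.keys x" for p
    using that sub u lookup_homogeneous[OF x] by (intro free_smult_in_grade) auto
  then show "free_extend u x \<in> free_grade W B' \<delta>' d"
    unfolding free_extend_def by (intro free_grade_sum) simp
qed

section \<open>Graded submodules and the choice of minimal generators\<close>

definition graded_submodule ::
  "'v set \<Rightarrow> 'i set \<Rightarrow> ('i \<Rightarrow> int) \<Rightarrow> ('i \<Rightarrow>\<^sub>0 ('v, 'k::field) mpoly) set \<Rightarrow> bool" where
  "graded_submodule W B \<delta> K \<longleftrightarrow> K \<subseteq> free_carrier W B \<and> 0 \<in> K \<and> (\<forall>x\<in>K. \<forall>y\<in>K. x + y \<in> K) \<and>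
     (\<forall>p\<in>carrier (poly_ring W). \<forall>x\<in>K. free_smult p x \<in> K) \<and> (\<forall>x\<in>K. \<forall>d. free_component \<delta> d x \<in> K)"

text \<open>Lets the construction of a minimal cover be repeated on its kernel.\<close>

lemma (in free_hom) graded_submodule_kernel:
  "graded_submodule W B \<delta> {x \<in> free_carrier W B. \<phi> x = 0}"
  unfolding graded_submodule_def
  by (auto simp: free_carrier_closed hom_zero add smult free_smult_in_carrier hom_component)

text \<open>Positions \<open>(b, m)\<close> in the free module are enumerated by natural numbers. By Gaussian elimination, a
  homogeneous basis of \<open>K\<close> modulo the irrelevant ideal times \<open>K\<close> is indexed by the leading positions of
  homogeneous elements of \<open>K\<close> that do not lead a homogeneous element of that product; so the generators
  are indexed by natural numbers, whatever the size of the field.\<close>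

locale graded_submodule_cover =
  fixes W :: "'v::{linorder,countable} set" and B :: "'i::countable set" and \<delta> :: "'i \<Rightarrow> int"
    and K :: "('i \<Rightarrow>\<^sub>0 ('v, 'k::field) mpoly) set"
  assumes W: "finite W" and nonneg: "\<And>b. b \<in> B \<Longrightarrow> 0 \<le> \<delta> b" and K: "graded_submodule W B \<delta> K"
begin

definition position :: "'i \<Rightarrow> ('v \<Rightarrow>\<^sub>0 nat) \<Rightarrow> nat" where
  "position b m = to_nat (b, Poly_Mapping.items m)"

lemma position_inject [simp]: "position b m = position b' m' \<longleftrightarrow> b = b' \<and> m = m'"
  by (metis position_def inj_eq inj_to_nat prod.inject the_value_items)

text \<open>Positions are compared by their numbers, an order without any relation to
  multiplication: only linear algebra over the field is done with it.\<close>

definition leading :: "('i \<Rightarrow>\<^sub>0 ('v, 'k) mpoly) \<Rightarrow> nat \<Rightarrow> bool" where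
  "leading x p \<longleftrightarrow> (\<exists>b m. position b m = p \<and> free_coeff x b m \<noteq> 0) \<and> (\<forall>b m. free_coeff x b m \<noteq> 0 \<longrightarrow>
      position b m \<le> p)"

definition homog :: "int \<Rightarrow> ('i \<Rightarrow>\<^sub>0 ('v, 'k) mpoly) set" where
  "homog e = K \<inter> free_grade W B \<delta> e"

text \<open>The part of degree \<open>e\<close> of the irrelevant ideal times
  \<open>K\<close>.\<close>

definition decomposable :: "int \<Rightarrow> ('i \<Rightarrow>\<^sub>0 ('v, 'k) mpoly) set" where
  "decomposable e = {\<Sum>v\<in>W. free_smult (indet v) (k v) | k. \<forall>v\<in>W. k v \<in> homog (e - 1)}"

lemma K_closed:
  "K \<subseteq> free_carrier W B" "0 \<in> K" "x \<in> K \<Longrightarrow> y \<in> K \<Longrightarrow> x + y \<in> K"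
  "p \<in> carrier (poly_ring W) \<Longrightarrow> x \<in> K \<Longrightarrow> free_smult p x \<in> K"
  "x \<in> K \<Longrightarrow> free_component \<delta> d x \<in> K"
  using K unfolding graded_submodule_def by blast+

lemma K_uminus: "x \<in> K \<Longrightarrow> - x \<in> K"
  using K_closed(4)[of "- 1" x] by (simp add: poly_ring_closed free_smult_uminus)

lemma K_sum: "(\<And>a. a \<in> A \<Longrightarrow> f a \<in> K) \<Longrightarrow> sum f A \<in> K"
  by (induction A rule: infinite_finite_induct) (auto simp: K_closed)

lemma homog_closed:
  "0 \<in> homog e" "x \<in> homog e \<Longrightarrow> y \<in> homog e \<Longrightarrow> x + y \<in> homog e" "x \<in> homog e \<Longrightarrow> - x \<in> homog e"
  by (auto simp: homog_def K_closed free_grade_closed K_uminus)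

lemma homog_sum: "(\<And>a. a \<in> A \<Longrightarrow> f a \<in> homog e) \<Longrightarrow> sum f A \<in> homog e"
  by (induction A rule: infinite_finite_induct) (auto simp: homog_closed)

lemma homog_smult: "p \<in> homogeneous_part W d \<Longrightarrow> x \<in> homog e \<Longrightarrow> free_smult p x \<in> homog (e + d)"
  by (simp add: homog_def K_closed free_smult_in_grade homogeneous_in_carrier)

lemma homog_scale: "x \<in> homog e \<Longrightarrow> free_smult (Poly_Mapping.single 0 c) x \<in> homog e"
  using homog_smult[OF const_homogeneous] by fastforce

lemma homog_degree:
  "x \<in> homog e \<Longrightarrow> free_coeff x b m \<noteq> 0 \<Longrightarrow> int (mon_degree m) + \<delta> b = e"
  by (simp add: homog_def free_grade_def)

lemma homog_negative: "e < 0 \<Longrightarrow> x \<in> homog e \<Longrightarrow> x = 0"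
  by (rule free_eqI) (use nonneg in \<open>force simp: homog_def free_grade_def\<close>)

lemma decomposable_homog: "decomposable e \<subseteq> homog e"
proof -
  have "free_smult (indet v) x \<in> homog e" if "v \<in> W" "x \<in> homog (e - 1)" for v x
    using homog_smult[OF indet_homogeneous that(2)] that(1) by simp
  then show ?thesis unfolding decomposable_def by (auto intro!: homog_sum)
qed

lemma cancel_leading:
  assumes "x \<in> homog e" "w \<in> homog e" "leading x p" "leading w p"
  obtains c where "x - free_smult (Poly_Mapping.single 0 c) w \<in> homog e"
    "\<And>b m. free_coeff (x - free_smult (Poly_Mapping.single 0 c) w) b m \<noteq> 0 \<Longrightarrow> position b m < p"
proof -
  obtain b m where bm: "position b m = p" "free_coeff x b m \<noteq> 0" using assms(3) by (auto simp:
      leading_def)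
  then have w: "free_coeff w b m \<noteq> 0" using assms(4) by (auto simp: leading_def)
  define c where "c = free_coeff x b m / free_coeff w b m"
  let ?y = "x - free_smult (Poly_Mapping.single 0 c) w"
  have "?y \<in> homog e"
    using homog_closed(2)[OF assms(1) homog_closed(3)[OF homog_scale[OF assms(2), of c]]] by simp
  moreover have "position b' m' < p" if nz: "free_coeff ?y b' m' \<noteq> 0" for b' m'
  proof -
    have "free_coeff ?y b m = 0" using w by (simp add: c_def)
    then have "position b' m' \<noteq> p" using nz bm(1) by (metis position_inject)
    moreover have "free_coeff x b' m' \<noteq> 0 \<or> free_coeff w b' m' \<noteq> 0" using nz by auto
    ultimately show ?thesis using assms(3,4) unfolding leading_def by (metis order_le_less)
  qed
  ultimately show ?thesis by (rule that)
qed

text \<open>A position \<open>(b, m)\<close> determines the degree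
  \<open>e = mon_degree m + \<delta> b\<close>, so no index is claimed by two degrees.\<close>

definition new_leads :: "nat set" where
  "new_leads = {p. \<exists>e. \<exists>x\<in>homog e. leading x p \<and> (\<forall>w\<in>decomposable e. \<not> leading w p)}"

text \<open>Each new lead \<open>p\<close> gets a homogeneous generator \<open>u p\<close> with
  leading position \<open>p\<close>. Elimination shows that they generate \<open>K\<close>. A
  combination of them with constants not all zero leads at a new lead, so it is not decomposable;
  hence relations have no constant coefficients.\<close>

lemma minimal_cover:
  obtains \<delta>' \<phi> where "free_hom W UNIV new_leads \<delta>' B \<delta> \<phi>" "\<phi> ` free_carrier W new_leads = K"
    "\<And>p. p \<in> new_leads \<Longrightarrow> 0 \<le> \<delta>' p"
    "\<And>x p. x \<in> free_carrier W new_leads \<Longrightarrow> \<phi> x = 0 \<Longrightarrow> free_coeff x p 0 = 0"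
proof -
  obtain \<delta>' u where u: "\<And>p. p \<in> new_leads \<Longrightarrow>
      u p \<in> homog (\<delta>' p) \<and> leading (u p) p \<and> (\<forall>w\<in>decomposable (\<delta>' p). \<not> leading w p)"
  proof -
    have "\<forall>p\<in>new_leads. \<exists>e x. x \<in> homog e \<and> leading x p \<and> (\<forall>w\<in>decomposable e. \<not> leading w p)"
      unfolding new_leads_def by blast
    from bchoice[OF this] obtain \<delta>' where "\<forall>p\<in>new_leads. \<exists>x. x \<in> homog (\<delta>' p) \<and> leading x p \<and>
        (\<forall>w\<in>decomposable (\<delta>' p). \<not> leading w p)" ..
    from bchoice[OF this] show ?thesis using that by blast
  qed
  interpret \<phi>: free_hom W UNIV new_leads \<delta>' B \<delta> "free_extend u"
    by (rule free_hom_free_extend) (use u in \<open>auto simp: homog_def\<close>)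
  let ?C = "free_carrier W new_leads"
  let ?I = "free_extend u ` ?C"
  have I_add: "x + y \<in> ?I" if xy: "x \<in> ?I" "y \<in> ?I" for x y
  proof -
    obtain a b where "x = free_extend u a" "y = free_extend u b" "a \<in> ?C" "b \<in> ?C" using xy by blast
    then have "x + y = free_extend u (a + b)" "a + b \<in> ?C" by (simp_all add: \<phi>.add free_carrier_closed)
    then show ?thesis by blast
  qed
  have I_smult: "free_smult p x \<in> ?I" if px: "p \<in> carrier (poly_ring W)" "x \<in> ?I" for p x
  proof -
    obtain a where "x = free_extend u a" "a \<in> ?C" using px by blast
    then have "free_smult p x = free_extend u (free_smult p a)" "free_smult p a \<in> ?C"
      using px by (simp_all add: \<phi>.smult free_smult_in_carrier)
    then show ?thesis by blast
  qed
  have I_zero: "0 \<in> ?I" using \<phi>.hom_zero free_carrier_closed(1) by (metis image_eqI)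
  have I_sum: "sum f A \<in> ?I" if "\<And>a. a \<in> A \<Longrightarrow> f a \<in> ?I" for f and A :: "'c set"
    using that by (induction A rule: infinite_finite_induct) (auto simp: I_zero I_add)
  have I_u: "u p \<in> ?I" if "p \<in> new_leads" for p
  proof -
    have "Poly_Mapping.single p 1 \<in> ?C"
      using that by (auto simp: free_carrier_def free_coeff_single lookup_one when_def)
    moreover have "free_extend u (Poly_Mapping.single p 1) = u p" by simp
    ultimately show ?thesis by (metis image_eqI)
  qed
  \<comment> \<open>Negative degrees contain only 0, so strong induction on a natural number reaches
    every homogeneous element.\<close>
  have I_homog: "homog (int k) \<subseteq> ?I" for k
  proof (induction k rule: less_induct)
    case (less k)
    have prev: "x \<in> ?I" if "x \<in> homog (int k - 1)" for x
    proof (cases k)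
      case 0
      then show ?thesis using homog_negative[of "int k - 1" x] that I_zero by simp
    next
      case (Suc k')
      then show ?thesis using less[of k'] that by auto
    qed
    have dec: "decomposable (int k) \<subseteq> ?I"
    proof
      fix x assume "x \<in> decomposable (int k)"
      then obtain g where g: "\<forall>v\<in>W. g v \<in> homog (int k - 1)" "x = (\<Sum>v\<in>W. free_smult (indet v) (g v))"
        unfolding decomposable_def by blast
      show "x \<in> ?I"
        unfolding g(2) by (rule I_sum, rule I_smult) (use g(1) prev poly_ring_closed in auto)
    qed
    \<comment> \<open>Inside one degree the induction is on a strict bound for positions, not on a
      dimension: \<open>B\<close> may have infinitely many indices of the same degree.\<close>
    have "\<forall>x\<in>homog (int k). (\<forall>b m. free_coeff x b m \<noteq> 0 \<longrightarrow> position b m < N) \<longrightarrow> x \<in> ?I" for N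
    proof (induction N)
      case 0
      then show ?case using I_zero by (metis free_eqI free_coeff_zero not_less_zero)
    next
      case (Suc N)
      show ?case
      proof (intro ballI impI)
        fix x assume x: "x \<in> homog (int k)" "\<forall>b m. free_coeff x b m \<noteq> 0 \<longrightarrow> position b m < Suc N"
        show "x \<in> ?I"
        proof (cases "leading x N")
          case False
          then have "\<forall>b m. free_coeff x b m \<noteq> 0 \<longrightarrow> position b m < N"
            using x(2) unfolding leading_def by (metis less_Suc_eq less_Suc_eq_le)
          then show ?thesis using Suc x(1) by blast
        next
          case lead: True
          \<comment> \<open>What cancels the leading position is either decomposable, hence in the
            image by the induction on the degree, or the generator chosen for this position.\<close>
          have "\<exists>w\<in>homog (int k). leading w N \<and> w \<in> ?I"
          proof (cases "\<exists>w\<in>decomposable (int k). leading w N")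
            case True
            then show ?thesis using dec decomposable_homog by blast
          next
            case False
            then have N: "N \<in> new_leads" using x(1) lead unfolding new_leads_def by blast
            obtain b m where "position b m = N" "free_coeff x b m \<noteq> 0" using lead by (auto simp:
                leading_def)
            moreover then have "free_coeff (u N) b m \<noteq> 0" using u[OF N] by (auto simp: leading_def)
            ultimately have "\<delta>' N = int k"
              using homog_degree x(1) u[OF N] by metis
            then show ?thesis using u[OF N] I_u[OF N] by auto
          qed
          then obtain w where w: "w \<in> homog (int k)" "leading w N" "w \<in> ?I" by blast
          obtain c where c: "x - free_smult (Poly_Mapping.single 0 c) w \<in> homog (int k)"
            "\<And>b m. free_coeff (x - free_smult (Poly_Mapping.single 0 c) w) b m \<noteq> 0 \<Longrightarrow> position b m < N"
            using cancel_leading[OF x(1) w(1) lead w(2)] by metis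
          then have "x - free_smult (Poly_Mapping.single 0 c) w \<in> ?I" using Suc by blast
          then have "x - free_smult (Poly_Mapping.single 0 c) w + free_smult (Poly_Mapping.single 0
              c) w \<in> ?I"
            using I_smult[OF poly_ring_closed(4) w(3)] by (rule I_add)
          then show ?thesis by simp
        qed
      qed
    qed
    note bounded = this
    show ?case
    proof
      fix x assume x: "x \<in> homog (int k)"
      define N where "N = Suc (Max (insert 0 ((\<lambda>(b, m). position b m) ` {(b, m). free_coeff x b m \<noteq>
          0})))"
      have "position b m < N" if "free_coeff x b m \<noteq> 0" for b m
        unfolding N_def less_Suc_eq_le using that finite_free_support[of x] by (intro Max_ge) auto
      then show "x \<in> ?I" using bounded x by blast
    qed
  qed
  have image: "?I = K"
  proof
    show "?I \<subseteq> K"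
    proof
      fix y assume "y \<in> ?I"
      then obtain x where x: "x \<in> ?C" "y = free_extend u x" by auto
      have "u p \<in> K" if "p \<in> Poly_Mapping.keys x" for p
        using that u keys_subset_free_carrier[OF x(1)] by (auto simp: homog_def)
      then show "y \<in> K"
        unfolding x(2) free_extend_def using x(1) by (intro K_sum K_closed lookup_in_poly_ring)
    qed
    show "K \<subseteq> ?I"
    proof
      fix x assume x: "x \<in> K"
      have comp: "free_component \<delta> e x \<in> ?I" for e
      proof -
        have h: "free_component \<delta> e x \<in> homog e"
          using K_closed(5)[OF x] free_component_in_grade[OF subsetD[OF K_closed(1) x]] by (simp
              add: homog_def)
        show ?thesis
        proof (cases "e < 0")
          case True
          then show ?thesis using homog_negative[OF True h] I_zero by simp
        next
          case False
          then show ?thesis using I_homog[of "nat e"] h by auto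
        qed
      qed
      have "x = (\<Sum>e\<in>{int (mon_degree m) + \<delta> b | b m. free_coeff x b m \<noteq> 0}. free_component \<delta> e x)"
        by (rule sum_free_components) (auto simp: free_degrees_finite)
      also have "\<dots> \<in> ?I" by (rule I_sum, rule comp)
      finally show "x \<in> ?I" .
    qed
  qed
  have nonneg': "0 \<le> \<delta>' p" if "p \<in> new_leads" for p
  proof (rule ccontr)
    assume "\<not> 0 \<le> \<delta>' p"
    then have "u p = 0" using homog_negative[of "\<delta>' p" "u p"] u[OF that] by simp
    then show False using u[OF that] by (simp add: leading_def)
  qed
  have kernel: "free_coeff x p 0 = 0" if x: "x \<in> ?C" "free_extend u x = 0" for x p
  proof (rule ccontr)
    assume p: "free_coeff x p 0 \<noteq> 0"
    \<comment> \<open>Passing to one homogeneous component keeps the offending constant and makes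
      all coefficients homogeneous.\<close>
    define e where "e = \<delta>' p"
    define f where "f = free_component \<delta>' e x"
    have f: "f \<in> free_grade W new_leads \<delta>' e" unfolding f_def using x(1) by (rule
        free_component_in_grade)
    then have fC: "f \<in> ?C" using free_grade_subset by blast
    have f0: "free_extend u f = 0" unfolding f_def using \<phi>.hom_component[OF x(1)] x(2) by simp
    have fp: "free_coeff f p 0 \<noteq> 0" using p by (simp add: f_def e_def)
    define A where "A = Poly_Mapping.keys f"
    have A: "finite A" "A \<subseteq> new_leads" using keys_subset_free_carrier[OF fC] by (auto simp: A_def)
    \<comment> \<open>The relation splits into the constant parts, collected in \<open>y\<close>,
      and the rest, divided by variables into the \<open>k v\<close>; so \<open>y\<close> is
      decomposable.\<close>
    define y where "y = (\<Sum>q\<in>A. free_smult (Poly_Mapping.single 0 (free_coeff f q 0)) (u q))"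
    define k where "k v = (\<Sum>q\<in>A. free_smult (min_quotient v (Poly_Mapping.lookup f q)) (u q))" for v
    have k: "k v \<in> homog (e - 1)" for v
    proof -
      have "free_smult (min_quotient v (Poly_Mapping.lookup f q)) (u q) \<in> homog (\<delta>' q + (e - \<delta>' q - 1))"
        if "q \<in> A" for q
        using that A u min_quotient_homogeneous[OF lookup_homogeneous[OF f]] by (intro homog_smult) auto
      then show ?thesis unfolding k_def by (intro homog_sum) simp
    qed
    have "0 = (\<Sum>q\<in>A. free_smult (Poly_Mapping.lookup f q) (u q))"
      using f0 by (simp add: free_extend_def A_def)
    also have "\<dots> = (\<Sum>q\<in>A. free_smult (Poly_Mapping.single 0 (free_coeff f q 0)) (u q)
        + (\<Sum>v\<in>W. free_smult (indet v) (free_smult (min_quotient v (Poly_Mapping.lookup f q)) (u q))))"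
    proof (rule sum.cong[OF refl])
      fix q
      show "free_smult (Poly_Mapping.lookup f q) (u q) = free_smult (Poly_Mapping.single 0
          (free_coeff f q 0)) (u q)
        + (\<Sum>v\<in>W. free_smult (indet v) (free_smult (min_quotient v (Poly_Mapping.lookup f q)) (u q)))"
        by (subst poly_decomposition[OF W lookup_in_poly_ring[OF fC]])
          (simp add: free_smult_add_left free_smult_sum_left free_smult_assoc free_coeff_def)
    qed
    also have "\<dots> = y + (\<Sum>v\<in>W. free_smult (indet v) (k v))"
      unfolding sum.distrib y_def k_def free_smult_sum by (subst (2) sum.swap) (rule refl)
    finally have "y = (\<Sum>v\<in>W. free_smult (indet v) (- k v))"
      by (simp add: free_smult_uminus sum_negf eq_neg_iff_add_eq_0)
    then have y: "y \<in> decomposable e"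
      unfolding decomposable_def mem_Collect_eq
      by (intro exI[of _ "\<lambda>v. - k v"]) (simp add: homog_closed(3) k)
    define C where "C = {q \<in> A. free_coeff f q 0 \<noteq> 0}"
    have "p \<in> A" using fp by (auto simp: A_def free_keys_iff)
    then have C: "finite C" "p \<in> C" using A fp by (auto simp: C_def)
    have deg: "\<delta>' q = e" if "q \<in> C" for q
      using that free_gradeD[OF f, of q 0] by (simp add: C_def)
    have y_coeff: "free_coeff y b m = (\<Sum>q\<in>C. free_coeff f q 0 * free_coeff (u q) b m)" for b m
      unfolding y_def free_coeff_sum C_def
      by (simp, rule sum.mono_neutral_right) (use A in auto)
    \<comment> \<open>The generators have distinct leading positions, so nothing cancels at the
      largest one, and the decomposable \<open>y\<close> leads at a new lead.\<close>
    define q where "q = Max C"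
    have q: "q \<in> C" "\<And>r. r \<in> C \<Longrightarrow> r \<le> q" unfolding q_def using C by (auto intro: Max_in)
    have lead: "leading (u r) r" if "r \<in> C" for r
      using u that A by (auto simp: C_def)
    have "leading y q"
      unfolding leading_def
    proof (intro conjI allI impI)
      obtain b m where bm: "position b m = q" "free_coeff (u q) b m \<noteq> 0"
        using lead[OF q(1)] by (auto simp: leading_def)
      have "free_coeff (u r) b m = 0" if r: "r \<in> C" "r \<noteq> q" for r
      proof (rule ccontr)
        assume "free_coeff (u r) b m \<noteq> 0"
        then have "q \<le> r" using lead[OF r(1)] bm(1) by (auto simp: leading_def)
        then show False using q(2)[OF r(1)] r(2) by simp
      qed
      then have "free_coeff y b m = (\<Sum>r\<in>C. if r = q then free_coeff f q 0 * free_coeff (u q) b m else 0)"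
        unfolding y_coeff by (intro sum.cong) auto
      also have "\<dots> \<noteq> 0" using C(1) q(1) bm(2) by (simp add: C_def)
      finally show "\<exists>b m. position b m = q \<and> free_coeff y b m \<noteq> 0" using bm(1) by blast
    next
      fix b m assume "free_coeff y b m \<noteq> 0"
      then obtain r where r: "r \<in> C" "free_coeff f r 0 * free_coeff (u r) b m \<noteq> 0"
        unfolding y_coeff by (rule sum.not_neutral_contains_not_neutral)
      then have "position b m \<le> r" using lead[OF r(1)] by (auto simp: leading_def)
      then show "position b m \<le> q" using q(2)[OF r(1)] by simp
    qed
    moreover have "q \<in> new_leads" using q(1) A by (auto simp: C_def)
    ultimately show False using u[of q] deg[OF q(1)] y by auto
  qed
  show ?thesis
    by (rule that[OF \<phi>.free_hom_axioms image nonneg' kernel])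
qed

end

section \<open>The Stanley--Reisner ring\<close>

text \<open>Covers are iterated, each on the kernel of the one before. The kernel of a minimal cover
  has no constant coefficients, and it is the image of the next map, which is the minimality of that
  map.\<close>

lemma minimal_free_sequence:
  fixes W :: "'v::{linorder,countable} set" and B\<^sub>0 :: "nat set"
    and K\<^sub>0 :: "(nat \<Rightarrow>\<^sub>0 ('v, 'k::field) mpoly) set"
  assumes W: "finite W" and nonneg: "\<And>b. b \<in> B\<^sub>0 \<Longrightarrow> 0 \<le> \<delta>\<^sub>0 b" and K: "graded_submodule W B\<^sub>0 \<delta>\<^sub>0 K\<^sub>0"
    and min: "\<And>x b. x \<in> K\<^sub>0 \<Longrightarrow> free_coeff x b 0 = 0"
  obtains B \<delta> \<phi> where "B 0 = B\<^sub>0" "\<delta> 0 = \<delta>\<^sub>0"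
    "\<And>i. free_hom W UNIV (B (Suc i)) (\<delta> (Suc i)) (B i) (\<delta> i) (\<phi> i)"
    "\<phi> 0 ` free_carrier W (B (Suc 0)) = K\<^sub>0"
    "\<And>i. \<phi> (Suc i) ` free_carrier W (B (Suc (Suc i))) = {x \<in> free_carrier W (B (Suc i)). \<phi> i x = 0}"
    "\<And>i x b. x \<in> free_carrier W (B (Suc i)) \<Longrightarrow> free_coeff (\<phi> i x) b 0 = 0"
proof -
  \<comment> \<open>A state holds basis, degrees, the map onto the preceding submodule, and the
    submodule still to be covered. The map is a dummy at stage 0, so \<open>\<psi> (Suc i)\<close>
    will be the map with index \<open>i\<close>.\<close>
  define P where "P n s = (case s of (B, \<delta>, \<phi>, K) \<Rightarrow> (n = 0 \<longrightarrow> B = B\<^sub>0 \<and> \<delta> = \<delta>\<^sub>0 \<and> K = K\<^sub>0) \<and>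
      graded_submodule W B \<delta> K \<and> (\<forall>b\<in>B. 0 \<le> \<delta> b) \<and> (\<forall>x\<in>K. \<forall>b. free_coeff x b 0 = 0))"
    for n :: nat and s :: "nat set \<times> (nat \<Rightarrow> int) \<times>
      ((nat \<Rightarrow>\<^sub>0 ('v, 'k) mpoly) \<Rightarrow> (nat \<Rightarrow>\<^sub>0 ('v, 'k) mpoly)) \<times> (nat \<Rightarrow>\<^sub>0 ('v, 'k) mpoly) set"
  define Q where "Q n s t = (case s of (B, \<delta>, \<phi>, K) \<Rightarrow> case t of (B', \<delta>', \<phi>', K') \<Rightarrow>
      free_hom W UNIV B' \<delta>' B \<delta> \<phi>' \<and> \<phi>' ` free_carrier W B' = K \<and>
      K' = {x \<in> free_carrier W B'. \<phi>' x = 0})"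
    for n :: nat and s t :: "nat set \<times> (nat \<Rightarrow> int) \<times>
      ((nat \<Rightarrow>\<^sub>0 ('v, 'k) mpoly) \<Rightarrow> (nat \<Rightarrow>\<^sub>0 ('v, 'k) mpoly)) \<times> (nat \<Rightarrow>\<^sub>0 ('v, 'k) mpoly) set"
  have "\<exists>s. \<forall>n. P n (s n) \<and> Q n (s n) (s (Suc n))"
  proof (rule dependent_nat_choice)
    show "\<exists>s. P 0 s"
      by (rule exI[of _ "(B\<^sub>0, \<delta>\<^sub>0, undefined, K\<^sub>0)"]) (use assms in \<open>auto simp: P_def\<close>)
  next
    fix s n assume s: "P n s"
    obtain B \<delta> \<phi> K where s_eq: "s = (B, \<delta>, \<phi>, K)" by (cases s)
    interpret graded_submodule_cover W B \<delta> K
      by standard (use s W in \<open>auto simp: P_def s_eq\<close>)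
    obtain \<delta>' \<phi>' where cover: "free_hom W UNIV new_leads \<delta>' B \<delta> \<phi>'" "\<phi>' ` free_carrier W new_leads = K"
      "\<And>p. p \<in> new_leads \<Longrightarrow> 0 \<le> \<delta>' p"
      "\<And>x p. x \<in> free_carrier W new_leads \<Longrightarrow> \<phi>' x = 0 \<Longrightarrow> free_coeff x p 0 = 0"
      using minimal_cover by metis
    interpret \<phi>': free_hom W UNIV new_leads \<delta>' B \<delta> \<phi>' by (rule cover(1))
    show "\<exists>t. P (Suc n) t \<and> Q n s t"
      by (rule exI[of _ "(new_leads, \<delta>', \<phi>', {x \<in> free_carrier W new_leads. \<phi>' x = 0})"])
        (use cover \<phi>'.graded_submodule_kernel in \<open>auto simp: P_def Q_def s_eq\<close>)
  qed
  then obtain s where s: "\<And>n. P n (s n)" "\<And>n. Q n (s n) (s (Suc n))" by blast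
  define B where "B n = fst (s n)" for n
  define \<delta> where "\<delta> n = fst (snd (s n))" for n
  define \<psi> where "\<psi> n = fst (snd (snd (s n)))" for n
  define K where "K n = snd (snd (snd (s n)))" for n
  have s_eq: "s n = (B n, \<delta> n, \<psi> n, K n)" for n by (simp add: B_def \<delta>_def \<psi>_def K_def)
  have 0: "B 0 = B\<^sub>0" "\<delta> 0 = \<delta>\<^sub>0" "K 0 = K\<^sub>0" using s(1)[of 0] by (auto simp: P_def s_eq)
  have min': "free_coeff x b 0 = 0" if "x \<in> K n" for n x b
    using s(1)[of n] that by (auto simp: P_def s_eq)
  have step: "free_hom W UNIV (B (Suc n)) (\<delta> (Suc n)) (B n) (\<delta> n) (\<psi> (Suc n))"
    "\<psi> (Suc n) ` free_carrier W (B (Suc n)) = K n"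
    "K (Suc n) = {x \<in> free_carrier W (B (Suc n)). \<psi> (Suc n) x = 0}" for n
    using s(2)[of n] by (simp_all add: Q_def s_eq)
  show ?thesis
  proof (rule that[of B \<delta> "\<lambda>i. \<psi> (Suc i)"])
    show "free_coeff (\<psi> (Suc i) x) b 0 = 0" if "x \<in> free_carrier W (B (Suc i))" for i x b
      using that step(2)[of i] min' by blast
  qed (use 0 step in auto)
qed

section \<open>The Stanley--Reisner ideal as a monomial ideal, and its quotient\<close>

lemma cring_poly_ring: "cring (poly_ring W)"
proof (rule cringI)
  show "abelian_group (poly_ring W)"
  proof (rule abelian_groupI)
    fix x assume "x \<in> carrier (poly_ring W)"
    then show "\<exists>y\<in>carrier (poly_ring W). y \<oplus>\<^bsub>poly_ring W\<^esub> x = \<zero>\<^bsub>poly_ring W\<^esub>"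
      by (intro bexI[of _ "- x"]) (auto simp: poly_ring_closed)
  qed (auto simp: poly_ring_closed add_ac)
  show "comm_monoid (poly_ring W)"
    by (rule comm_monoidI) (auto simp: poly_ring_closed mult_ac)
qed (auto simp: distrib_right)

definition nonface_polys :: "'v set \<Rightarrow> 'v set set \<Rightarrow> ('v, 'k::field) mpoly set" where
  "nonface_polys W \<Gamma> = {p \<in> carrier (poly_ring W). \<forall>m. Poly_Mapping.lookup p m \<noteq> 0 \<longrightarrow>
      Poly_Mapping.keys m \<notin> \<Gamma>}"

lemma nonface_polys_closed:
  "0 \<in> nonface_polys W \<Gamma>"
  "p \<in> nonface_polys W \<Gamma> \<Longrightarrow> q \<in> nonface_polys W \<Gamma> \<Longrightarrow> p + q \<in> nonface_polys W \<Gamma>"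
  "p \<in> nonface_polys W \<Gamma> \<Longrightarrow> - p \<in> nonface_polys W \<Gamma>"
  "p \<in> nonface_polys W \<Gamma> \<Longrightarrow> q \<in> nonface_polys W \<Gamma> \<Longrightarrow> p - q \<in> nonface_polys W \<Gamma>"
proof -
  show add: "p + q \<in> nonface_polys W \<Gamma>" if "p \<in> nonface_polys W \<Gamma>" "q \<in> nonface_polys W \<Gamma>" for p q
    using that unfolding nonface_polys_def
    by (simp add: poly_ring_closed lookup_add) (metis add_0)
  show minus: "- p \<in> nonface_polys W \<Gamma>" if "p \<in> nonface_polys W \<Gamma>" for p
    using that by (simp add: nonface_polys_def poly_ring_closed)
  show "p - q \<in> nonface_polys W \<Gamma>" if "p \<in> nonface_polys W \<Gamma>" "q \<in> nonface_polys W \<Gamma>" for p q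
    using add[OF that(1) minus[OF that(2)]] by simp
qed (simp add: nonface_polys_def poly_ring_closed)

text \<open>Multiplication only enlarges supports, and a set containing a nonface is a
  nonface.\<close>

lemma nonface_polys_mult:
  assumes \<Gamma>: "simplicial_complex_on W \<Gamma>" and "a \<in> carrier (poly_ring W)" "p \<in> nonface_polys W \<Gamma>"
  shows "a * p \<in> nonface_polys W \<Gamma>"
  unfolding nonface_polys_def
proof (clarsimp, intro conjI allI impI)
  show "a * p \<in> carrier (poly_ring W)" using assms(2,3) by (simp add: nonface_polys_def poly_ring_closed)
  fix m assume "Poly_Mapping.lookup (a * p) m \<noteq> 0"
  then obtain x y where "m = x + y" "Poly_Mapping.lookup p y \<noteq> 0" by (rule lookup_times_nonzero)
  then show "Poly_Mapping.keys m \<notin> \<Gamma>"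
    using \<Gamma> assms(3) unfolding nonface_polys_def simplicial_complex_on_def by (auto simp: keys_add_nat)
qed

text \<open>A monomial whose support is a nonface is divisible by the squarefree generator of that
  support, so the ideal is spanned by such monomials.\<close>

lemma stanley_reisner_ideal_eq:
  fixes \<Gamma> :: "'v set set"
  assumes \<Gamma>: "simplicial_complex_on W \<Gamma>"
  shows "ideal (nonface_polys W \<Gamma> :: ('v, 'k::field) mpoly set) (poly_ring W)"
    and "stanley_reisner_ideal W \<Gamma> = (nonface_polys W \<Gamma> :: ('v, 'k) mpoly set)"
proof -
  let ?S = "poly_ring W :: ('v, 'k) mpoly ring"
  let ?J = "nonface_polys W \<Gamma> :: ('v, 'k) mpoly set"
  let ?G = "{squarefree_monomial \<sigma> | \<sigma>. \<sigma> \<subseteq> W \<and> \<sigma> \<notin> \<Gamma>} :: ('v, 'k) mpoly set"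
  interpret cring ?S by (rule cring_poly_ring)
  show ideal: "ideal ?J ?S"
  proof (rule idealI)
    show "subgroup ?J (add_monoid ?S)"
    proof (rule group.subgroupI)
      show "group (add_monoid ?S)" by (rule add.group_axioms)
      show "?J \<subseteq> carrier (add_monoid ?S)" by (auto simp: nonface_polys_def)
      show "?J \<noteq> {}" using nonface_polys_closed(1) by blast
      show "a \<otimes>\<^bsub>add_monoid ?S\<^esub> b \<in> ?J" if "a \<in> ?J" "b \<in> ?J" for a b
        using that by (simp add: nonface_polys_closed)
      fix a assume a: "a \<in> ?J"
      then have "inv\<^bsub>add_monoid ?S\<^esub> a = - a"
        by (intro group.inv_equality[OF add.group_axioms]) (auto simp: nonface_polys_def
            poly_ring_closed)
      then show "inv\<^bsub>add_monoid ?S\<^esub> a \<in> ?J" using a by (simp add: nonface_polys_closed)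
    qed
    fix a x assume "a \<in> ?J" "x \<in> carrier ?S"
    then have "x * a \<in> ?J" using nonface_polys_mult[OF \<Gamma>] by blast
    then show "x \<otimes>\<^bsub>?S\<^esub> a \<in> ?J" "a \<otimes>\<^bsub>?S\<^esub> x \<in> ?J" by (simp_all add: mult.commute)
  qed (rule ring_axioms)
  define e where "e \<sigma> = (\<Sum>v\<in>\<sigma>. Poly_Mapping.single v (1::nat))" for \<sigma> :: "'v set"
  have lookup_e: "Poly_Mapping.lookup (e \<sigma>) v = (if v \<in> \<sigma> then 1 else 0)" if "finite \<sigma>" for \<sigma> v
    using that by (simp add: e_def lookup_sum lookup_single when_def)
  have fin: "finite \<sigma>" if "\<sigma> \<subseteq> W" for \<sigma>
    using that \<Gamma> finite_subset by (auto simp: simplicial_complex_on_def)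
  have keys_e: "Poly_Mapping.keys (e \<sigma>) = \<sigma>" if "finite \<sigma>" for \<sigma>
    using that by (auto simp: in_keys_iff lookup_e split: if_splits)
  have G: "?G \<subseteq> ?J"
    unfolding squarefree_monomial_def e_def[symmetric]
    by (auto simp: nonface_polys_def poly_ring_carrier_iff lookup_single when_def keys_e fin split:
        if_splits) blast
  then have GS: "?G \<subseteq> carrier ?S" by (auto simp: nonface_polys_def)
  show "stanley_reisner_ideal W \<Gamma> = ?J"
    unfolding stanley_reisner_ideal_def
  proof
    show "Idl\<^bsub>?S\<^esub> ?G \<subseteq> ?J" by (rule genideal_minimal[OF ideal G])
    interpret I: ideal "Idl\<^bsub>?S\<^esub> ?G" ?S by (rule genideal_ideal[OF GS])
    show "?J \<subseteq> Idl\<^bsub>?S\<^esub> ?G"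
    proof
      fix p assume p: "p \<in> ?J"
      have mono: "Poly_Mapping.single m (Poly_Mapping.lookup p m) \<in> Idl\<^bsub>?S\<^esub> ?G" if "m \<in>
          Poly_Mapping.keys p" for m
      proof -
        let ?\<sigma> = "Poly_Mapping.keys m"
        have \<sigma>: "?\<sigma> \<subseteq> W" "?\<sigma> \<notin> \<Gamma>"
          using p that by (auto simp: nonface_polys_def poly_ring_carrier_iff in_keys_iff)
        then have g: "squarefree_monomial ?\<sigma> \<in> Idl\<^bsub>?S\<^esub> ?G" using genideal_self[OF GS] by blast
        \<comment> \<open>All exponents on the support are at least 1, so the truncated subtraction
          is exact.\<close>
        have "m = (m - e ?\<sigma>) + e ?\<sigma>"
          by (rule poly_mapping_eqI) (auto simp: lookup_add lookup_minus lookup_e in_keys_iff)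
        then have eq: "Poly_Mapping.single m (Poly_Mapping.lookup p m)
            = Poly_Mapping.single (m - e ?\<sigma>) (Poly_Mapping.lookup p m) * squarefree_monomial ?\<sigma>"
          unfolding squarefree_monomial_def e_def[symmetric] by (simp add: mult_single)
        have "Poly_Mapping.single (m - e ?\<sigma>) (Poly_Mapping.lookup p m) \<in> carrier ?S"
          using \<sigma>(1) keys_minus_nat[of m "e ?\<sigma>"] by (auto simp: poly_ring_carrier_iff lookup_single
              when_def)
        from I.I_l_closed[OF g this] show ?thesis unfolding eq by simp
      qed
      have sum: "sum f A \<in> Idl\<^bsub>?S\<^esub> ?G" if "\<And>a. a \<in> A \<Longrightarrow> f a \<in> Idl\<^bsub>?S\<^esub> ?G"
        for f :: "('v \<Rightarrow>\<^sub>0 nat) \<Rightarrow> ('v, 'k) mpoly" and A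
        using that
      proof (induction A rule: infinite_finite_induct)
        case (insert a A)
        then show ?case using I.a_closed[of "f a" "sum f A"] by simp
      qed (use I.zero_closed in auto)
      have "p = (\<Sum>m\<in>Poly_Mapping.keys p. Poly_Mapping.single m (Poly_Mapping.lookup p m))"
        by (rule poly_mapping_eqI) (auto simp: lookup_sum lookup_single when_def in_keys_iff)
      also have "\<dots> \<in> Idl\<^bsub>?S\<^esub> ?G" by (rule sum, rule mono)
      finally show "p \<in> Idl\<^bsub>?S\<^esub> ?G" .
    qed
  qed
qed

abbreviation sr_class :: "'v set \<Rightarrow> 'v set set \<Rightarrow> ('v, 'k::field) mpoly \<Rightarrow> ('v, 'k) mpoly set" where
  "sr_class W \<Gamma> p \<equiv> stanley_reisner_ideal W \<Gamma> +>\<^bsub>poly_ring W\<^esub> p"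

lemma sr_class_eq_iff:
  fixes p q :: "('v, 'k::field) mpoly"
  assumes \<Gamma>: "simplicial_complex_on W \<Gamma>"
  shows "sr_class W \<Gamma> p = sr_class W \<Gamma> q \<longleftrightarrow> p - q \<in> nonface_polys W \<Gamma>"
proof -
  have mem: "r \<in> sr_class W \<Gamma> p \<longleftrightarrow> r - p \<in> nonface_polys W \<Gamma>" for r p :: "('v, 'k) mpoly"
    unfolding stanley_reisner_ideal_eq[OF \<Gamma>] a_r_coset_def'
    by (auto intro: bexI[of _ "r - p"])
  show ?thesis
  proof
    assume "sr_class W \<Gamma> p = sr_class W \<Gamma> q"
    moreover have "p \<in> sr_class W \<Gamma> p" by (simp add: mem nonface_polys_closed)
    ultimately show "p - q \<in> nonface_polys W \<Gamma>" using mem by blast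
  next
    assume *: "p - q \<in> nonface_polys W \<Gamma>"
    have "r - p \<in> nonface_polys W \<Gamma> \<longleftrightarrow> r - q \<in> nonface_polys W \<Gamma>" for r
      using nonface_polys_closed(2)[OF _ *, of "r - p"] nonface_polys_closed(4)[OF _ *, of "r - q"]
          by auto
    then show "sr_class W \<Gamma> p = sr_class W \<Gamma> q" unfolding set_eq_iff mem by blast
  qed
qed

lemma stanley_reisner_ring_simps:
  fixes \<Gamma> :: "'v set set"
  assumes \<Gamma>: "simplicial_complex_on W \<Gamma>"
  defines "M \<equiv> stanley_reisner_ring TYPE('k::field) W \<Gamma>"
  shows "carrier M = sr_class W \<Gamma> ` carrier (poly_ring W)"
    and "zero M = sr_class W \<Gamma> 0"
    and "grade M d = sr_class W \<Gamma> ` homogeneous_part W d"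
    and "p \<in> carrier (poly_ring W) \<Longrightarrow> q \<in> carrier (poly_ring W) \<Longrightarrow>
      add M (sr_class W \<Gamma> p) (sr_class W \<Gamma> q) = sr_class W \<Gamma> (p + q)"
    and "p \<in> carrier (poly_ring W) \<Longrightarrow> q \<in> carrier (poly_ring W) \<Longrightarrow>
      smult M p (sr_class W \<Gamma> q) = sr_class W \<Gamma> (p * q)"
proof -
  let ?I = "stanley_reisner_ideal W \<Gamma> :: ('v, 'k) mpoly set" and ?S = "poly_ring W :: ('v, 'k) mpoly
      ring"
  interpret ideal ?I ?S using stanley_reisner_ideal_eq[OF \<Gamma>] by metis
  show "carrier M = sr_class W \<Gamma> ` carrier (poly_ring W)"
    by (auto simp: M_def stanley_reisner_ring_def Let_def FactRing_def A_RCOSETS_def')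
  show "zero M = sr_class W \<Gamma> 0"
    using a_rcos_zero[OF _ zero_closed]
    by (auto simp: M_def stanley_reisner_ring_def Let_def FactRing_def a_r_coset_def')
  show "grade M d = sr_class W \<Gamma> ` homogeneous_part W d"
    by (simp add: M_def stanley_reisner_ring_def Let_def)
  show "add M (sr_class W \<Gamma> p) (sr_class W \<Gamma> q) = sr_class W \<Gamma> (p + q)"
    if "p \<in> carrier (poly_ring W)" "q \<in> carrier (poly_ring W)"
    using ring_hom_add[OF rcos_ring_hom that] by (simp add: M_def stanley_reisner_ring_def Let_def)
  show "smult M p (sr_class W \<Gamma> q) = sr_class W \<Gamma> (p * q)"
    if "p \<in> carrier (poly_ring W)" "q \<in> carrier (poly_ring W)"
    using ring_hom_mult[OF rcos_ring_hom that] by (simp add: M_def stanley_reisner_ring_def Let_def)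
qed

section \<open>Minimal resolutions of the Stanley--Reisner ring\<close>

lemma graded_hom_iff_free_hom:
  fixes \<phi> :: "('i \<Rightarrow>\<^sub>0 ('v::linorder, 'k::field) mpoly) \<Rightarrow> ('j \<Rightarrow>\<^sub>0 ('v, 'k) mpoly)"
  shows "\<phi> \<in> graded_hom (poly_ring W) (graded_free_module W B \<delta>) (graded_free_module W B' \<delta>') \<longleftrightarrow>
    free_hom W UNIV B \<delta> B' \<delta>' \<phi>"
  unfolding graded_hom_def free_hom_def by (simp add: Pi_iff image_subset_iff) blast

text \<open>One generator of degree 0 covers the ring. As \<open>{}\<close> is a face, the ideal
  contains no polynomial with a constant term, so this cover is already minimal and the kernels can
  be resolved from there on.\<close>

lemma minimal_resolution_exists:
  fixes W :: "'v::{linorder,countable} set"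
  assumes \<Gamma>: "simplicial_complex_on W \<Gamma>" and "{} \<in> \<Gamma>"
  shows "\<exists>F. minimal_graded_free_resolution W (stanley_reisner_ring TYPE('k::field) W \<Gamma>) F"
proof -
  note simps = stanley_reisner_ring_simps[OF \<Gamma>, where ?'k = 'k]
  let ?l = "\<lambda>x :: nat \<Rightarrow>\<^sub>0 ('v, 'k) mpoly. Poly_Mapping.lookup x 0"
  define K where "K = {x \<in> free_carrier W {0}. ?l x \<in> nonface_polys W \<Gamma>}"
  have W: "finite W" using \<Gamma> by (simp add: simplicial_complex_on_def)
  have K: "graded_submodule W {0} (\<lambda>_. 0) K"
    unfolding graded_submodule_def
  proof (intro conjI ballI allI)
    fix x d assume x: "x \<in> K"
    have "Poly_Mapping.lookup (?l (free_component (\<lambda>_. 0) d x)) m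
        = (if int (mon_degree m) = d then Poly_Mapping.lookup (?l x) m else 0)" for m
      using free_coeff_filter[of _ x 0 m] by (simp add: free_coeff_def)
    then show "free_component (\<lambda>_. 0) d x \<in> K"
      using x by (auto simp: K_def nonface_polys_def free_carrier_closed poly_ring_carrier_iff
          split: if_splits)
  qed (auto simp: K_def free_carrier_closed nonface_polys_closed lookup_add free_smult_in_carrier
      nonface_polys_mult[OF \<Gamma>])
  have min: "free_coeff x b 0 = 0" if "x \<in> K" for x b
  proof (cases "b = 0")
    case True
    then show ?thesis using that \<open>{} \<in> \<Gamma>\<close> by (auto simp: K_def nonface_polys_def free_coeff_def)
  next
    case False
    then show ?thesis using that free_carrierD[of x W "{0}" b 0] by (auto simp: K_def)
  qed
  obtain B \<delta> \<phi> where seq: "B 0 = {0::nat}" "\<delta> 0 = (\<lambda>_. 0)"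
    "\<And>i. free_hom W UNIV (B (Suc i)) (\<delta> (Suc i)) (B i) (\<delta> i) (\<phi> i)"
    "\<phi> 0 ` free_carrier W (B (Suc 0)) = K"
    "\<And>i. \<phi> (Suc i) ` free_carrier W (B (Suc (Suc i))) = {x \<in> free_carrier W (B (Suc i)). \<phi> i x = 0}"
    "\<And>i x b. x \<in> free_carrier W (B (Suc i)) \<Longrightarrow> free_coeff (\<phi> i x) b 0 = 0"
    by (rule minimal_free_sequence[OF W _ K min]) auto
  define F where "F = \<lparr>res_basis = B, res_degree = \<delta>, res_map = \<phi>, res_aug = (\<lambda>x. sr_class W \<Gamma> (?l x))\<rparr>"
  have zero: "sr_class W \<Gamma> p = sr_class W \<Gamma> 0 \<longleftrightarrow> p \<in> nonface_polys W \<Gamma>" for p :: "('v, 'k) mpoly"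
    using sr_class_eq_iff[OF \<Gamma>, of p 0] by simp
  have single: "Poly_Mapping.single 0 p \<in> free_carrier W {0}" if "p \<in> carrier (poly_ring W)" for p
      :: "('v, 'k) mpoly"
    using that by (auto simp: free_carrier_def free_coeff_single poly_ring_carrier_iff)
  have "minimal_graded_free_resolution W (stanley_reisner_ring TYPE('k) W \<Gamma>) F"
    unfolding minimal_graded_free_resolution_def
  proof (intro conjI allI ballI)
    have "?l x \<in> homogeneous_part W d" if "x \<in> free_grade W {0} (\<lambda>_. 0) d" for x d
      using lookup_homogeneous[OF that, of 0] by simp
    then show "res_aug F \<in> graded_hom (poly_ring W) (res_module W F 0) (stanley_reisner_ring
        TYPE('k) W \<Gamma>)"
      unfolding graded_hom_def
      by (auto simp: F_def res_module_def seq(1,2) simps lookup_in_poly_ring lookup_add)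
    show "res_map F i \<in> graded_hom (poly_ring W) (res_module W F (Suc i)) (res_module W F i)" for i
      unfolding res_module_def graded_hom_iff_free_hom using seq(3) by (simp add: F_def)
    show "res_aug F ` carrier (res_module W F 0) = carrier (stanley_reisner_ring TYPE('k) W \<Gamma>)"
    proof
      show "res_aug F ` carrier (res_module W F 0) \<subseteq> carrier (stanley_reisner_ring TYPE('k) W \<Gamma>)"
        by (auto simp: F_def res_module_def simps lookup_in_poly_ring)
      show "carrier (stanley_reisner_ring TYPE('k) W \<Gamma>) \<subseteq> res_aug F ` carrier (res_module W F 0)"
      proof
        fix X assume "X \<in> carrier (stanley_reisner_ring TYPE('k) W \<Gamma>)"
        then obtain p :: "('v, 'k) mpoly" where p: "p \<in> carrier (poly_ring W)" "X = sr_class W \<Gamma> p"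
          by (auto simp: simps)
        then have "X = res_aug F (Poly_Mapping.single 0 p)" by (simp add: F_def)
        moreover have "Poly_Mapping.single 0 p \<in> carrier (res_module W F 0)"
          using single[OF p(1)] by (simp add: F_def res_module_def seq(1))
        ultimately show "X \<in> res_aug F ` carrier (res_module W F 0)" by (rule image_eqI)
      qed
    qed
    show "{x \<in> carrier (res_module W F 0). res_aug F x = \<zero>\<^bsub>stanley_reisner_ring TYPE('k) W \<Gamma>\<^esub>}
        = res_map F 0 ` carrier (res_module W F 1)"
      using seq(1,4) by (simp add: F_def res_module_def simps zero K_def)
    show "{x \<in> carrier (res_module W F (Suc i)). res_map F i x = 0}
        = res_map F (Suc i) ` carrier (res_module W F (Suc (Suc i)))" for i
      using seq(5) by (simp add: F_def res_module_def)
    show "Poly_Mapping.lookup (res_map F i x) b \<in> irrelevant_ideal W"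
      if x: "x \<in> carrier (res_module W F (Suc i))" for i x b
    proof -
      have x': "x \<in> free_carrier W (B (Suc i))" using x by (simp add: F_def res_module_def)
      interpret free_hom W UNIV "B (Suc i)" "\<delta> (Suc i)" "B i" "\<delta> i" "\<phi> i" by (rule seq(3))
      show ?thesis
        using seq(6)[OF x', of b] lookup_in_poly_ring[OF closed[OF x'], of b]
        by (simp add: irrelevant_ideal_def F_def free_coeff_def)
    qed
  qed
  then show ?thesis by blast
qed

text \<open>Truncation to face monomials removes the dependence on the chosen representative. The
  result is placed in a free module of rank one, so that the augmentation becomes a map between free
  modules.\<close>

definition sr_normal_form ::
  "'v set \<Rightarrow> 'v set set \<Rightarrow> ('v, 'k::field) mpoly set \<Rightarrow> (nat \<Rightarrow>\<^sub>0 ('v, 'k) mpoly)" where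
  "sr_normal_form W \<Gamma> X = Poly_Mapping.single 0 (pm_filter (\<lambda>m. Poly_Mapping.keys m \<in> \<Gamma>)
     (SOME p. p \<in> carrier (poly_ring W) \<and> X = sr_class W \<Gamma> p))"

lemma pm_filter_faces_eq_iff:
  fixes p q :: "('v, 'k::field) mpoly"
  assumes "p \<in> carrier (poly_ring W)" "q \<in> carrier (poly_ring W)"
  shows "pm_filter (\<lambda>m. Poly_Mapping.keys m \<in> \<Gamma>) p = pm_filter (\<lambda>m. Poly_Mapping.keys m \<in> \<Gamma>) q \<longleftrightarrow>
    p - q \<in> nonface_polys W \<Gamma>"
proof -
  have "p - q \<in> carrier (poly_ring W)"
    using poly_ring_closed(1)[OF assms(1) poly_ring_closed(2)[OF assms(2)]] by simp
  then show ?thesis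
    unfolding poly_mapping_eq_iff fun_eq_iff nonface_polys_def by (auto simp: lookup_minus)
qed

lemma sr_normal_form_class:
  fixes p :: "('v, 'k::field) mpoly"
  assumes \<Gamma>: "simplicial_complex_on W \<Gamma>" and p: "p \<in> carrier (poly_ring W)"
  shows "sr_normal_form W \<Gamma> (sr_class W \<Gamma> p) = Poly_Mapping.single 0 (pm_filter (\<lambda>m.
      Poly_Mapping.keys m \<in> \<Gamma>) p)"
proof -
  define q where "q = (SOME q. q \<in> carrier (poly_ring W) \<and> sr_class W \<Gamma> p = sr_class W \<Gamma> q)"
  have "q \<in> carrier (poly_ring W) \<and> sr_class W \<Gamma> p = sr_class W \<Gamma> q"
    unfolding q_def by (rule someI[of _ p]) (simp add: p)
  then show ?thesis
    using pm_filter_faces_eq_iff[OF p, of q \<Gamma>] sr_class_eq_iff[OF \<Gamma>, of p q]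
    unfolding sr_normal_form_def q_def[symmetric] by simp
qed

text \<open>Brings the augmentation of an arbitrary resolution under \<open>free_hom\<close> without
  changing its kernel; the ring appears as the set of truncated elements.\<close>

lemma augmentation_normal_form:
  fixes W :: "'v::linorder set" and \<epsilon> :: "('i \<Rightarrow>\<^sub>0 ('v, 'k::field) mpoly) \<Rightarrow> ('v, 'k) mpoly set"
  assumes \<Gamma>: "simplicial_complex_on W \<Gamma>"
    and hom: "\<epsilon> \<in> graded_hom (poly_ring W) (graded_free_module W B \<delta>) (stanley_reisner_ring TYPE('k)
        W \<Gamma>)"
    and surj: "\<epsilon> ` free_carrier W B = carrier (stanley_reisner_ring TYPE('k) W \<Gamma>)"
  defines "\<phi> \<equiv> \<lambda>x. sr_normal_form W \<Gamma> (\<epsilon> x)"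
  shows "free_hom W \<Gamma> B \<delta> {0} (\<lambda>_. 0) \<phi>"
    and "\<phi> ` free_carrier W B = {x \<in> free_carrier W {0}. supported_part \<Gamma> x = x}"
    and "x \<in> free_carrier W B \<Longrightarrow> \<phi> x = 0 \<longleftrightarrow> \<epsilon> x = \<zero>\<^bsub>stanley_reisner_ring TYPE('k) W \<Gamma>\<^esub>"
proof -
  let ?M = "stanley_reisner_ring TYPE('k) W \<Gamma>"
  let ?S = "carrier (poly_ring W) :: ('v, 'k) mpoly set"
  let ?f = "pm_filter (\<lambda>m. Poly_Mapping.keys m \<in> \<Gamma>) :: ('v, 'k) mpoly \<Rightarrow> _"
  note simps = stanley_reisner_ring_simps[OF \<Gamma>, where ?'k = 'k]
  have rep: "\<exists>p\<in>?S. \<epsilon> x = sr_class W \<Gamma> p" if "x \<in> free_carrier W B" for x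
    using surj that unfolding simps by blast
  have \<phi>: "\<phi> x = Poly_Mapping.single 0 (?f p)" if "p \<in> ?S" "\<epsilon> x = sr_class W \<Gamma> p" for x p
    using sr_normal_form_class[OF \<Gamma> that(1)] that(2) by (simp add: \<phi>_def)
  have fS: "?f p \<in> ?S" if "p \<in> ?S" for p
    using that by (auto simp: poly_ring_carrier_iff split: if_splits)
  have f_single: "supported_part \<Gamma> (Poly_Mapping.single (0::nat) p) = Poly_Mapping.single 0 (?f p)" for p
    by (rule free_eqI) (simp add: free_coeff_single)
  have single: "Poly_Mapping.single 0 p \<in> free_carrier W {0}" if "p \<in> ?S" for p
    using that by (auto simp: free_carrier_def free_coeff_single poly_ring_carrier_iff)
  have add: "\<epsilon> (x + y) = add ?M (\<epsilon> x) (\<epsilon> y)" if "x \<in> free_carrier W B" "y \<in> free_carrier W B" for x y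
    using hom that by (simp add: graded_hom_def)
  have smult: "\<epsilon> (free_smult a x) = smult ?M a (\<epsilon> x)" if "a \<in> ?S" "x \<in> free_carrier W B" for a x
    using hom that by (simp add: graded_hom_def)
  show "free_hom W \<Gamma> B \<delta> {0} (\<lambda>_. 0) \<phi>"
  proof
    fix x :: "'i \<Rightarrow>\<^sub>0 ('v, 'k) mpoly" assume x: "x \<in> free_carrier W B"
    then obtain p where p: "p \<in> ?S" "\<epsilon> x = sr_class W \<Gamma> p" using rep by blast
    then show "\<phi> x \<in> free_carrier W {0}" using \<phi>[OF p] single[OF fS] by simp
    {
      fix y :: "'i \<Rightarrow>\<^sub>0 ('v, 'k) mpoly" assume y: "y \<in> free_carrier W B"
      then obtain q where q: "q \<in> ?S" "\<epsilon> y = sr_class W \<Gamma> q" using rep by blast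
      have "\<epsilon> (x + y) = sr_class W \<Gamma> (p + q)" using add[OF x y] p q by (simp add: simps)
      moreover have "?f (p + q) = ?f p + ?f q" by (rule poly_mapping_eqI) (simp add: lookup_add)
      ultimately show "\<phi> (x + y) = \<phi> x + \<phi> y"
        using \<phi>[OF poly_ring_closed(1)[OF p(1) q(1)]] \<phi>[OF p] \<phi>[OF q] by (simp add: single_add)
    }
    {
      fix a assume a: "a \<in> ?S"
      have "\<epsilon> (free_smult a x) = sr_class W \<Gamma> (a * p)" using smult[OF a x] p a by (simp add: simps)
      then have "\<phi> (free_smult a x) = Poly_Mapping.single 0 (?f (a * p))"
        using \<phi>[OF poly_ring_closed(3)[OF a p(1)]] by simp
      \<comment> \<open>Truncating \<open>p\<close> before multiplying changes nothing, since
        multiples of nonface monomials have nonface support.\<close>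
      also have "?f (a * p) = ?f (a * ?f p)"
      proof -
        have "p - ?f p \<in> nonface_polys W \<Gamma>"
        proof -
          have "?f p = ?f (?f p)" by (rule poly_mapping_eqI) simp
          then show ?thesis using pm_filter_faces_eq_iff[OF p(1) fS[OF p(1)]] by blast
        qed
        then have "a * p - a * ?f p \<in> nonface_polys W \<Gamma>"
          using nonface_polys_mult[OF \<Gamma> a] by (simp add: right_diff_distrib[symmetric])
        then show ?thesis
          using pm_filter_faces_eq_iff poly_ring_closed(3)[OF a p(1)] poly_ring_closed(3)[OF a fS[OF
              p(1)]] by blast
      qed
      also have "Poly_Mapping.single 0 (?f (a * ?f p)) = supported_part \<Gamma> (free_smult a (\<phi> x))"
      proof -
        have "free_smult a (Poly_Mapping.single (0::nat) (?f p)) = Poly_Mapping.single 0 (a * ?f p)"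
          by (rule poly_mapping_eqI) (simp add: lookup_single when_def)
        then show ?thesis unfolding \<phi>[OF p] by (simp only: f_single)
      qed
      finally show "\<phi> (free_smult a x) = supported_part \<Gamma> (free_smult a (\<phi> x))" .
    }
  next
    fix x :: "'i \<Rightarrow>\<^sub>0 ('v, 'k) mpoly" and d assume x: "x \<in> free_grade W B \<delta> d"
    then have "\<epsilon> x \<in> grade ?M d" using hom by (simp add: graded_hom_def image_subset_iff)
    then obtain p where p: "p \<in> homogeneous_part W d" "\<epsilon> x = sr_class W \<Gamma> p" unfolding simps by auto
    then have "\<phi> x = Poly_Mapping.single 0 (?f p)" using \<phi> homogeneous_in_carrier by blast
    then show "\<phi> x \<in> free_grade W {0} (\<lambda>_. 0) d"
      using p(1) by (auto simp: free_grade_def free_coeff_single homogeneous_part_iff)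
  qed
  show "\<phi> ` free_carrier W B = {x \<in> free_carrier W {0}. supported_part \<Gamma> x = x}"
  proof (rule equalityI; rule subsetI)
    fix y assume "y \<in> \<phi> ` free_carrier W B"
    then obtain x where x: "x \<in> free_carrier W B" "y = \<phi> x" by auto
    then obtain p where p: "p \<in> ?S" "\<epsilon> x = sr_class W \<Gamma> p" using rep by blast
    have "?f (?f p) = ?f p" by (rule poly_mapping_eqI) simp
    then show "y \<in> {x \<in> free_carrier W {0}. supported_part \<Gamma> x = x}"
      unfolding x(2) \<phi>[OF p] using single[OF fS[OF p(1)]] by (simp only: f_single mem_Collect_eq)
  next
    fix y :: "nat \<Rightarrow>\<^sub>0 ('v, 'k) mpoly"
    assume y: "y \<in> {x \<in> free_carrier W {0}. supported_part \<Gamma> x = x}"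
    then have p: "Poly_Mapping.lookup y 0 \<in> ?S" using lookup_in_poly_ring[of y W "{0}" 0] by simp
    then have "sr_class W \<Gamma> (Poly_Mapping.lookup y 0) \<in> \<epsilon> ` free_carrier W B" unfolding surj simps
        by blast
    then obtain x where x: "x \<in> free_carrier W B" "\<epsilon> x = sr_class W \<Gamma> (Poly_Mapping.lookup y 0)" by auto
    have "Poly_Mapping.keys y \<subseteq> {0}" using y keys_subset_free_carrier by blast
    then have "Poly_Mapping.lookup y k = 0" if "k \<noteq> 0" for k
      using that in_keys_iff[of k y] by auto
    then have "y = Poly_Mapping.single 0 (Poly_Mapping.lookup y 0)"
      by (intro poly_mapping_eqI[of y]) (simp add: lookup_single when_def)
    from arg_cong[OF this, of "supported_part \<Gamma>"] have "supported_part \<Gamma> y = \<phi> x"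
      by (simp only: f_single \<phi>[OF p x(2)])
    then have "y = \<phi> x" using y by simp
    then show "y \<in> \<phi> ` free_carrier W B" using x(1) by blast
  qed
  show "\<phi> x = 0 \<longleftrightarrow> \<epsilon> x = \<zero>\<^bsub>?M\<^esub>" if x: "x \<in> free_carrier W B"
  proof -
    obtain p where p: "p \<in> ?S" "\<epsilon> x = sr_class W \<Gamma> p" using rep x by blast
    have "\<phi> x = 0 \<longleftrightarrow> ?f p = ?f 0"
      unfolding \<phi>[OF p] by (metis pm_filter_zero lookup_single_eq lookup_zero single_zero)
    also have "\<dots> \<longleftrightarrow> \<epsilon> x = sr_class W \<Gamma> 0"
      unfolding p(2) sr_class_eq_iff[OF \<Gamma>] pm_filter_faces_eq_iff[OF p(1) poly_ring_closed(5)] ..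
    finally show ?thesis by (simp add: simps)
  qed
qed

section \<open>Finiteness of the generators in each degree\<close>

text \<open>Gaussian elimination, one coordinate of \<open>P\<close> at a time. Independence is that
  of an indexed family, so indices are counted even where vectors might coincide, and finiteness of
  \<open>C\<close> is part of the result.\<close>

lemma independent_family_card_le:
  fixes u :: "'i \<Rightarrow> 'p \<Rightarrow> 'k::field"
  assumes "finite P" and "\<And>b p. b \<in> C \<Longrightarrow> p \<notin> P \<Longrightarrow> u b p = 0"
    and "\<And>A c. finite A \<Longrightarrow> A \<subseteq> C \<Longrightarrow> (\<And>p. (\<Sum>b\<in>A. c b * u b p) = 0) \<Longrightarrow> \<forall>b\<in>A. c b = 0"
  shows "finite C \<and> card C \<le> card P"
  using assms
proof (induction P arbitrary: C u rule: finite_induct)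
  case empty
  have "b \<notin> C" for b
    using empty(1)[of b] empty(2)[of "{b}" "\<lambda>_. 1"] by force
  then have "C = {}" by blast
  then show ?case by simp
next
  case (insert p P)
  show ?case
  proof (cases "\<forall>b\<in>C. u b p = 0")
    case True
    have "finite C \<and> card C \<le> card P"
    proof (rule insert.IH[of C u])
      show "u b x = 0" if "b \<in> C" "x \<notin> P" for b x
        using that True insert.prems(1)[of b x] by (cases "x = p") auto
    qed (rule insert.prems(2))
    then show ?thesis using insert.hyps by simp
  next
    case False
    then obtain b0 where b0: "b0 \<in> C" "u b0 p \<noteq> 0" by blast
    \<comment> \<open>\<open>b0\<close> is the pivot for the coordinate \<open>p\<close>, which
      vanishes on all \<open>v b\<close>.\<close>
    define v where "v b x = u b x - u b p / u b0 p * u b0 x" for b x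
    have "finite (C - {b0}) \<and> card (C - {b0}) \<le> card P"
    proof (rule insert.IH[of "C - {b0}" v])
      show "v b x = 0" if "b \<in> C - {b0}" "x \<notin> P" for b x
        using that insert.prems(1)[of b x] insert.prems(1)[of b0 x] b0 by (cases "x = p") (auto
            simp: v_def)
    next
      fix A c assume A: "finite A" "A \<subseteq> C - {b0}" and rel: "\<And>x. (\<Sum>b\<in>A. c b * v b x) = 0"
      \<comment> \<open>The coefficient at the pivot is chosen to undo the elimination, which turns
        a relation among the \<open>v b\<close> into one among the \<open>u b\<close>.\<close>
      define c' where "c' b = (if b = b0 then - (\<Sum>b\<in>A. c b * (u b p / u b0 p)) else c b)" for b
      have "b0 \<notin> A" using A by auto
      have "(\<Sum>b\<in>insert b0 A. c' b * u b x) = 0" for x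
      proof -
        have "(\<Sum>b\<in>A. c' b * u b x) = (\<Sum>b\<in>A. c b * u b x)"
          using \<open>b0 \<notin> A\<close> by (intro sum.cong) (auto simp: c'_def)
        then have "(\<Sum>b\<in>insert b0 A. c' b * u b x) = (\<Sum>b\<in>A. c b * v b x)"
          using A(1) \<open>b0 \<notin> A\<close>
          by (simp add: c'_def v_def right_diff_distrib sum_subtractf sum_distrib_right mult.assoc)
        then show ?thesis using rel by simp
      qed
      then have "\<forall>b\<in>insert b0 A. c' b = 0"
        using insert.prems(2)[of "insert b0 A" c'] A b0(1) by blast
      then show "\<forall>b\<in>A. c b = 0" using \<open>b0 \<notin> A\<close> by (auto simp: c'_def split: if_splits)
    qed
    then show ?thesis
      using insert.hyps b0(1) by (metis card_Suc_Diff1 card_insert_disjoint finite_Diff_insert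
          finite.emptyI Diff_empty Suc_le_mono finite_insert insert_Diff)
  qed
qed

lemma finite_monomials:
  assumes "finite W"
  shows "finite {m::'v \<Rightarrow>\<^sub>0 nat. Poly_Mapping.keys m \<subseteq> W \<and> mon_degree m \<le> k}"
proof -
  have le: "Poly_Mapping.lookup m v \<le> mon_degree m" for m :: "'v \<Rightarrow>\<^sub>0 nat" and v
    unfolding mon_degree_def by (cases "v \<in> Poly_Mapping.keys m") (auto simp: in_keys_iff intro:
        member_le_sum)
  let ?X = "{m::'v \<Rightarrow>\<^sub>0 nat. Poly_Mapping.keys m \<subseteq> W \<and> mon_degree m \<le> k}"
  have "Poly_Mapping.lookup ` ?X \<subseteq> {f. \<forall>x. (x \<in> W \<longrightarrow> f x \<in> {..k}) \<and> (x \<notin> W \<longrightarrow> f x = 0)}"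
    by (auto simp: in_keys_iff subset_iff intro: order_trans[OF le])
  then have "finite (Poly_Mapping.lookup ` ?X)"
    by (rule finite_subset[OF _ finite_set_of_finite_funs[OF assms finite_atMost]])
  then show ?thesis by (rule finite_imageD) (simp add: inj_on_def poly_mapping.lookup_inject)
qed

text \<open>The images of the generators of degree \<open>j\<close> are independent, since a linear
  relation would give a kernel element with constant coefficients. They lie in the part of degree
  \<open>j\<close> of the target, which has finitely many monomial positions.\<close>

lemma (in free_hom) finite_generators:
  assumes W: "finite W" and nonneg: "\<And>b. b \<in> B' \<Longrightarrow> 0 \<le> \<delta>' b" and fin: "\<And>j. finite {b \<in> B'. \<delta>' b = j}"
    and ker: "\<And>x b. x \<in> free_carrier W B \<Longrightarrow> \<phi> x = 0 \<Longrightarrow> free_coeff x b 0 = 0"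
  shows "finite {b \<in> B. \<delta> b = j}" and "b \<in> B \<Longrightarrow> 0 \<le> \<delta> b"
proof -
  define P where "P j = {(b, m). b \<in> B' \<and> Poly_Mapping.keys m \<subseteq> W \<and> int (mon_degree m) + \<delta>' b = j}" for j
  have finP: "finite (P j)" for j
  proof -
    have "P j \<subseteq> (\<Union>i\<in>{0..j}. {b \<in> B'. \<delta>' b = i}) \<times> {m. Poly_Mapping.keys m \<subseteq> W \<and> mon_degree m \<le> nat j}"
      using nonneg by (fastforce simp: P_def)
    then show ?thesis
      by (rule finite_subset) (use fin finite_monomials[OF W] in auto)
  qed
  define u where "u b = (\<lambda>(b', m). free_coeff (\<phi> (Poly_Mapping.single b 1)) b' m)" for b
  have gen: "Poly_Mapping.single b 1 \<in> free_grade W B \<delta> (\<delta> b)" if "b \<in> B" for b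
    using that by (auto simp: free_grade_def free_coeff_single lookup_one when_def split: if_splits)
  have card: "finite {b \<in> B. \<delta> b = j} \<and> card {b \<in> B. \<delta> b = j} \<le> card (P j)" for j
  proof (rule independent_family_card_le[OF finP, where u = u])
    fix b p assume b: "b \<in> {b \<in> B. \<delta> b = j}" and p: "p \<notin> P j"
    then have "\<phi> (Poly_Mapping.single b 1) \<in> free_grade W B' \<delta>' j" using graded[OF gen] by blast
    from free_gradeD[OF this, of "fst p" "snd p"] p show "u b p = 0"
      unfolding u_def P_def by (auto simp: split_beta)
  next
    fix A c assume A: "finite A" "A \<subseteq> {b \<in> B. \<delta> b = j}" and rel: "\<And>p. (\<Sum>b\<in>A. c b * u b p) = 0"
    \<comment> \<open>The relation lifts to an element with the constants \<open>c\<close> as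
      coordinates; it lies in the kernel, so they vanish.\<close>
    define x :: "'i \<Rightarrow>\<^sub>0 ('v, 'k) mpoly" where "x = (\<Sum>b\<in>A. free_smult (Poly_Mapping.single 0 (c b))
        (Poly_Mapping.single b 1))"
    have car: "Poly_Mapping.single b 1 \<in> free_carrier W B" if "b \<in> A" for b
      using that A gen free_grade_subset by blast
    have xcar: "x \<in> free_carrier W B"
      unfolding x_def by (intro free_carrier_sum free_smult_in_carrier car poly_ring_closed)
    have "\<phi> x = (\<Sum>b\<in>A. \<phi> (free_smult (Poly_Mapping.single 0 (c b)) (Poly_Mapping.single b 1)))"
      unfolding x_def by (intro hom_sum free_smult_in_carrier car poly_ring_closed)
    also have "\<dots> = (\<Sum>b\<in>A. free_smult (Poly_Mapping.single 0 (c b)) (\<phi> (Poly_Mapping.single b 1)))"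
    proof (rule sum.cong[OF refl])
      fix b assume b: "b \<in> A"
      have "supported_part \<Gamma> (free_smult (Poly_Mapping.single 0 a) y) = free_smult
          (Poly_Mapping.single 0 a) (supported_part \<Gamma> y)"
        for a and y :: "'j \<Rightarrow>\<^sub>0 ('v, 'k) mpoly"
        by (rule free_eqI) simp
      then show "\<phi> (free_smult (Poly_Mapping.single 0 (c b)) (Poly_Mapping.single b 1))
          = free_smult (Poly_Mapping.single 0 (c b)) (\<phi> (Poly_Mapping.single b 1))"
        using smult[OF poly_ring_closed(4) car[OF b]] hom_supported[OF car[OF b]] by simp
    qed
    also have "\<dots> = 0"
      by (rule free_eqI) (use rel in \<open>auto simp: free_coeff_sum u_def\<close>)
    finally have "\<phi> x = 0" .
    then have "free_coeff x b 0 = 0" for b using ker xcar by blast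
    moreover have "free_coeff x b 0 = c b" if "b \<in> A" for b
      using that A(1) by (simp add: x_def free_coeff_sum free_coeff_single if_distrib cong: if_cong)
    ultimately show "\<forall>b\<in>A. c b = 0" by simp
  qed
  show "finite {b \<in> B. \<delta> b = j}" using card by blast
  show "0 \<le> \<delta> b" if b: "b \<in> B"
  proof (rule ccontr)
    assume neg: "\<not> 0 \<le> \<delta> b"
    \<comment> \<open>The target has no positions in negative degree, so the same count leaves no
      generators there.\<close>
    have "P (\<delta> b) = {}" using neg nonneg by (fastforce simp: P_def)
    then have "finite {b' \<in> B. \<delta> b' = \<delta> b}" "card {b' \<in> B. \<delta> b' = \<delta> b} = 0" 
      using card[of "\<delta> b"] by simp_all
    then show False using b by (auto simp: card_0_eq)
  qed
qed

section \<open>Koszul homology in multidegree one and regularity\<close>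

text \<open>Adjointness of boundary and coboundary: the inner sum on the right is the coboundary of
  \<open>\<psi>\<close> at \<open>\<sigma>\<close>.\<close>

lemma pairing_simplicial_boundary:
  fixes c :: "'v::linorder set \<Rightarrow>\<^sub>0 'k::field"
  assumes W: "finite W" and c: "Poly_Mapping.keys c \<subseteq> Pow W"
  shows "(\<Sum>\<tau>\<in>Pow W. Poly_Mapping.lookup (simplicial_boundary c) \<tau> * \<psi> \<tau>)
    = (\<Sum>\<sigma>\<in>Poly_Mapping.keys c. Poly_Mapping.lookup c \<sigma> * (\<Sum>v\<in>\<sigma>. alternate (card {w\<in>\<sigma>. w < v}) (\<psi> (\<sigma>
        - {v}))))"
proof -
  let ?t = "\<lambda>\<sigma> v. (-1) ^ card {w \<in> \<sigma>. w < v} * Poly_Mapping.lookup c \<sigma>"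
  have "(\<Sum>\<tau>\<in>Pow W. Poly_Mapping.lookup (simplicial_boundary c) \<tau> * \<psi> \<tau>)
      = (\<Sum>\<tau>\<in>Pow W. \<Sum>\<sigma>\<in>Poly_Mapping.keys c. \<Sum>v\<in>\<sigma>. if \<tau> = \<sigma> - {v} then ?t \<sigma> v * \<psi> (\<sigma> - {v}) else 0)"
    unfolding simplicial_boundary_def lookup_sum sum_distrib_right lookup_single
    by (intro sum.cong refl) (auto simp: when_def)
  also have "\<dots> = (\<Sum>\<sigma>\<in>Poly_Mapping.keys c. \<Sum>\<tau>\<in>Pow W. \<Sum>v\<in>\<sigma>. if \<tau> = \<sigma> - {v} then ?t \<sigma> v * \<psi> (\<sigma> - {v})
      else 0)"
    by (rule sum.swap)
  also have "\<dots> = (\<Sum>\<sigma>\<in>Poly_Mapping.keys c. \<Sum>v\<in>\<sigma>. ?t \<sigma> v * \<psi> (\<sigma> - {v}))"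
  proof (rule sum.cong[OF refl])
    fix \<sigma> assume "\<sigma> \<in> Poly_Mapping.keys c"
    then have \<sigma>: "\<sigma> \<subseteq> W" using c by auto
    have "(\<Sum>\<tau>\<in>Pow W. \<Sum>v\<in>\<sigma>. if \<tau> = \<sigma> - {v} then ?t \<sigma> v * \<psi> (\<sigma> - {v}) else 0)
        = (\<Sum>v\<in>\<sigma>. \<Sum>\<tau>\<in>Pow W. if \<tau> = \<sigma> - {v} then ?t \<sigma> v * \<psi> (\<sigma> - {v}) else 0)"
      by (rule sum.swap)
    also have "\<dots> = (\<Sum>v\<in>\<sigma>. ?t \<sigma> v * \<psi> (\<sigma> - {v}))"
      by (rule sum.cong[OF refl]) (use \<sigma> W in \<open>auto simp: Diff_subset_conv\<close>)
    finally show "(\<Sum>\<tau>\<in>Pow W. \<Sum>v\<in>\<sigma>. if \<tau> = \<sigma> - {v} then ?t \<sigma> v * \<psi> (\<sigma> - {v}) else 0)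
        = (\<Sum>v\<in>\<sigma>. ?t \<sigma> v * \<psi> (\<sigma> - {v}))" .
  qed
  also have "\<dots> = (\<Sum>\<sigma>\<in>Poly_Mapping.keys c. Poly_Mapping.lookup c \<sigma> * (\<Sum>v\<in>\<sigma>. alternate (card {w\<in>\<sigma>. w <
      v}) (\<psi> (\<sigma> - {v}))))"
    by (simp add: sum_distrib_left alternate_eq_mult mult_ac)
  finally show ?thesis .
qed

lemma alternate_alternate: "alternate m (alternate n x) = alternate (m + n) x"
  by (simp add: alternate_def)

lemma alternate_sum: "alternate n (sum f A) = (\<Sum>a\<in>A. alternate n (f a))"
  by (simp add: alternate_def sum_negf)

lemma alternate_cong_parity: "even (m + n) \<Longrightarrow> alternate m x = alternate n x"
  by (auto simp: alternate_def)

definition squarefree_exponent :: "'v set \<Rightarrow> ('v \<Rightarrow>\<^sub>0 nat)" where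
  "squarefree_exponent \<rho> = (\<Sum>v\<in>\<rho>. Poly_Mapping.single v 1)"

lemma keys_squarefree_exponent: "finite \<rho> \<Longrightarrow> Poly_Mapping.keys (squarefree_exponent \<rho>) = \<rho>"
  by (auto simp: squarefree_exponent_def in_keys_iff lookup_sum lookup_single when_def split: if_splits)

lemma mon_degree_squarefree_exponent: "finite \<rho> \<Longrightarrow> mon_degree (squarefree_exponent \<rho>) = card \<rho>"
  unfolding squarefree_exponent_def by (induction \<rho> rule: finite_induct) (simp_all add: mon_degree_add)

lemma squarefree_exponent_insert:
  "finite \<rho> \<Longrightarrow> v \<notin> \<rho> \<Longrightarrow> squarefree_exponent (insert v \<rho>) = Poly_Mapping.single v 1 + squarefree_exponent \<rho>"
  by (simp add: squarefree_exponent_def)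

lemma minus_single_eq_squarefree_exponent_iff:
  assumes "finite \<rho>" "v \<in> \<rho>" "v \<in> Poly_Mapping.keys m"
  shows "m - Poly_Mapping.single v 1 = squarefree_exponent (\<rho> - {v}) \<longleftrightarrow> m = squarefree_exponent \<rho>"
proof -
  have \<rho>: "squarefree_exponent \<rho> = Poly_Mapping.single v 1 + squarefree_exponent (\<rho> - {v})"
    using squarefree_exponent_insert[of "\<rho> - {v}" v] assms by (simp add: insert_absorb)
  obtain m' where "m = Poly_Mapping.single v 1 + m'"
    using assms(3)[folded exists_add_single_iff] by (rule exE)
  then show ?thesis unfolding \<rho> by simp
qed

text \<open>The part of the Koszul complex of the Stanley--Reisner ring in multidegree \<open>(1,\<dots>,1)\<close> is the
  augmented cochain complex of \<open>\<Gamma>\<close>, with the face \<open>\<rho>\<close> sitting at the index set \<open>W - \<rho>\<close>. The parity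
  function \<open>E\<close> below matches the signs of the two complexes.\<close>

lemma koszul_not_acyclic:
  fixes W :: "'v::linorder set" and w :: "'v set \<Rightarrow>\<^sub>0 'k::field"
  assumes \<Gamma>: "simplicial_complex_on W \<Gamma>"
    and w: "w \<in> simplicial_chains (int k - 1) \<Gamma>" "simplicial_boundary w = 0"
      "w \<notin> simplicial_boundary ` simplicial_chains (int k) \<Gamma>"
    and i: "i + k = card W"
    and N: "N = {x \<in> free_carrier W {0::nat}. supported_part \<Gamma> x = (x :: nat \<Rightarrow>\<^sub>0 ('v, 'k) mpoly)}"
  shows "\<not> koszul_acyclic W \<Gamma> (N \<inter> free_grade W {0} (\<lambda>_. 0) (int (card W) - int i)) N i"
proof
  assume acyclic: "koszul_acyclic W \<Gamma> (N \<inter> free_grade W {0} (\<lambda>_. 0) (int (card W) - int i)) N i"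
  let ?U = "simplicial_boundary ` simplicial_chains (int k) \<Gamma> :: ('v set \<Rightarrow>\<^sub>0 'k) set"
  let ?x = squarefree_exponent
  have W: "finite W" using \<Gamma> by (simp add: simplicial_complex_on_def)
  have fin: "finite \<sigma>" if "\<sigma> \<subseteq> W" for \<sigma> using that W finite_subset by blast
  have face: "\<tau> \<in> \<Gamma>" if "\<sigma> \<in> \<Gamma>" "\<tau> \<subseteq> \<sigma>" for \<sigma> \<tau> using that \<Gamma> by (auto simp: simplicial_complex_on_def)
  have face_W: "\<sigma> \<subseteq> W" if "\<sigma> \<in> \<Gamma>" for \<sigma> using that \<Gamma> by (auto simp: simplicial_complex_on_def)
  have "\<exists>\<chi>::'v set \<Rightarrow> 'k. (\<forall>u\<in>?U. (\<Sum>\<sigma>\<in>Poly_Mapping.keys u. Poly_Mapping.lookup u \<sigma> * \<chi> \<sigma>) = 0) \<and>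
      (\<Sum>\<sigma>\<in>Poly_Mapping.keys w. Poly_Mapping.lookup w \<sigma> * \<chi> \<sigma>) \<noteq> 0"
  proof (rule separating_functional)
    show "0 \<in> ?U" by (rule image_eqI[of _ _ 0]) simp_all
    fix x assume "x \<in> ?U"
    then obtain c where c: "c \<in> simplicial_chains (int k) \<Gamma>" "x = simplicial_boundary c" by auto
    {
      fix y assume "y \<in> ?U"
      then obtain d where "d \<in> simplicial_chains (int k) \<Gamma>" "y = simplicial_boundary d" by auto
      then show "x + y \<in> ?U"
        using c by (intro image_eqI[of _ _ "c + d"]) (simp_all add: simplicial_boundary_add
            simplicial_chains_add)
    }
    fix a
    have "Poly_Mapping.map ((*) a) c \<in> simplicial_chains (int k) \<Gamma>"
      using c(1) keys_map_scale_subset[of a c] by (auto simp: simplicial_chains_def)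
    then show "Poly_Mapping.map ((*) a) x \<in> ?U"
      using c simplicial_boundary_scale[OF W simplicial_chains_keys[OF \<Gamma> c(1)], of a] by force
  qed (rule w(3))
  then obtain \<chi> :: "'v set \<Rightarrow> 'k" where
    \<chi>: "\<And>u. u \<in> ?U \<Longrightarrow> (\<Sum>\<sigma>\<in>Poly_Mapping.keys u. Poly_Mapping.lookup u \<sigma> * \<chi> \<sigma>) = 0"
    "(\<Sum>\<sigma>\<in>Poly_Mapping.keys w. Poly_Mapping.lookup w \<sigma> * \<chi> \<sigma>) \<noteq> 0" by blast
  \<comment> \<open>\<open>\<chi>\<close> vanishes on the boundary of a single face, and this value
    is its coboundary there.\<close>
  have cocycle: "(\<Sum>v\<in>\<rho>. alternate (card {w\<in>\<rho>. w < v}) (\<chi> (\<rho> - {v}))) = 0"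
    if \<rho>: "\<rho> \<in> \<Gamma>" "card \<rho> = Suc k" for \<rho>
  proof -
    let ?c = "Poly_Mapping.single \<rho> 1 :: 'v set \<Rightarrow>\<^sub>0 'k"
    have c: "?c \<in> simplicial_chains (int k) \<Gamma>" using \<rho> by (simp add: simplicial_chains_def)
    have keys: "Poly_Mapping.keys (simplicial_boundary ?c) \<subseteq> Pow W"
      using simplicial_chains_keys[OF \<Gamma> simplicial_boundary_in_chains[OF \<Gamma> c]] .
    have "(\<Sum>\<tau>\<in>Pow W. Poly_Mapping.lookup (simplicial_boundary ?c) \<tau> * \<chi> \<tau>)
        = (\<Sum>\<sigma>\<in>Poly_Mapping.keys (simplicial_boundary ?c). Poly_Mapping.lookup (simplicial_boundary
            ?c) \<sigma> * \<chi> \<sigma>)"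
      using W keys by (intro sum.mono_neutral_right) (auto simp: in_keys_iff)
    also have "\<dots> = 0" using \<chi>(1) c by blast
    finally show ?thesis
      using pairing_simplicial_boundary[OF W simplicial_chains_keys[OF \<Gamma> c], of \<chi>] by simp
  qed
  \<comment> \<open>Inserting \<open>v\<close> changes \<open>E\<close> by the number of vertices
    below \<open>v\<close> in \<open>\<sigma>\<close> plus the number in the complement, which
    trades the Koszul sign for the simplicial one.\<close>
  define E where "E \<sigma> = (\<Sum>w\<in>\<sigma>. card {u\<in>W. u < w})" for \<sigma>
  have card_below: "card {u\<in>W. u < v} = card {u\<in>\<sigma>. u < v} + card {u\<in>W - \<sigma>. u < v}" if "\<sigma> \<subseteq> W" for \<sigma> v
  proof -
    have "{u\<in>W. u < v} = {u\<in>\<sigma>. u < v} \<union> {u\<in>W - \<sigma>. u < v}" using that by auto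
    then show ?thesis using fin[OF that] W by (simp add: card_Un_disjoint disjoint_iff)
  qed
  have E_insert: "E (insert v \<sigma>) = E \<sigma> + card {u\<in>\<sigma>. u < v} + card {u\<in>W - \<sigma>. u < v}"
    if "\<sigma> \<subseteq> W" "v \<in> W - \<sigma>" for \<sigma> v
    using that fin[OF that(1)] card_below[OF that(1)] by (simp add: E_def)
  \<comment> \<open>At an index set of size \<open>i\<close> the squarefree monomial of the
    complement has degree \<open>k\<close>, so the total degree is \<open>card W\<close>.\<close>
  define f :: "'v set \<Rightarrow> (nat \<Rightarrow>\<^sub>0 ('v, 'k) mpoly)" where
    "f \<sigma> = (if W - \<sigma> \<in> \<Gamma> then Poly_Mapping.single 0 (Poly_Mapping.single (?x (W - \<sigma>)) (alternate (E
        \<sigma>) (\<chi> (W - \<sigma>)))) else 0)" for \<sigma>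
  have f_coeff: "free_coeff (f \<sigma>) b m = (if W - \<sigma> \<in> \<Gamma> \<and> b = 0 \<and> m = ?x (W - \<sigma>) then alternate (E \<sigma>)
      (\<chi> (W - \<sigma>)) else 0)"
    for \<sigma> b m
    by (auto simp: f_def free_coeff_single lookup_single when_def)
  have coeff_koszul: "free_coeff (koszul_supported W \<Gamma> g \<tau>) b m = (\<Sum>v\<in>W - \<tau>. alternate (card {w\<in>\<tau>. w
      < v})
      (if Poly_Mapping.keys m \<in> \<Gamma> \<and> v \<in> Poly_Mapping.keys m then free_coeff (g (insert v \<tau>)) b (m -
          Poly_Mapping.single v 1) else 0))"
    for g :: "'v set \<Rightarrow> (nat \<Rightarrow>\<^sub>0 ('v, 'k) mpoly)" and \<tau> b m
  proof -
    have "free_coeff (alternate n x) b m = alternate n (free_coeff x b m)" for n and x :: "nat \<Rightarrow>\<^sub>0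
        ('v, 'k) mpoly"
      by (simp add: alternate_def)
    then show ?thesis
      unfolding koszul_def free_coeff_sum
      by (intro sum.cong refl) (simp add: free_coeff_indet_smult)
  qed
  have "\<exists>g. (\<forall>\<sigma>. \<sigma> \<subseteq> W \<longrightarrow> card \<sigma> = Suc i \<longrightarrow> g \<sigma> \<in> N) \<and>
      (\<forall>\<sigma>. \<sigma> \<subseteq> W \<longrightarrow> card \<sigma> = i \<longrightarrow> f \<sigma> = koszul_supported W \<Gamma> g \<sigma>)"
  proof (rule acyclic[unfolded koszul_acyclic_def, rule_format])
    fix \<sigma> assume \<sigma>: "\<sigma> \<subseteq> W" "card \<sigma> = i"
    have keys: "Poly_Mapping.keys (?x (W - \<sigma>)) = W - \<sigma>" using W by (simp add: keys_squarefree_exponent)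
    have "mon_degree (?x (W - \<sigma>)) = card W - i"
      using W \<sigma> fin by (simp add: mon_degree_squarefree_exponent card_Diff_subset)
    then have "f \<sigma> \<in> free_grade W {0} (\<lambda>_. 0) (int (card W) - int i)"
      using i by (auto simp: free_grade_def f_coeff keys)
    moreover have "supported_part \<Gamma> (f \<sigma>) = f \<sigma>"
      by (rule free_eqI) (auto simp: f_coeff keys)
    ultimately show "f \<sigma> \<in> N \<inter> free_grade W {0} (\<lambda>_. 0) (int (card W) - int i)"
      using free_grade_subset unfolding N by blast
  next
    fix \<tau> assume \<tau>: "\<tau> \<subseteq> W" "Suc (card \<tau>) = i"
    define \<rho> where "\<rho> = W - \<tau>"
    have \<rho>: "finite \<rho>" "\<rho> \<subseteq> W" "W - \<tau> = \<rho>" using W by (auto simp: \<rho>_def)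
    have W_ins: "W - insert v \<tau> = \<rho> - {v}" for v by (auto simp: \<rho>_def)
    have card_\<rho>: "card \<rho> = Suc k" using \<tau> i fin[OF \<tau>(1)] by (simp add: \<rho>_def card_Diff_subset)
    \<comment> \<open>The only possible coefficient is at the monomial of \<open>\<rho>\<close>. It
      survives truncation only if \<open>\<rho>\<close> is a face, and then it is, up to sign, the
      coboundary of \<open>\<chi>\<close>.\<close>
    show "koszul_supported W \<Gamma> f \<tau> = 0"
    proof (rule free_eqI)
      fix b m
      have "free_coeff (koszul_supported W \<Gamma> f \<tau>) b m
          = (\<Sum>v\<in>\<rho>. if \<rho> \<in> \<Gamma> \<and> b = 0 \<and> m = ?x \<rho>
               then alternate (E \<tau>) (alternate (card {w\<in>\<rho>. w < v}) (\<chi> (\<rho> - {v}))) else 0)"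
        unfolding coeff_koszul \<rho>(3)
      proof (rule sum.cong[OF refl])
        fix v assume v: "v \<in> \<rho>"
        have eq: "m - Poly_Mapping.single v 1 = ?x (\<rho> - {v}) \<longleftrightarrow> m = ?x \<rho>" if "v \<in> Poly_Mapping.keys m"
          using minus_single_eq_squarefree_exponent_iff[OF \<rho>(1) v that] .
        have sign: "alternate (card {w\<in>\<tau>. w < v}) (alternate (E (insert v \<tau>)) y)
            = alternate (E \<tau>) (alternate (card {w\<in>\<rho>. w < v}) y)" for y :: 'k
          unfolding alternate_alternate
          by (rule alternate_cong_parity) (use E_insert[OF \<tau>(1), of v] v in \<open>auto simp: \<rho>_def\<close>)
        have keys: "Poly_Mapping.keys (?x \<rho>) = \<rho>" using \<rho>(1) by (rule keys_squarefree_exponent)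
        show "alternate (card {w\<in>\<tau>. w < v}) (if Poly_Mapping.keys m \<in> \<Gamma> \<and> v \<in> Poly_Mapping.keys m
              then free_coeff (f (insert v \<tau>)) b (m - Poly_Mapping.single v 1) else 0)
            = (if \<rho> \<in> \<Gamma> \<and> b = 0 \<and> m = ?x \<rho>
               then alternate (E \<tau>) (alternate (card {w\<in>\<rho>. w < v}) (\<chi> (\<rho> - {v}))) else 0)"
        proof (cases "m = ?x \<rho>")
          case True
          then show ?thesis
            using v eq keys face[of \<rho> "\<rho> - {v}"] by (auto simp: f_coeff W_ins sign)
        next
          case False
          then show ?thesis using eq by (auto simp: f_coeff W_ins)
        qed
      qed
      also have "\<dots> = 0"
        using cocycle[OF _ card_\<rho>] by (cases "\<rho> \<in> \<Gamma> \<and> b = 0 \<and> m = ?x \<rho>") (auto simp: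
            alternate_sum[symmetric])
      finally show "free_coeff (koszul_supported W \<Gamma> f \<tau>) b m = free_coeff 0 b m" by simp
    qed
  qed
  then obtain g where g: "\<And>\<sigma>. \<sigma> \<subseteq> W \<Longrightarrow> card \<sigma> = i \<Longrightarrow> f \<sigma> = koszul_supported W \<Gamma> g \<sigma>" by blast
  \<comment> \<open>Only the coefficients of \<open>g\<close> in multidegree
    \<open>(1,...,1)\<close> are read off, so homogeneity of \<open>g\<close> is immaterial.\<close>
  define \<psi> where "\<psi> \<rho> = alternate (E (W - \<rho>)) (free_coeff (g (W - \<rho>)) 0 (?x \<rho>))" for \<rho>
  have coboundary: "\<chi> \<rho> = (\<Sum>v\<in>\<rho>. alternate (card {w\<in>\<rho>. w < v}) (\<psi> (\<rho> - {v})))"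
    if \<rho>: "\<rho> \<in> \<Gamma>" "card \<rho> = k" for \<rho>
  proof -
    define \<sigma> where "\<sigma> = W - \<rho>"
    have \<rho>W: "\<rho> \<subseteq> W" "finite \<rho>" using face_W[OF \<rho>(1)] fin by auto
    have \<sigma>: "\<sigma> \<subseteq> W" "card \<sigma> = i" "W - \<sigma> = \<rho>"
      using \<rho>W \<rho>(2) i by (auto simp: \<sigma>_def card_Diff_subset)
    have keys: "Poly_Mapping.keys (?x \<rho>) = \<rho>" using \<rho>W(2) by (rule keys_squarefree_exponent)
    have "alternate (E \<sigma>) (\<chi> \<rho>) = free_coeff (f \<sigma>) 0 (?x \<rho>)"
      using \<rho>(1) \<sigma>(3) by (simp add: f_coeff)
    also have "\<dots> = (\<Sum>v\<in>\<rho>. alternate (E \<sigma>) (alternate (card {w\<in>\<rho>. w < v}) (\<psi> (\<rho> - {v}))))"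
      unfolding g[OF \<sigma>(1,2)] coeff_koszul \<sigma>(3)
    proof (rule sum.cong[OF refl])
      fix v assume v: "v \<in> \<rho>"
      have ins: "W - (\<rho> - {v}) = insert v \<sigma>" using v \<rho>W by (auto simp: \<sigma>_def)
      have x: "?x \<rho> - Poly_Mapping.single v 1 = ?x (\<rho> - {v})"
        using minus_single_eq_squarefree_exponent_iff[OF \<rho>W(2) v, of "?x \<rho>"] v keys by simp
      have sign: "alternate (E \<sigma>) (alternate (card {w\<in>\<rho>. w < v}) (alternate (E (insert v \<sigma>)) y))
          = alternate (card {w\<in>\<sigma>. w < v}) y" for y :: 'k
        unfolding alternate_alternate
        by (rule alternate_cong_parity) (use E_insert[OF \<sigma>(1), of v] v \<rho>W \<sigma> in auto)
      show "alternate (card {w\<in>\<sigma>. w < v}) (if Poly_Mapping.keys (?x \<rho>) \<in> \<Gamma> \<and> v \<in> Poly_Mapping.keys (?x \<rho>)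
            then free_coeff (g (insert v \<sigma>)) 0 (?x \<rho> - Poly_Mapping.single v 1) else 0)
          = alternate (E \<sigma>) (alternate (card {w\<in>\<rho>. w < v}) (\<psi> (\<rho> - {v})))"
        unfolding \<psi>_def ins sign x keys using v \<rho>(1) by simp
    qed
    finally have "alternate (E \<sigma>) (\<chi> \<rho>) = alternate (E \<sigma>) (\<Sum>v\<in>\<rho>. alternate (card {w\<in>\<rho>. w < v}) (\<psi> (\<rho>
        - {v})))"
      by (simp add: alternate_sum)
    then show ?thesis by (auto simp: alternate_def split: if_splits)
  qed
  \<comment> \<open>On the faces of size \<open>k\<close> the cochain \<open>\<chi>\<close> is a
    coboundary, so its pairing with the cycle \<open>w\<close> is zero.\<close>
  have "(\<Sum>\<sigma>\<in>Poly_Mapping.keys w. Poly_Mapping.lookup w \<sigma> * \<chi> \<sigma>)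
      = (\<Sum>\<sigma>\<in>Poly_Mapping.keys w. Poly_Mapping.lookup w \<sigma> * (\<Sum>v\<in>\<sigma>. alternate (card {u\<in>\<sigma>. u < v}) (\<psi>
          (\<sigma> - {v}))))"
    using w(1) coboundary by (intro sum.cong refl) (auto simp: simplicial_chains_def)
  also have "\<dots> = (\<Sum>\<tau>\<in>Pow W. Poly_Mapping.lookup (simplicial_boundary w) \<tau> * \<psi> \<tau>)"
    by (rule pairing_simplicial_boundary[OF W simplicial_chains_keys[OF \<Gamma> w(1)], symmetric])
  also have "\<dots> = 0" using w(2) by simp
  finally show False using \<chi>(2) by blast
qed

section \<open>From a missing generator to vanishing Koszul homology, and the bound\<close>

text \<open>Shifts the indices so that the augmentation is map 0 and \<open>res_map F q\<close> is
  map \<open>Suc q\<close>. Each kernel is the image of a differential, so minimality says that it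
  has no constant coefficients.\<close>

lemma minimal_resolution_free_homs:
  fixes W :: "'v::linorder set" and F :: "('v, 'k::field, ('v, 'k) mpoly set) free_complex"
  assumes \<Gamma>: "simplicial_complex_on W \<Gamma>"
    and F: "minimal_graded_free_resolution W (stanley_reisner_ring TYPE('k) W \<Gamma>) F"
  shows "\<exists>\<phi> :: nat \<Rightarrow> (nat \<Rightarrow>\<^sub>0 ('v, 'k) mpoly) \<Rightarrow> (nat \<Rightarrow>\<^sub>0 ('v, 'k) mpoly).
    free_hom W \<Gamma> (res_basis F 0) (res_degree F 0) {0} (\<lambda>_. 0) (\<phi> 0) \<and>
    \<phi> 0 ` free_carrier W (res_basis F 0) = {x \<in> free_carrier W {0}. supported_part \<Gamma> x = x} \<and>
    (\<forall>q. free_hom W UNIV (res_basis F (Suc q)) (res_degree F (Suc q)) (res_basis F q) (res_degree F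
        q) (\<phi> (Suc q))) \<and>
    (\<forall>q. {x \<in> free_carrier W (res_basis F q). \<phi> q x = 0} = \<phi> (Suc q) ` free_carrier W (res_basis F
        (Suc q))) \<and>
    (\<forall>q x b. x \<in> free_carrier W (res_basis F q) \<longrightarrow> \<phi> q x = 0 \<longrightarrow> free_coeff x b 0 = 0)"
proof -
  let ?M = "stanley_reisner_ring TYPE('k) W \<Gamma>"
  let ?C = "\<lambda>q. free_carrier W (res_basis F q) :: (nat \<Rightarrow>\<^sub>0 ('v, 'k) mpoly) set"
  have aug: "res_aug F \<in> graded_hom (poly_ring W) (graded_free_module W (res_basis F 0) (res_degree
      F 0)) ?M"
    "res_aug F ` ?C 0 = carrier ?M"
    and maps: "\<And>q. free_hom W UNIV (res_basis F (Suc q)) (res_degree F (Suc q)) (res_basis F q)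
        (res_degree F q) (res_map F q)"
    and exact0: "{x \<in> ?C 0. res_aug F x = \<zero>\<^bsub>?M\<^esub>} = res_map F 0 ` ?C 1"
    and exact: "\<And>q. {x \<in> ?C (Suc q). res_map F q x = 0} = res_map F (Suc q) ` ?C (Suc (Suc q))"
    and min: "\<And>q x b. x \<in> ?C (Suc q) \<Longrightarrow> free_coeff (res_map F q x) b 0 = 0"
    using F unfolding minimal_graded_free_resolution_def res_module_def graded_hom_iff_free_hom
    by (simp_all add: irrelevant_ideal_def free_coeff_def)
  define \<phi> where "\<phi> q = (case q of 0 \<Rightarrow> \<lambda>x. sr_normal_form W \<Gamma> (res_aug F x) | Suc q \<Rightarrow> res_map F q)" for q
  have \<phi>_simps [simp]: "\<phi> 0 = (\<lambda>x. sr_normal_form W \<Gamma> (res_aug F x))" "\<phi> (Suc q) = res_map F q" for q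
    by (simp_all add: \<phi>_def)
  note normal = augmentation_normal_form[OF \<Gamma> aug]
  have kernels: "{x \<in> ?C q. \<phi> q x = 0} = \<phi> (Suc q) ` ?C (Suc q)" for q
  proof (cases q)
    case 0
    have "{x \<in> ?C 0. \<phi> 0 x = 0} = {x \<in> ?C 0. res_aug F x = \<zero>\<^bsub>?M\<^esub>}" using normal(3) by auto
    then show ?thesis using 0 exact0 by simp
  qed (use exact in simp)
  show ?thesis
  proof (rule exI[of _ \<phi>], intro conjI allI impI)
    fix q x b assume "x \<in> ?C q" "\<phi> q x = 0"
    then have "x \<in> \<phi> (Suc q) ` ?C (Suc q)" using kernels[of q] by blast
    then show "free_coeff x b 0 = 0" using min by auto
  qed (use normal maps kernels in simp_all)
qed

text \<open>The part of Hochster's formula for the full vertex set that bounds the regularity from below.\<close>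

lemma regularity_stanley_reisner_ge:
  fixes W :: "'v::{linorder,countable} set" and w :: "'v set \<Rightarrow>\<^sub>0 'k::field"
  assumes \<Gamma>: "simplicial_complex_on W \<Gamma>"
    and w: "w \<in> simplicial_chains (h - 1) \<Gamma>" "simplicial_boundary w = 0"
      "w \<notin> simplicial_boundary ` simplicial_chains h \<Gamma>"
  shows "regularity W (stanley_reisner_ring TYPE('k) W \<Gamma>) \<ge> ereal (of_int h)"
proof -
  let ?M = "stanley_reisner_ring TYPE('k) W \<Gamma>"
  have W: "finite W" using \<Gamma> by (simp add: simplicial_complex_on_def)
  \<comment> \<open>The zero chain bounds, so \<open>w\<close> involves a face of cardinality
    \<open>h\<close>; hence \<open>h\<close> is not negative and the complex is not void.\<close>
  have "w \<noteq> 0" using w(3) by (metis image_eqI simplicial_boundary_0 simplicial_chains_0)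
  then obtain \<sigma> where "\<sigma> \<in> Poly_Mapping.keys w" by (metis all_not_in_conv keys_eq_empty)
  then have \<sigma>: "\<sigma> \<in> \<Gamma>" "int (card \<sigma>) = h" using w(1) by (auto simp: simplicial_chains_def)
  then have "{} \<in> \<Gamma>" "\<sigma> \<subseteq> W" using \<Gamma> by (auto simp: simplicial_complex_on_def)
  define k where "k = card \<sigma>"
  have h: "h = int k" using \<sigma> by (simp add: k_def)
  \<comment> \<open>Faces of size \<open>k\<close> sit at index sets of the complementary
    size.\<close>
  define i where "i = card W - k"
  have ik: "i + k = card W" using card_mono[OF W \<open>\<sigma> \<subseteq> W\<close>] by (simp add: i_def k_def)
  let ?j = "int (card W)"
  define F where "F = (SOME F. minimal_graded_free_resolution W ?M F)"
  have F: "minimal_graded_free_resolution W ?M F"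
    unfolding F_def using minimal_resolution_exists[OF \<Gamma> \<open>{} \<in> \<Gamma>\<close>] by (rule someI_ex)
  let ?B = "res_basis F" and ?\<delta> = "res_degree F"
  from minimal_resolution_free_homs[OF \<Gamma> F] obtain \<phi> :: "nat \<Rightarrow> (nat \<Rightarrow>\<^sub>0 ('v, 'k) mpoly) \<Rightarrow> (nat \<Rightarrow>\<^sub>0
      ('v, 'k) mpoly)" where
    hom_all: "free_hom W \<Gamma> (?B 0) (?\<delta> 0) {0} (\<lambda>_. 0) (\<phi> 0)"
    "\<phi> 0 ` free_carrier W (?B 0) = {x \<in> free_carrier W {0}. supported_part \<Gamma> x = x}"
    "\<forall>q. free_hom W UNIV (?B (Suc q)) (?\<delta> (Suc q)) (?B q) (?\<delta> q) (\<phi> (Suc q))"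
    "\<forall>q. {x \<in> free_carrier W (?B q). \<phi> q x = 0} = \<phi> (Suc q) ` free_carrier W (?B (Suc q))"
    "\<forall>q x b. x \<in> free_carrier W (?B q) \<longrightarrow> \<phi> q x = 0 \<longrightarrow> free_coeff x b 0 = 0"
    by (elim exE conjE) (rule that)
  note \<phi> = hom_all(1,2) hom_all(3)[rule_format] hom_all(4)[rule_format] hom_all(5)[rule_format]
  \<comment> \<open>The ring lives on a single index of degree 0; from there finiteness and
    nonnegativity pass from each map to the next along the resolution.\<close>
  have fin: "finite {b \<in> ?B q. ?\<delta> q b = j} \<and> (\<forall>b\<in>?B q. 0 \<le> ?\<delta> q b)" for q j
  proof (induction q arbitrary: j)
    case 0
    show ?case using free_hom.finite_generators[OF \<phi>(1) W _ _ \<phi>(5)] by auto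
  next
    case (Suc q)
    have nonneg: "\<And>b. b \<in> ?B q \<Longrightarrow> 0 \<le> ?\<delta> q b" and fin: "\<And>j. finite {b \<in> ?B q. ?\<delta> q b = j}"
      using Suc by auto
    interpret free_hom W UNIV "?B (Suc q)" "?\<delta> (Suc q)" "?B q" "?\<delta> q" "\<phi> (Suc q)" by (rule \<phi>(3))
    show ?case using finite_generators[OF W nonneg fin \<phi>(5)] by auto
  qed
  \<comment> \<open>Uniform names for all maps: only the augmentation, with index 0, has a truncated
    target.\<close>
  define \<Gamma>' where "\<Gamma>' q = (if q = 0 then \<Gamma> else UNIV)" for q :: nat
  define B' where "B' q = (if q = 0 then {0} else ?B (q - 1))" for q
  define \<delta>' where "\<delta>' q = (if q = 0 then (\<lambda>_. 0) else ?\<delta> (q - 1))" for q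
  have hom: "free_hom W (\<Gamma>' q) (?B q) (?\<delta> q) (B' q) (\<delta>' q) (\<phi> q)" for q
    using \<phi>(1,3) by (cases q) (simp_all add: \<Gamma>'_def B'_def \<delta>'_def)
  have "{b \<in> ?B i. ?\<delta> i b = ?j} \<noteq> {}"
  proof
    assume none: "{b \<in> ?B i. ?\<delta> i b = ?j} = {}"
    \<comment> \<open>Koszul degree \<open>r\<close> is paired with the image of map
      \<open>i - r\<close>, always in total degree \<open>card W\<close>. The missing generators are
      used at \<open>r = 0\<close>, and at \<open>r = i\<close> the image is the ring
      itself.\<close>
    have "koszul_acyclic W (\<Gamma>' (i - r)) (\<phi> (i - r) ` free_carrier W (?B (i - r)) \<inter>
        free_grade W (B' (i - r)) (\<delta>' (i - r)) (?j - int r)) (\<phi> (i - r) ` free_carrier W (?B (i - r))) r"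
      if "r \<le> i" for r
      using that
    proof (induction r)
      case 0
      interpret free_hom W "\<Gamma>' i" "?B i" "?\<delta> i" "B' i" "\<delta>' i" "\<phi> i" by (rule hom)
      show ?case using koszul_acyclic_image_0[OF W, of ?j] none by auto
    next
      case (Suc r)
      define q where "q = i - Suc r"
      have q: "i - r = Suc q" using Suc.prems by (simp add: q_def)
      interpret free_hom W "\<Gamma>' q" "?B q" "?\<delta> q" "B' q" "\<delta>' q" "\<phi> q" by (rule hom)
      have "koszul_acyclic W UNIV ({x \<in> free_carrier W (?B q). \<phi> q x = 0} \<inter> free_grade W (?B q) (?\<delta>
          q) (?j - int r))
          {x \<in> free_carrier W (?B q). \<phi> q x = 0} r"
        using Suc unfolding q \<phi>(4) by (simp add: \<Gamma>'_def B'_def \<delta>'_def)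
      then show ?case unfolding q_def[symmetric] by (rule koszul_acyclic_image[OF W])
    qed
    from this[of i] have "koszul_acyclic W \<Gamma> ({x \<in> free_carrier W {0}. supported_part \<Gamma> x = x} \<inter>
        free_grade W {0} (\<lambda>_. 0) (?j - int i)) {x \<in> free_carrier W {0::nat}. supported_part \<Gamma> x = (x
            :: nat \<Rightarrow>\<^sub>0 ('v, 'k) mpoly)} i"
      by (simp add: \<Gamma>'_def B'_def \<delta>'_def \<phi>(2))
    then show False
      using koszul_not_acyclic[OF \<Gamma> w[unfolded h] ik refl] by blast
  qed
  \<comment> \<open>Nonemptiness alone would not do, since an infinite set has \<open>card\<close>
    0.\<close>
  then have "card {b \<in> ?B i. ?\<delta> i b = ?j} \<noteq> 0" using fin[of i ?j] card_0_eq by blast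
  then have "graded_betti W ?M i ?j \<noteq> 0" by (simp add: graded_betti_def Let_def F_def)
  moreover have "?j - int i = h" using ik h by simp
  ultimately have "ereal (of_int h) \<in> {ereal (of_int (j - int i)) | i j. graded_betti W ?M i j \<noteq> 0}"
      by blast
  then show ?thesis unfolding regularity_def by (rule Sup_upper)
qed

theorem theorem3p3:
  fixes n :: nat and h :: int and \<Delta> :: "nat set set" and T :: "nat set"
  assumes "simplicial_complex_on {1..n} \<Delta>"
    and "vertex_minimal_cycle TYPE('k::field) h {1..n} \<Delta>"
    and "T \<subseteq> {1..n}"
    and "\<not> connected_complex (restriction \<Delta> T)"
  shows "regularity ({1..n} - T)
           (stanley_reisner_ring TYPE('k) ({1..n} - T) (restriction \<Delta> ({1..n} - T)))
         \<ge> ereal (of_int h)"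
proof -
  obtain w :: "nat set \<Rightarrow>\<^sub>0 'k" where w: "w \<in> simplicial_chains (h - 1) (restriction \<Delta> ({1..n} - T))"
    "simplicial_boundary w = 0"
    "w \<notin> simplicial_boundary ` simplicial_chains h (restriction \<Delta> ({1..n} - T))"
    using nonbounding_cycle_off_disconnected[OF assms] by blast
  show ?thesis
    by (rule regularity_stanley_reisner_ge[OF simplicial_complex_restriction[OF assms(1)] w]) blast
qed

end
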